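(* Let $f_1,\dots,f_r\in\mathbb C[z_1,\dots,z_n]\setminus\mathbb C$ be homogeneous polynomials of degree one. Suppose that $A=\{f_1f_2\cdots f_r=0\}\subseteq\mathbb C^n$ is a central essential indecomposable hyperplane arrangement. Let $\varphi\in C_c^\infty(\mathbb C^n)$ be such that $\varphi(\mathbf 0)>0$ and $\varphi\ge 0$. Then there is a non-empty analytically open subset $U\subseteq\{(a_1,\dots,a_r)\in\mathbb C^r\mid \sum_{i=1}^r a_i=1\}$ such that for every $\mathbf a=(a_1,\dots,a_r)\in\mathbb N_{>0}^r$ with $\left(\frac{a_1}{\sum_{i=1}^r a_i},\dots,\frac{a_r}{\sum_{i=1}^r a_i}\right)\in U$, the number $-n/\sum_{i=1}^r a_i$ is a pole of $Z_{\mathbf f^{\mathbf a},\varphi}(s)$, where $\mathbf f^{\mathbf a}:=f_1^{a_1}\cdots f_r^{a_r}$. In particular, for such $\mathbf a$, $-n/\sum_{i=1}^r a_i$ is a root of the Bernstein-Sato polynomial $b_{\mathbf f^{\mathbf a}}(s)$.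
   Context: $C_c^\infty(\mathbb C^n)$ is the space of compactly supported complex-valued $C^\infty$ functions on $\mathbb C^n$ (smooth in the real sense). Hyperplane arrangements: let $A=\{f=0\}=\bigcup_i V_i\subseteq\mathbb C^n$ be a finite union of hyperplanes. $A$ is central if $\mathbf 0\in V_i$ for all $i$; essential if $\bigcap_i V_i=\{\mathbf 0\}$; decomposable if, after a linear coordinate change, $f$ can be written as the product of two non-constant polynomials in two disjoint sets of variables; indecomposable otherwise. Archimedean zeta function: for $f\in\mathbb C[z_1,\dots,z_n]\setminus\mathbb C$ and $\varphi\in C_c^\infty(\mathbb C^n)$, $Z_{f,\varphi}(s)$ is the meromorphic extension to $\mathbb C$ of the function $s\mapsto \int_{\mathbb C^n}|f|^{2s}\varphi\,\mathrm d\mathbf z$ on $\{s\in\mathbb C\mid \mathrm{Re}\,s>0\}$, where $\mathrm d\mathbf z=(\frac{\sqrt{-1}}2)^n\mathrm dz_1\wedge\mathrm d\bar z_1\wedge\cdots\wedge\mathrm dz_n\wedge\mathrm d\bar z_n$ (Lebesgue measure). Bernstein-Sato polynomial: $b_f(s)\in\mathbb C[s]$ is the monic polynomial of smallest degree for which there is $P\in A_n[s]=A_n\otimes_{\mathbb C}\mathbb C[s]$ ($A_n$ the Weyl algebra of $\mathbb C[z_1,\dots,z_n]$) with $P\cdot(f\cdot f^s)=b_f(s)\cdot f^s$ in $\mathbb C[z_1,\dots,z_n,\frac1f,s]\cdot f^s$. A subset of a complex manifold $M$ is analytically open if its complement is a closed complex analytic subset of $M$. *)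

theory Defs
  imports
    "HOL-Complex_Analysis.Complex_Analysis"
    "HOL-Library.Poly_Mapping"
    "HOL-Library.Complex_Order"
    "HOL-Computational_Algebra.Polynomial_Factorial"
begin

section \<open>Polynomials in several variables\<close>

text \<open>
  The polynomial ring over the complex numbers with variables indexed by \<open>'n\<close>: a finitely
  supported map from exponent vectors to coefficients.
\<close>

type_synonym 'n cpoly = "('n \<Rightarrow>\<^sub>0 nat) \<Rightarrow>\<^sub>0 complex"

definition Const :: "complex \<Rightarrow> 'n cpoly" where
  "Const c = Poly_Mapping.single 0 c"

definition Var :: "'n \<Rightarrow> 'n cpoly" where
  "Var i = Poly_Mapping.single (Poly_Mapping.single i 1) 1"

text \<open>Evaluation in an algebra with structure map \<open>h\<close>, the variable \<open>i\<close> being sent to \<open>x i\<close>.\<close>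

definition eval_in :: "(complex \<Rightarrow> 'b) \<Rightarrow> ('n \<Rightarrow> 'b) \<Rightarrow> ('n::finite) cpoly \<Rightarrow> 'b::comm_ring_1" where
  "eval_in h x p =
     (\<Sum>m\<in>Poly_Mapping.keys p. h (Poly_Mapping.lookup p m) * (\<Prod>i\<in>UNIV. x i ^ Poly_Mapping.lookup m i))"

definition peval :: "('n::finite) cpoly \<Rightarrow> complex ^ 'n \<Rightarrow> complex" where
  "peval p z = eval_in (\<lambda>c. c) (\<lambda>i. z $ i) p"

definition lin_subst :: "complex ^ 'n ^ 'n \<Rightarrow> ('n::finite) cpoly \<Rightarrow> 'n cpoly" where
  "lin_subst L p = eval_in Const (\<lambda>i. \<Sum>j\<in>UNIV. Const (L $ i $ j) * Var j) p"

definition constant_poly :: "'n cpoly \<Rightarrow> bool" where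
  "constant_poly p \<longleftrightarrow> (\<exists>c. p = Const c)"

definition homogeneous :: "nat \<Rightarrow> ('n::finite) cpoly \<Rightarrow> bool" where
  "homogeneous d p \<longleftrightarrow> (\<forall>m\<in>Poly_Mapping.keys p. (\<Sum>i\<in>UNIV. Poly_Mapping.lookup m i) = d)"

definition vars :: "'n cpoly \<Rightarrow> 'n set" where
  "vars p = (\<Union>m\<in>Poly_Mapping.keys p. Poly_Mapping.keys m)"

definition pderiv_var :: "'n \<Rightarrow> 'n cpoly \<Rightarrow> 'n cpoly" where
  "pderiv_var i p =
     (\<Sum>m\<in>Poly_Mapping.keys p.
        Poly_Mapping.single (m - Poly_Mapping.single i 1)
          (of_nat (Poly_Mapping.lookup m i) * Poly_Mapping.lookup p m))"


section \<open>Hyperplane arrangements\<close>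

definition zero_locus :: "('n::finite) cpoly \<Rightarrow> (complex ^ 'n) set" where
  "zero_locus p = {z. peval p z = 0}"

text \<open>The first two predicates refer to the family of hyperplanes of the arrangement.\<close>

definition central :: "(complex ^ 'n) set set \<Rightarrow> bool" where
  "central H \<longleftrightarrow> (\<forall>V\<in>H. 0 \<in> V)"

definition essential :: "(complex ^ 'n) set set \<Rightarrow> bool" where
  "essential H \<longleftrightarrow> \<Inter>H = {0}"

definition decomposable :: "('n::finite) cpoly \<Rightarrow> bool" where
  "decomposable f \<longleftrightarrow>
     (\<exists>L g h. invertible L \<and> lin_subst L f = g * h \<and>
        \<not> constant_poly g \<and> \<not> constant_poly h \<and> vars g \<inter> vars h = {})"


section \<open>Test functions\<close>

fun Ck :: "nat \<Rightarrow> ('a::real_normed_vector \<Rightarrow> 'b::real_normed_vector) \<Rightarrow> bool" where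
  "Ck 0 \<phi> \<longleftrightarrow> continuous_on UNIV \<phi>"
| "Ck (Suc k) \<phi> \<longleftrightarrow>
     (\<forall>x. \<phi> differentiable (at x)) \<and> (\<forall>v. Ck k (\<lambda>x. frechet_derivative \<phi> (at x) v))"

definition test_function :: "(complex ^ 'n::finite \<Rightarrow> complex) \<Rightarrow> bool" where
  "test_function \<phi> \<longleftrightarrow> (\<forall>k. Ck k \<phi>) \<and> compact (closure (support_on UNIV \<phi>))"


section \<open>The archimedean zeta function\<close>

text \<open>
  The values are pinned down by \<open>nicely_meromorphic_on\<close>: poles get the value \<open>0\<close> and there are
  no removable singularities, so that the extension is unique as a function on the whole plane.
\<close>

definition archimedean_zeta ::
    "('n::finite) cpoly \<Rightarrow> (complex ^ 'n \<Rightarrow> complex) \<Rightarrow> complex \<Rightarrow> complex" where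
  "archimedean_zeta f \<phi> =
     (THE Z. Z nicely_meromorphic_on UNIV \<and>
        (\<forall>s. Re s > 0 \<longrightarrow>
           Z s = (LINT z|lborel. of_real (norm (peval f z)) powr (2 * s) * \<phi> z)))"

lemma nicely_meromorphic_extension_unique:
  assumes F: "F nicely_meromorphic_on UNIV" and G: "G nicely_meromorphic_on UNIV"
    and eq: "\<And>s. Re s > 0 \<Longrightarrow> F s = (G s :: complex)"
  shows "F = G"
proof
  fix z
  have mer: "(\<lambda>s. F s - G s) meromorphic_on UNIV"
    using F G by (auto simp: nicely_meromorphic_on_def intro!: meromorphic_intros)
  have "\<forall>\<^sub>F s in at (1::complex). s \<in> {s. Re s > 0}"
    by (intro eventually_at_in_open') (auto simp: open_halfspace_Re_gt)
  hence *: "\<forall>\<^sub>F s in at (1::complex). F s - G s = 0"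
    by eventually_elim (simp add: eq)
  have "\<not> (\<forall>\<^sub>\<approx>s\<in>UNIV. F s - G s \<noteq> 0)"
  proof
    assume "\<forall>\<^sub>\<approx>s\<in>UNIV. F s - G s \<noteq> 0"
    hence "\<forall>\<^sub>F s in at (1::complex). F s - G s \<noteq> 0"
      by (simp add: eventually_cosparse_open_eq)
    with * have "\<forall>\<^sub>F s in at (1::complex). False"
      by eventually_elim auto
    thus False by simp
  qed
  hence "\<forall>\<^sub>\<approx>s\<in>UNIV. F s - G s = 0"
    using meromorphic_imp_constant_or_avoid[OF mer, of 0] connected_UNIV by auto
  hence ev: "\<forall>\<^sub>F s in at z. F s = G s"
    by (simp add: eventually_cosparse_open_eq)
  have cF: "is_pole F z \<and> F z = 0 \<or> F \<midarrow>z\<rightarrow> F z"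
    and cG: "is_pole G z \<and> G z = 0 \<or> G \<midarrow>z\<rightarrow> G z"
    using F G by (auto simp: nicely_meromorphic_on_def)
  show "F z = G z"
  proof (cases "is_pole F z")
    case True
    moreover from this have "is_pole G z"
      using ev is_pole_cong by blast
    ultimately show ?thesis
      using cF cG by (metis is_pole_def at_neq_bot not_tendsto_and_filterlim_at_infinity)
  next
    case False
    moreover from this have "\<not> is_pole G z"
      using ev is_pole_cong by blast
    ultimately have "F \<midarrow>z\<rightarrow> F z" "G \<midarrow>z\<rightarrow> G z"
      using cF cG by auto
    thus ?thesis
      using ev tendsto_cong LIM_unique by metis
  qed
qed


section \<open>The Bernstein-Sato polynomial\<close>

text \<open>
  \<open>C[z][s]\<close> is modelled as \<open>'n cpoly poly\<close>, the variable of \<open>poly\<close> being \<open>s\<close>.  The linear order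
  on the index type of the variables is only there because the library needs it to turn
  \<open>'n cpoly\<close> into an integral domain.
\<close>

type_synonym 'n cpoly_s = "'n cpoly poly"

definition pderiv_s :: "'n \<Rightarrow> 'n cpoly_s \<Rightarrow> 'n cpoly_s" where
  "pderiv_s i = map_poly (pderiv_var i)"

lemma pderiv_var_superset:
  assumes "finite S" "Poly_Mapping.keys p \<subseteq> S"
  shows "pderiv_var i p =
     (\<Sum>m\<in>S. Poly_Mapping.single (m - Poly_Mapping.single i 1)
        (of_nat (Poly_Mapping.lookup m i) * Poly_Mapping.lookup p m))"
  unfolding pderiv_var_def
  by (rule sum.mono_neutral_left) (use assms in \<open>auto simp: in_keys_iff\<close>)

lemma pderiv_var_add: "pderiv_var i (p + q) = pderiv_var i p + pderiv_var i q"
proof -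
  let ?S = "Poly_Mapping.keys p \<union> Poly_Mapping.keys q"
  show ?thesis
    using keys_add[of p q]
    by (simp add: pderiv_var_superset[of ?S] lookup_add distrib_left single_add sum.distrib)
qed

lemma pderiv_var_0 [simp]: "pderiv_var i 0 = 0"
  by (simp add: pderiv_var_def)

lemma pderiv_var_sum: "pderiv_var i (sum g A) = (\<Sum>x\<in>A. pderiv_var i (g x))"
  by (induction A rule: infinite_finite_induct) (simp_all add: pderiv_var_add)

lemma pderiv_var_single:
  "pderiv_var i (Poly_Mapping.single m c) =
     Poly_Mapping.single (m - Poly_Mapping.single i 1) (of_nat (Poly_Mapping.lookup m i) * c)"
  by (subst pderiv_var_superset[of "{m}"]) auto

lemma cpoly_sum_monomials:
  "p = (\<Sum>m\<in>Poly_Mapping.keys p. Poly_Mapping.single m (Poly_Mapping.lookup p m))"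
  by (rule poly_mapping_eqI)
    (auto simp: lookup_sum lookup_single when_def in_keys_iff)

lemma pderiv_var_mult_single:
  "pderiv_var i (Poly_Mapping.single m c * Poly_Mapping.single l d) =
     pderiv_var i (Poly_Mapping.single m c) * Poly_Mapping.single l d +
     Poly_Mapping.single m c * pderiv_var i (Poly_Mapping.single l d)"
proof -
  define e where "e = Poly_Mapping.single i (1::nat)"
  have shift: "m + l - e = (m - e) + l" if "Poly_Mapping.lookup m i \<noteq> 0" for m l :: "'a \<Rightarrow>\<^sub>0 nat"
    using that by (intro poly_mapping_eqI) (auto simp: lookup_add lookup_minus lookup_single when_def e_def)
  have 1: "Poly_Mapping.single (m + l - e) (of_nat (Poly_Mapping.lookup m i) * x) =
      Poly_Mapping.single ((m - e) + l) (of_nat (Poly_Mapping.lookup m i) * x)" for x :: complex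
    by (cases "Poly_Mapping.lookup m i = 0") (simp_all add: shift)
  have 2: "Poly_Mapping.single (m + l - e) (of_nat (Poly_Mapping.lookup l i) * x) =
      Poly_Mapping.single (m + (l - e)) (of_nat (Poly_Mapping.lookup l i) * x)" for x :: complex
    using shift[of l m] by (cases "Poly_Mapping.lookup l i = 0") (simp_all add: add.commute)
  show ?thesis
    using 1[of "c * d"] 2[of "c * d"]
    by (simp add: e_def mult_single pderiv_var_single lookup_add single_add algebra_simps)
qed

lemma pderiv_var_mult: "pderiv_var i (p * q) = pderiv_var i p * q + p * pderiv_var i q"
proof -
  let ?a = "\<lambda>m. Poly_Mapping.single m (Poly_Mapping.lookup p m)"
  let ?b = "\<lambda>m. Poly_Mapping.single m (Poly_Mapping.lookup q m)"
  have p: "p = sum ?a (Poly_Mapping.keys p)" and q: "q = sum ?b (Poly_Mapping.keys q)"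
    by (rule cpoly_sum_monomials)+
  have "pderiv_var i (sum ?a (Poly_Mapping.keys p) * sum ?b (Poly_Mapping.keys q)) =
      pderiv_var i (sum ?a (Poly_Mapping.keys p)) * sum ?b (Poly_Mapping.keys q) +
      sum ?a (Poly_Mapping.keys p) * pderiv_var i (sum ?b (Poly_Mapping.keys q))"
    by (simp add: sum_product pderiv_var_sum pderiv_var_mult_single sum.distrib)
  thus ?thesis
    by (simp flip: p q)
qed

lemma pderiv_s_mult: "pderiv_s i (p * q) = pderiv_s i p * q + p * pderiv_s i q"
  by (rule poly_eqI)
    (simp add: pderiv_s_def coeff_map_poly coeff_mult pderiv_var_sum pderiv_var_mult sum.distrib)

text \<open>The extension of \<open>pderiv_s i\<close> to the field of fractions by the quotient rule.\<close>

definition fderiv :: "'n \<Rightarrow> ('n::linorder) cpoly_s fract \<Rightarrow> 'n cpoly_s fract" where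
  "fderiv i u =
     (THE v. \<forall>a b. b \<noteq> 0 \<and> u = Fract a b \<longrightarrow> v = Fract (pderiv_s i a * b - a * pderiv_s i b) (b * b))"

lemma fderiv_Fract:
  assumes "b \<noteq> 0"
  shows "fderiv i (Fract a b) = Fract (pderiv_s i a * b - a * pderiv_s i b) (b * b)"
proof -
  let ?D = "pderiv_s i"
  have wd: "Fract (?D a * b - a * ?D b) (b * b) = Fract (?D c * d - c * ?D d) (d * d)"
    if nz: "d \<noteq> 0" and "Fract a b = Fract c d" for c d
  proof -
    have eq: "a * d = c * b"
      using that assms by (simp add: eq_fract)
    have D: "?D a * d + a * ?D d = ?D c * b + c * ?D b"
      using arg_cong[OF eq, of ?D] by (simp add: pderiv_s_mult)
    have "(?D a * b - a * ?D b) * (d * d) - (?D c * d - c * ?D d) * (b * b)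
        = b * d * ((?D a * d + a * ?D d) - (?D c * b + c * ?D b))
          - (a * d - c * b) * (b * ?D d + d * ?D b)"
      by (simp add: algebra_simps)
    also have "\<dots> = 0"
      using D eq by simp
    finally show ?thesis
      using nz assms by (simp add: eq_fract)
  qed
  show ?thesis
    unfolding fderiv_def
  proof (rule the_equality)
    fix v
    assume "\<forall>c d. d \<noteq> 0 \<and> Fract a b = Fract c d \<longrightarrow> v = Fract (?D c * d - c * ?D d) (d * d)"
    thus "v = Fract (?D a * b - a * ?D b) (b * b)"
      using assms by blast
  qed (use wd in blast)
qed

text \<open>
  An element \<open>u \<cdot> f\<^sup>s\<close> of \<open>C[z, 1/f, s] \<cdot> f\<^sup>s\<close> is represented by its coefficient \<open>u\<close>, viewed in the
  field of fractions of \<open>C[z][s]\<close>.  The derivation with respect to the \<open>i\<close>-th variable acts by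
  \<open>u \<cdot> f\<^sup>s \<mapsto> (\<partial>\<^sub>i u + s u \<partial>\<^sub>i f / f) \<cdot> f\<^sup>s\<close>.
\<close>

definition twisted_deriv ::
    "('n::linorder) cpoly \<Rightarrow> 'n \<Rightarrow> 'n cpoly_s fract \<Rightarrow> 'n cpoly_s fract" where
  "twisted_deriv f i u =
     fderiv i u + to_fract [:0, 1:] * u * to_fract [:pderiv_var i f:] / to_fract [:f:]"

text \<open>
  The operators by which the elements of \<open>A\<^sub>n[s]\<close> act on such coefficients: the algebra
  generated over \<open>C[z][s]\<close> by the derivations.  As \<open>A\<^sub>n\<close> is simple, \<open>A\<^sub>n[s]\<close> acts faithfully, so
  that nothing is lost in passing from its elements to these operators.
\<close>

inductive_set weyl_operators ::
    "('n::linorder) cpoly \<Rightarrow> ('n cpoly_s fract \<Rightarrow> 'n cpoly_s fract) set"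
  for f :: "'n cpoly" where
  mult: "(\<lambda>u. to_fract g * u) \<in> weyl_operators f"
| deriv: "twisted_deriv f i \<in> weyl_operators f"
| add: "P \<in> weyl_operators f \<Longrightarrow> Q \<in> weyl_operators f \<Longrightarrow> (\<lambda>u. P u + Q u) \<in> weyl_operators f"
| comp: "P \<in> weyl_operators f \<Longrightarrow> Q \<in> weyl_operators f \<Longrightarrow> P \<circ> Q \<in> weyl_operators f"

definition bernstein_sato_relation :: "('n::linorder) cpoly \<Rightarrow> complex poly \<Rightarrow> bool" where
  "bernstein_sato_relation f b \<longleftrightarrow>
     (\<exists>P\<in>weyl_operators f. P (to_fract [:f:]) = to_fract (map_poly Const b))"

definition bernstein_sato_poly :: "('n::linorder) cpoly \<Rightarrow> complex poly" where
  "bernstein_sato_poly f =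
     (THE b. lead_coeff b = 1 \<and> bernstein_sato_relation f b \<and>
        (\<forall>c. lead_coeff c = 1 \<and> bernstein_sato_relation f c \<longrightarrow> degree b \<le> degree c))"


lemma map_poly_Const_diff: "map_poly Const (b - c) = map_poly Const b - map_poly Const c"
  by (rule poly_eqI) (simp add: coeff_map_poly Const_def single_diff)

lemma map_poly_Const_smult: "map_poly Const (smult c b) = [:Const c:] * map_poly Const b"
  by (rule poly_eqI) (simp add: coeff_map_poly Const_def mult_single)

lemma bernstein_sato_relation_lincomb:
  assumes "bernstein_sato_relation f b" "bernstein_sato_relation f c"
  shows "bernstein_sato_relation f (smult k (b - c))"
proof -
  obtain P Q where PQ: "P \<in> weyl_operators f" "Q \<in> weyl_operators f"
    "P (to_fract [:f:]) = to_fract (map_poly Const b)"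
    "Q (to_fract [:f:]) = to_fract (map_poly Const c)"
    using assms by (auto simp: bernstein_sato_relation_def)
  have "(\<lambda>u. to_fract [:Const k:] * u) \<circ> (\<lambda>u. P u + ((\<lambda>u. to_fract (-1) * u) \<circ> Q) u)
      \<in> weyl_operators f" (is "?R \<in> _")
    by (intro weyl_operators.intros PQ)
  moreover have "?R (to_fract [:f:]) = to_fract (map_poly Const (smult k (b - c)))"
    using PQ(3,4) 
    by (simp add: map_poly_Const_smult map_poly_Const_diff flip: to_fract_diff to_fract_mult)
  ultimately show ?thesis
    unfolding bernstein_sato_relation_def by blast
qed

lemma bernstein_sato_unique:
  assumes b: "lead_coeff b = 1" "bernstein_sato_relation f b"
    "\<And>d. lead_coeff d = 1 \<Longrightarrow> bernstein_sato_relation f d \<Longrightarrow> degree b \<le> degree d"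
    and c: "lead_coeff c = 1" "bernstein_sato_relation f c"
    "\<And>d. lead_coeff d = 1 \<Longrightarrow> bernstein_sato_relation f d \<Longrightarrow> degree c \<le> degree d"
  shows "b = c"
proof (rule ccontr)
  assume "b \<noteq> c"
  define d where "d = smult (inverse (lead_coeff (b - c))) (b - c)"
  have "lead_coeff (b - c) \<noteq> 0"
    using \<open>b \<noteq> c\<close> by (metis eq_iff_diff_eq_0 leading_coeff_0_iff)
  hence "lead_coeff d = 1" "degree d = degree (b - c)"
    unfolding d_def lead_coeff_smult degree_smult_eq by auto
  moreover have "bernstein_sato_relation f d"
    unfolding d_def by (intro bernstein_sato_relation_lincomb b c)
  ultimately have le: "degree b \<le> degree (b - c)"
    using b(3) by metis
  have eq: "degree b = degree c"
    using b c by (simp add: antisym)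
  have "coeff (b - c) (degree b) = 0"
    using b(1) c(1) eq by simp
  moreover have "degree (b - c) = degree b"
    using le eq degree_diff_le[of b "degree b" c] by simp
  ultimately show False
    using \<open>b \<noteq> c\<close> by (metis eq_iff_diff_eq_0 leading_coeff_0_iff)
qed


section \<open>Analytically open subsets\<close>

text \<open>
  For \<open>W\<close> relatively open in a complex submanifold \<open>M\<close> of \<open>C\<^sup>r\<close>, the derivative is taken within
  \<open>W\<close>, so that this is holomorphy of \<open>g\<close> as a function on the manifold \<open>W\<close>.
\<close>

definition holomorphic_within :: "(complex ^ 'r::finite \<Rightarrow> complex) \<Rightarrow> (complex ^ 'r) set \<Rightarrow> bool" where
  "holomorphic_within g W \<longleftrightarrow>
     (\<forall>x\<in>W. \<exists>D. (g has_derivative D) (at x within W) \<and> (\<forall>c v. D (c *s v) = c * D v))"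

text \<open>
  Local equations are required around every point of \<open>M\<close>, not only of \<open>Z\<close>; this makes \<open>Z\<close> closed.
\<close>

definition analytic_subset :: "(complex ^ 'r::finite) set \<Rightarrow> (complex ^ 'r) set \<Rightarrow> bool" where
  "analytic_subset M Z \<longleftrightarrow> Z \<subseteq> M \<and>
     (\<forall>x\<in>M. \<exists>W G. openin (top_of_set M) W \<and> x \<in> W \<and> finite G \<and>
        (\<forall>g\<in>G. holomorphic_within g W) \<and> Z \<inter> W = {w\<in>W. \<forall>g\<in>G. g w = 0})"

definition analytically_open :: "(complex ^ 'r::finite) set \<Rightarrow> (complex ^ 'r) set \<Rightarrow> bool" where
  "analytically_open M U \<longleftrightarrow> U \<subseteq> M \<and> analytic_subset M (M - U)"

end

theory Submission
  imports Defs
begin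

text \<open>
  Write \<open>f\<^sub>i\<close> as the linear form \<open>l\<^sub>i\<close> and consider \<open>I(s, \<psi>) = \<integral> \<Prod>\<^sub>i |l\<^sub>i|\<^bsup>2 s\<^sub>i\<^esup> \<psi>\<close> for \<open>s \<in> C\<^sup>r\<close>.
  For a set \<open>T\<close> of indices choose a basis \<open>B \<subseteq> T\<close> of the span of its forms and dual vectors \<open>v\<^sub>i\<close>.
  The divergence \<open>\<Sum>\<^sub>i\<^sub>\<in>\<^sub>B \<partial>\<^bsub>v\<^sub>i\<^esub> (l\<^sub>i u)\<close> of \<open>u = l\<^sup>\<alpha> \<Prod> |l\<^sub>i|\<^bsup>2 s\<^sub>i\<^esup>\<close> equals \<open>(|B| + \<Sum>\<^sub>T (\<alpha>\<^sub>t + s\<^sub>t)) u\<close> up to terms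
  in which a form outside \<open>T\<close> has been traded for one in \<open>B\<close>.  Induction on \<open>T\<close> and on the degree
  of \<open>l\<^sup>\<alpha>\<close> over \<open>T\<close> reduces every \<open>l\<^sub>i u\<close> to multiples of a high power of \<open>\<Prod> l\<^sub>i\<close>, at the cost of factors
  \<open>rk T + d + \<Sum>\<^sub>T s\<^sub>t\<close> only.  For distributions this continues \<open>I(s, \<psi>)\<close> to \<open>C\<^sup>r\<close>; inside the Weyl
  algebra it proves that Bernstein-Sato polynomials exist.

  For the full index set with \<open>\<alpha> = 0\<close> the identity is exact, so \<open>(n + \<Sum> s\<^sub>i) I(s, \<phi>)\<close> is holomorphic at the points
  of the hyperplane \<open>\<Sum> s\<^sub>i = -n\<close> where no factor with \<open>T\<close> proper vanishes.  \<open>U\<close> consists of the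
  points at which, moreover, its value is not zero.  It is non-empty: indecomposability says
  that the matroid is connected, whence the average \<open>x\<close> of the indicators of the bases satisfies
  \<open>\<Sum>\<^sub>T x < rk T\<close> for all proper \<open>T\<close>.  If the value at \<open>-x\<close> were zero, \<open>I(-\<tau> x, \<phi>)\<close> would continue
  beyond \<open>\<tau> = 1\<close>, and by Landau's theorem on positive integrands \<open>\<integral> \<Prod> |l\<^sub>i|\<^bsup>-2 x\<^sub>i\<^esup> \<phi>\<close> would be finite;
  but the integrand is homogeneous of degree \<open>-2n\<close>.

  Finally, apply the functional equation to \<open>|f|\<^bsup>2s\<^esup> \<phi>\<close>: as \<open>f\<close> is divisible by some \<open>l\<^sub>i\<close>, the right hand
  side has no pole at \<open>-n / \<Sum> a\<^sub>i\<close>, so \<open>b\<^sub>f\<close> cancels the pole of the zeta function there.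
\<close>

text \<open>The difficulty is to know that a single denominator vanishes at the point in question.
  An unspecified functional equation would continue the integral but say nothing about the zeros of
  its factors. Therefore the descent keeps an explicit multiset of pairs \<open>(T, d)\<close>
  recording every factor spent. The pair \<open>(UNIV, 0)\<close> is the hyperplane itself: over the
  full index set the descent stops at degree one and never spends it, and one last exact step spends
  it once. Consequently an integral with one additional form in the integrand is free of that
  factor, which is what cancels the pole in the Bernstein-Sato argument. The descent is stated for
  an abstract predicate \<open>J\<close> because it runs twice, for distributions and in the Weyl
  algebra. The second run is forced by \<open>bernstein_sato_poly\<close> being a definite
  description: its value is known only once a nonzero relation has been exhibited. Infinitely many
  factors occur altogether, so the analyticity of the complement of U rests on a local argument:
  near a given point only finitely many of them can vanish.\<close>

no_notation fps_nth (infixl "$" 75)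

section \<open>Descent on exponents\<close>

text \<open>A pair \<open>(T, d)\<close> codes the linear factor
  \<open>rk T + d + (\<Sum>t\<in>T. s $ t)\<close>. The two conditions leave out the constant
  factors of the empty set, which could be zero, and the single factor \<open>(UNIV, 0)\<close>,
  whose zero set is the hyperplane under study.\<close>

definition admissible :: "('r set \<times> nat) multiset \<Rightarrow> bool" where
  "admissible L \<longleftrightarrow> (\<forall>(T, d)\<in>#L. T \<noteq> {} \<and> (T = UNIV \<longrightarrow> d \<ge> 1))"

lemma admissible_simps [simp]:
  "admissible {#}"
  "admissible (add_mset (T, d) L) \<longleftrightarrow> T \<noteq> {} \<and> (T = UNIV \<longrightarrow> d \<ge> 1) \<and> admissible L"
  "admissible (L + L') \<longleftrightarrow> admissible L \<and> admissible L'"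
  by (auto simp: admissible_def)

lemma admissible_sum: "(\<And>i. i \<in> A \<Longrightarrow> admissible (M i)) \<Longrightarrow> admissible (sum M A)"
  by (induction A rule: infinite_finite_induct) auto

text \<open>\<open>J L \<alpha>\<close> reads: the monomial with exponents \<alpha> is under control
  after multiplication by the factors in \<open>L\<close>. \<open>start\<close> says that a
  uniformly high exponent costs nothing; \<open>step\<close> is the divergence identity for
  \<open>T\<close>, whose terms all gain a form of \<open>bas T\<close> and may lose one outside
  \<open>T\<close>. The instances are \<open>continues K\<close> and \<open>reaches\<close>.\<close>

locale exponent_descent =
  fixes bas :: "'r::finite set \<Rightarrow> 'r set"
    and J :: "('r set \<times> nat) multiset \<Rightarrow> ('r \<Rightarrow> nat) \<Rightarrow> bool"
    and K :: nat
  assumes bas_ne: "T \<noteq> {} \<Longrightarrow> bas T \<noteq> {}"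
    and bas_sub: "bas T \<subseteq> T"
    and mono: "J L \<alpha> \<Longrightarrow> L \<subseteq># L' \<Longrightarrow> (\<And>i. \<alpha> i \<le> \<beta> i) \<Longrightarrow> J L' \<beta>"
    and start: "J {#} (\<lambda>_. K)"
    and step: "T \<noteq> {} \<Longrightarrow> (\<And>t. t \<notin> T \<Longrightarrow> \<alpha> t \<ge> 1) \<Longrightarrow>
      (\<And>i. i \<in> bas T \<Longrightarrow> J L (\<alpha>(i := Suc (\<alpha> i)))) \<Longrightarrow>
      (\<And>i t. i \<in> bas T \<Longrightarrow> t \<notin> T \<Longrightarrow> J L (\<alpha>(i := Suc (\<alpha> i), t := \<alpha> t - 1))) \<Longrightarrow>
      J (add_mset (T, sum \<alpha> T) L) \<alpha>"
begin

lemma sum_bas: "(\<And>t. t \<in> T - bas T \<Longrightarrow> \<alpha> t = 0) \<Longrightarrow> sum \<alpha> T = (sum \<alpha> (bas T) :: nat)"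
  by (rule sum.mono_neutral_right) (use bas_sub in auto)

text \<open>\<open>k\<close> is what the degree over the basis lacks from
  \<open>card (bas T) * N\<close>. The exponents outside \<open>T\<close> are \<open>N + k\<close>
  because each of the \<open>k\<close> steps may consume one of them.\<close>

definition descends :: "'r set \<Rightarrow> nat \<Rightarrow> nat \<Rightarrow> ('r set \<times> nat) multiset \<Rightarrow> bool" where
  "descends T N k L \<longleftrightarrow> (\<forall>\<alpha>. sum \<alpha> (bas T) = card (bas T) * N - k \<longrightarrow>
     (\<forall>t\<in>T - bas T. \<alpha> t = 0) \<longrightarrow> (\<forall>t. t \<notin> T \<longrightarrow> \<alpha> t = N + k) \<longrightarrow> J L \<alpha>)"

text \<open>Induction on the deficit \<open>k\<close>. At deficit 0 the pigeonhole principle gives a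
  basis form with exponent at least \<open>N\<close>, and the hypothesis for \<open>T - {i}\<close>
  applies; each further unit of deficit costs one factor \<open>(T, d)\<close> with \<open>d\<close>
  the current degree. For the full set the bound on \<open>k\<close> is strict, which keeps
  \<open>d\<close> positive.\<close>

lemma descends_exists:
  assumes "T \<noteq> {}"
    and IH: "\<And>i. i \<in> T \<Longrightarrow> \<exists>N L. admissible L \<and> J L (\<lambda>t. if t \<in> T - {i} then 0 else N)"
  shows "\<exists>N\<ge>1. \<forall>k\<le>card (bas T) * N. (T = UNIV \<longrightarrow> k < card (bas T) * N) \<longrightarrow>
           (\<exists>L. admissible L \<and> descends T N k L)"
proof -
  define B where "B = bas T"
  obtain M L0 where LM: "\<And>i. i \<in> T \<Longrightarrow> admissible (L0 i) \<and> J (L0 i) (\<lambda>t. if t \<in> T - {i} then 0 else M i)"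
    using IH by metis
  \<comment> \<open>Dominates all \<open>M i\<close> at once; the successor ensures
    \<open>N \<ge> 1\<close>, so that \<open>descent_full\<close> can stop one step before degree
    0.\<close>
  define N where "N = Suc (sum M T)"
  define D where "D = card B * N"
  have MN: "M i \<le> N" if "i \<in> T" for i
    unfolding N_def using member_le_sum[of i T M] that by simp
  let ?P = "\<lambda>k L. \<forall>\<alpha>. sum \<alpha> B = D - k \<longrightarrow> (\<forall>t\<in>T - B. \<alpha> t = 0) \<longrightarrow>
          (\<forall>t. t \<notin> T \<longrightarrow> \<alpha> t = N + k) \<longrightarrow> J L \<alpha>"
  have "k \<le> D \<Longrightarrow> (T = UNIV \<Longrightarrow> k < D) \<Longrightarrow> \<exists>L. admissible L \<and> ?P k L" for k
  proof (induction k)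
    case 0
    show ?case
    proof (intro exI conjI allI impI)
      show "admissible (sum L0 T)"
        using LM by (intro admissible_sum) auto
      fix \<alpha> assume a: "sum \<alpha> B = D - 0" "\<forall>t\<in>T - B. \<alpha> t = 0" "\<forall>t. t \<notin> T \<longrightarrow> \<alpha> t = N + 0"
      have "\<exists>i\<in>B. \<alpha> i \<ge> N"
      proof (rule ccontr)
        assume "\<not> (\<exists>i\<in>B. \<alpha> i \<ge> N)"
        hence "sum \<alpha> B < (\<Sum>i\<in>B. N)"
          using bas_ne[OF assms(1)] by (intro sum_strict_mono) (auto simp: B_def)
        thus False using a(1) by (simp add: D_def)
      qed
      then obtain i where i: "i \<in> B" "\<alpha> i \<ge> N" by blast
      have iT: "i \<in> T" using i bas_sub[of T] by (auto simp: B_def)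
      show "J (sum L0 T) \<alpha>"
      proof (rule mono)
        show "J (L0 i) (\<lambda>t. if t \<in> T - {i} then 0 else M i)" using LM iT by blast
        show "L0 i \<subseteq># sum L0 T" using iT by (simp add: sum.remove[of T i])
        show "(if t \<in> T - {i} then 0 else M i) \<le> \<alpha> t" for t
          using i a(3) MN[OF iT] by (auto intro: order_trans)
      qed
    qed
  next
    case (Suc k)
    then obtain L where L: "admissible L" "?P k L" by auto
    show ?case
    proof (intro exI conjI allI impI)
      show "admissible (add_mset (T, D - Suc k) L)"
        using L Suc.prems assms by auto
      fix \<alpha> assume a: "sum \<alpha> B = D - Suc k" "\<forall>t\<in>T - B. \<alpha> t = 0" "\<forall>t. t \<notin> T \<longrightarrow> \<alpha> t = N + Suc k"
      \<comment> \<open>Both kinds of term in \<open>step\<close> have deficit \<open>k\<close> over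
        the basis and exponents at least \<open>N + k\<close> outside \<open>T\<close>. The surplus
        outside is cut down to exactly \<open>N + k\<close> in \<gamma> and restored by
        \<open>mono\<close>.\<close>
      have main: "J L \<beta>" if "i \<in> B" "\<And>t. t \<in> T \<Longrightarrow> \<beta> t = (\<alpha>(i := Suc (\<alpha> i))) t"
        "\<And>t. t \<notin> T \<Longrightarrow> \<beta> t \<ge> N + k" for \<beta> i
      proof (rule mono)
        define \<gamma> where "\<gamma> = (\<lambda>t. if t \<in> T then \<beta> t else N + k)"
        have "sum \<gamma> B = sum \<beta> B"
          unfolding \<gamma>_def by (rule sum.cong) (use bas_sub[of T] in \<open>auto simp: B_def\<close>)
        also have "\<dots> = sum (\<alpha>(i := Suc (\<alpha> i))) B"
          by (rule sum.cong) (use bas_sub[of T] that(2) in \<open>auto simp: B_def\<close>)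
        also have "\<dots> = Suc (sum \<alpha> B)"
          using that(1) by (simp add: sum.remove[of B i])
        finally have "sum \<gamma> B = D - k" using a(1) Suc.prems by simp
        moreover have "\<forall>t\<in>T - B. \<gamma> t = 0" using that(1,2) a(2) by (auto simp: \<gamma>_def)
        ultimately show "J L \<gamma>" using L(2) by (auto simp: \<gamma>_def)
        show "\<gamma> t \<le> \<beta> t" for t using that(3) by (auto simp: \<gamma>_def)
      qed auto
      have "J (add_mset (T, sum \<alpha> T) L) \<alpha>"
      proof (rule step[OF assms(1)])
        fix i assume i: "i \<in> bas T"
        hence iT: "i \<in> T" using bas_sub by auto
        show "J L (\<alpha>(i := Suc (\<alpha> i)))"
          by (rule main[of i]) (use i a(3) iT in \<open>auto simp: B_def\<close>)
        fix t assume "t \<notin> T"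
        thus "J L (\<alpha>(i := Suc (\<alpha> i), t := \<alpha> t - 1))"
          by (intro main[of i]) (use i a(3) iT in \<open>auto simp: B_def\<close>)
      qed (use a(3) in auto)
      moreover have "sum \<alpha> T = D - Suc k" 
        using sum_bas[of T \<alpha>] a by (simp add: B_def)
      ultimately show "J (add_mset (T, D - Suc k) L) \<alpha>" by simp
    qed
  qed
  hence "\<forall>k\<le>D. (T = UNIV \<longrightarrow> k < D) \<longrightarrow> (\<exists>L. admissible L \<and> descends T N k L)"
    unfolding descends_def by (simp only: B_def D_def) blast
  moreover have "N \<ge> 1" by (simp add: N_def)
  ultimately show ?thesis unfolding D_def B_def by blast
qed

text \<open>A proper nonempty \<open>T\<close> may be driven down to degree 0, since the factor
  \<open>(T, 0)\<close> is admissible. Induction on \<open>T\<close>: removing one index leaves a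
  smaller set.\<close>

lemma descent_proper:
  assumes "T \<noteq> UNIV"
  shows "\<exists>N L. admissible L \<and> J L (\<lambda>t. if t \<in> T then 0 else N)"
  using finite[of T] assms
proof (induction T rule: finite_psubset_induct)
  case (psubset T)
  show ?case
  proof (cases "T = {}")
    case True
    thus ?thesis using start by (intro exI[of _ K] exI[of _ "{#}"]) auto
  next
    case False
    have "\<exists>N L. admissible L \<and> J L (\<lambda>t. if t \<in> T - {i} then 0 else N)" if "i \<in> T" for i
      using that psubset.prems by (intro psubset.IH) auto
    then obtain N where "\<forall>k\<le>card (bas T) * N. (T = UNIV \<longrightarrow> k < card (bas T) * N) \<longrightarrow>
           (\<exists>L. admissible L \<and> descends T N k L)"
      using descends_exists[OF False] by blast
    then obtain L where L: "admissible L" "descends T N (card (bas T) * N) L"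
      using psubset.prems by blast
    have "J L (\<lambda>t. if t \<in> T then 0 else N + card (bas T) * N)"
      by (rule L(2)[unfolded descends_def, rule_format]) (use bas_sub[of T] in \<open>auto intro!: sum.neutral\<close>)
    thus ?thesis using L(1) by blast
  qed
qed

text \<open>Over the full set the deficit goes up to \<open>card (bas UNIV) * N - 1\<close>, that
  is, down to degree 1; reaching degree 0 would spend \<open>(UNIV, 0)\<close>.\<close>

theorem descent_full:
  "\<exists>L. admissible L \<and> (\<forall>i\<in>bas UNIV. J L ((\<lambda>_. 0)(i := 1)))"
proof -
  have "\<exists>N L. admissible L \<and> J L (\<lambda>t. if t \<in> UNIV - {i} then 0 else N)" for i
    by (rule descent_proper) auto
  then obtain N where N: "N \<ge> 1" "\<forall>k\<le>card (bas UNIV) * N. (UNIV = (UNIV :: 'r set) \<longrightarrow> k < card (bas UNIV) * N) \<longrightarrow>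
           (\<exists>L. admissible L \<and> descends UNIV N k L)"
    using descends_exists[of UNIV] by blast
  have pos: "card (bas UNIV) * N \<ge> 1" using N(1) bas_ne[of UNIV] by (simp add: Suc_le_eq card_gt_0_iff)
  then obtain L where L: "admissible L" "descends UNIV N (card (bas UNIV) * N - 1) L"
    using N(2)[rule_format, of "card (bas UNIV) * N - 1"] by auto
  have "J L ((\<lambda>_. 0)(i := 1))" if "i \<in> bas UNIV" for i
    by (rule L(2)[unfolded descends_def, rule_format]) (use that pos in \<open>auto simp: sum.remove[of _ i]\<close>)
  thus ?thesis using L(1) by blast
qed

end

section \<open>Bases of an arrangement\<close>

definition lform :: "complex ^ 'n \<Rightarrow> complex ^ 'n::finite \<Rightarrow> complex" where
  "lform c z = (\<Sum>j\<in>UNIV. c $ j * z $ j)"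

lemma lform_simps [simp]:
  "lform 0 z = 0" "lform c 0 = 0"
  "lform (c + d) z = lform c z + lform d z"
  "lform c (z + w) = lform c z + lform c w"
  "lform (a *s c) z = a * lform c z"
  "lform c (a *s z) = a * lform c z"
  "lform c (- z) = - lform c z"
  "lform c (z - w) = lform c z - lform c w"
  by (simp_all add: lform_def sum.distrib sum_distrib_left sum_subtractf sum_negf algebra_simps)

lemma lform_sum_left [simp]: "lform (sum g A) z = (\<Sum>x\<in>A. lform (g x) z)"
  by (induction A rule: infinite_finite_induct) auto

lemma lform_scaleR [simp]: "lform c (a *\<^sub>R z) = of_real a * lform c z"
  by (simp add: lform_def sum_distrib_left scaleR_conv_of_real[where 'a=complex] algebra_simps)

lemma linear_lform: "linear (lform c)"
  by (rule linearI) (auto simp: scaleR_conv_of_real[where 'a=complex])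

lemma bounded_linear_lform: "bounded_linear (lform c)"
  using linear_lform linear_conv_bounded_linear by blast

text \<open>Extend the indicator of \<open>b\<close> on \<open>B\<close> to a linear map. The map is
  vector valued, so one coordinate \<open>k\<close> is read off, and \<open>v\<close> collects the
  values of that coordinate on the unit vectors.\<close>

lemma dual_vector_exists:
  fixes B :: "(complex ^ 'n::finite) set"
  assumes "vec.independent B" 
  shows "\<exists>v. \<forall>b'\<in>B. lform b' v = (if b' = b then 1 else 0)"
proof -
  fix k :: 'n
  obtain g :: "complex^'n \<Rightarrow> complex^'n" where g: "Vector_Spaces.linear (*s) (*s) g"
    "\<forall>x\<in>B. g x = (if x = b then axis k 1 else 0)"
    using vec.linear_independent_extend[OF assms, of "\<lambda>x. if x = b then axis k 1 else 0"] by blast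
  define v where "v = (\<chi> j. g (axis j 1) $ k)"
  have "lform x v = g x $ k" for x
  proof -
    have "g x = g (\<Sum>i\<in>UNIV. (x $ i) *s axis i 1)" by (simp add: basis_expansion)
    also have "\<dots> = (\<Sum>i\<in>UNIV. (x $ i) *s g (axis i 1))"
      by (simp add: vec.linear_sum[OF g(1)] vec.linear_scale[OF g(1)])
    finally show ?thesis by (simp add: lform_def v_def)
  qed
  thus ?thesis using g(2) by (intro exI[of _ v]) (auto simp: axis_def)
qed

locale arrangement =
  fixes c :: "'r::finite \<Rightarrow> complex ^ 'n::finite"
  assumes c_nonzero: "c i \<noteq> 0"
    and essential: "(\<And>i. lform (c i) z = 0) \<Longrightarrow> z = 0"
begin

text \<open>If the forms did not span, a vector dual to some \<open>x\<close> outside their span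
  would be annihilated by all of them, against \<open>essential\<close>.\<close>

lemma span_range: "vec.span (range c) = UNIV"
proof (rule ccontr)
  assume *: "vec.span (range c) \<noteq> UNIV"
  obtain B where B: "B \<subseteq> range c" "vec.independent B" "range c \<subseteq> vec.span B"
    using vec.maximal_independent_subset[of "range c"] by blast
  have "vec.span B \<noteq> UNIV" using * B(1) vec.span_mono by blast
  then obtain x where x: "x \<notin> vec.span B" by auto
  hence ind: "vec.independent (insert x B)" using B(2) by (simp add: vec.independent_insertI)
  obtain v where v: "\<forall>b\<in>insert x B. lform b v = (if b = x then 1 else 0)"
    using dual_vector_exists[OF ind] by blast
  have "x \<notin> B" using x vec.span_base by blast
  have "lform y v = 0" if "y \<in> vec.span B" for y
    using that by (induction rule: vec.span_induct_alt) (use v \<open>x \<notin> B\<close> in auto)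
  hence "lform (c i) v = 0" for i using B(3) by blast
  hence "v = 0" by (rule essential)
  thus False using v by force
qed

text \<open>A basis is a set of indices, not of vectors: \<open>c\<close> may take the same value
  twice, whence the injectivity clause. In matroid terms \<open>B\<close> is a basis of
  \<open>T\<close>.\<close>

definition spans_by :: "'r set \<Rightarrow> 'r set \<Rightarrow> bool" where
  "spans_by T B \<longleftrightarrow> B \<subseteq> T \<and> inj_on c B \<and> vec.independent (c ` B) \<and> c ` T \<subseteq> vec.span (c ` B)"

lemma extend_independent:
  assumes "B0 \<subseteq> T" "inj_on c B0" "vec.independent (c ` B0)"
  shows "\<exists>B. B0 \<subseteq> B \<and> spans_by T B"
proof -
  obtain B' where B': "c ` B0 \<subseteq> B'" "B' \<subseteq> c ` T" "vec.independent B'" "c ` T \<subseteq> vec.span B'"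
    using vec.maximal_independent_subset_extend[of "c ` B0" "c ` T"] assms by blast
  have "B' - c ` B0 \<subseteq> c ` T" using B' by blast
  then obtain B1 where B1: "B1 \<subseteq> T" "inj_on c B1" "B' - c ` B0 = c ` B1"
    by (metis subset_image_inj)
  have im: "c ` (B0 \<union> B1) = B'" using B1(3) B'(1) by blast
  have "inj_on c (B0 \<union> B1)"
    using assms(2) B1 by (auto simp: inj_on_Un)
  thus ?thesis
    unfolding spans_by_def by (intro exI[of _ "B0 \<union> B1"]) (use im B' B1 assms in auto)
qed

definition bas :: "'r set \<Rightarrow> 'r set" where
  "bas T = (SOME B. spans_by T B)"

definition rk :: "'r set \<Rightarrow> nat" where
  "rk T = card (bas T)"

lemma spans_by_bas: "spans_by T (bas T)"
  unfolding bas_def by (rule someI_ex) (use extend_independent[of "{}" T] in \<open>auto simp: vec.independent_empty\<close>)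

lemma bas_subset: "bas T \<subseteq> T"
  using spans_by_bas by (simp add: spans_by_def)

lemma bas_nonempty:
  assumes "T \<noteq> {}"
  shows "bas T \<noteq> {}"
proof
  assume "bas T = {}"
  hence "c ` T \<subseteq> {0}" using spans_by_bas[of T] by (simp add: spans_by_def)
  thus False using assms c_nonzero by auto
qed

definition dual :: "'r set \<Rightarrow> 'r \<Rightarrow> complex ^ 'n" where
  "dual T i = (SOME v. \<forall>b\<in>c ` bas T. lform b v = (if b = c i then 1 else 0))"

lemma lform_dual:
  assumes "i \<in> bas T" "j \<in> bas T"
  shows "lform (c j) (dual T i) = (if i = j then 1 else 0)"
proof -
  have *: "\<forall>b\<in>c ` bas T. lform b (dual T i) = (if b = c i then 1 else 0)"
    unfolding dual_def
    by (rule someI_ex, rule dual_vector_exists) (use spans_by_bas[of T] in \<open>auto simp: spans_by_def\<close>)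
  have "c j = c i \<longleftrightarrow> i = j"
    using spans_by_bas[of T] assms by (auto simp: spans_by_def inj_on_def)
  thus ?thesis using * assms by auto
qed

text \<open>The coordinates of \<open>c t\<close> in the basis \<open>bas T\<close> are its values
  on the dual vectors. Hence the vector field
  \<open>\<Sum>i\<in>bas T. lform (c i) z *s dual T i\<close> differentiates each form of
  \<open>T\<close> to itself, as the Euler field does.\<close>

lemma lform_expand:
  assumes "t \<in> T"
  shows "(\<Sum>i\<in>bas T. lform (c t) (dual T i) * lform (c i) z) = lform (c t) z"
proof -
  have "c t \<in> vec.span (c ` bas T)" using assms spans_by_bas[of T] by (auto simp: spans_by_def)
  moreover have "(\<Sum>i\<in>bas T. lform x (dual T i) * lform (c i) z) = lform x z"
    if "x \<in> vec.span (c ` bas T)" for x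
    using that
  proof (induction rule: vec.span_induct_alt)
    case base
    show ?case by simp
  next
    case (step a x y)
    then obtain k where k: "k \<in> bas T" "x = c k" by blast
    have "(\<Sum>i\<in>bas T. lform x (dual T i) * lform (c i) z) = (\<Sum>i\<in>bas T. if i = k then lform (c i) z else 0)"
      by (rule sum.cong) (use k lform_dual in auto)
    also have "\<dots> = lform x z" using k by simp
    finally show ?case using step
      by (simp add: algebra_simps sum.distrib flip: sum_distrib_left)
  qed
  ultimately show ?thesis by blast
qed

lemma card_le_rk:
  assumes "inj_on c B" "vec.independent (c ` B)"
  shows "card (B \<inter> T) \<le> rk T"
proof -
  have "card (c ` (B \<inter> T)) \<le> card (c ` bas T)"
  proof (rule conjunct2[OF vec.independent_span_bound])
    show "vec.independent (c ` (B \<inter> T))" by (rule vec.independent_mono[OF assms(2)]) auto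
    show "c ` (B \<inter> T) \<subseteq> vec.span (c ` bas T)" using spans_by_bas[of T] by (auto simp: spans_by_def)
  qed auto
  moreover have "card (c ` (B \<inter> T)) = card (B \<inter> T)"
    by (rule card_image, rule inj_on_subset[OF assms(1)]) auto
  ultimately show ?thesis unfolding rk_def using card_image_le[of "bas T" c] by simp
qed

lemma spans_by_card:
  assumes "spans_by UNIV B"
  shows "card B = CARD('n)"
proof -
  have "vec.span (c ` B) = UNIV"
    using assms span_range unfolding spans_by_def by (metis UNIV_eq_I vec.span_mono vec.span_span subset_antisym top_greatest)
  hence "card (c ` B) = CARD('n)"
    using assms vec.dim_span_eq_card_independent[of "c ` B"] vec_dim_card[where 'a=complex and 'n='n]
    by (simp add: spans_by_def)
  thus ?thesis using assms card_image[of c B] by (simp add: spans_by_def)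
qed

lemma rk_UNIV: "rk UNIV = CARD('n)"
  unfolding rk_def by (rule spans_by_card) (rule spans_by_bas)

section \<open>The barycentre of the bases\<close>

definition bases :: "'r set set" where
  "bases = {B. spans_by UNIV B}"

text \<open>The barycentre of the vertices of the base polytope of the matroid.\<close>

definition centre :: "'r \<Rightarrow> real" where
  "centre i = real (card {B\<in>bases. i \<in> B}) / real (card bases)"

lemma card_bases_pos: "card bases > 0"
  using spans_by_bas[of UNIV] by (auto simp: bases_def card_gt_0_iff)

lemma sum_centre: "sum centre T = (\<Sum>B\<in>bases. real (card (B \<inter> T))) / real (card bases)"
proof -
  have "(\<Sum>i\<in>T. real (card {B\<in>bases. i \<in> B})) = (\<Sum>i\<in>T. \<Sum>B\<in>bases. if i \<in> B then 1 else 0)"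
    by (rule sum.cong) (auto simp: sum.If_cases Int_def)
  also have "\<dots> = (\<Sum>B\<in>bases. \<Sum>i\<in>T. if i \<in> B then 1 else 0)"
    by (rule sum.swap)
  also have "\<dots> = (\<Sum>B\<in>bases. real (card (B \<inter> T)))"
    by (rule sum.cong) (auto simp: sum.If_cases Int_commute)
  finally show ?thesis by (simp add: centre_def flip: sum_divide_distrib)
qed

lemma sum_centre_UNIV: "sum centre UNIV = CARD('n)"
proof -
  have "(\<Sum>B\<in>bases. real (card (B \<inter> UNIV))) = (\<Sum>B\<in>bases. real CARD('n))"
    by (rule sum.cong) (auto simp: bases_def spans_by_card)
  thus ?thesis using card_bases_pos by (auto simp: sum_centre)
qed

text \<open>A single nonzero form is independent, so every index lies in some basis.\<close>

lemma centre_pos: "centre i > 0"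
proof -
  have "vec.independent (c ` {i})" using c_nonzero by (simp add: vec.independent_insert)
  then obtain B where "B \<supseteq> {i}" "spans_by UNIV B" using extend_independent[of "{i}" UNIV] by auto
  hence "{B\<in>bases. i \<in> B} \<noteq> {}" by (auto simp: bases_def)
  thus ?thesis using card_bases_pos by (auto simp: centre_def card_gt_0_iff)
qed

text \<open>Every basis meets \<open>T\<close> in at most \<open>rk T\<close> indices, so strictness
  for one basis is enough. A basis grown from \<open>bas (-T)\<close> meets the complement in
  \<open>rk (-T)\<close> indices, hence meets \<open>T\<close> in \<open>CARD('n) - rk (-T)\<close>
  of them, which differs from \<open>rk T\<close>.\<close>

lemma sum_centre_less:
  assumes "rk T + rk (-T) \<noteq> CARD('n)"
  shows "sum centre T < rk T"
proof -
  have le: "real (card (B \<inter> T)) \<le> rk T" if "B \<in> bases" for B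
    using that card_le_rk[of B T] by (auto simp: bases_def spans_by_def)
  obtain B where B: "bas (-T) \<subseteq> B" "spans_by UNIV B"
    using extend_independent[of "bas (-T)" UNIV] spans_by_bas[of "-T"] by (auto simp: spans_by_def)
  have "bas (-T) \<subseteq> B \<inter> -T" using B bas_subset[of "-T"] by auto
  hence "card (B \<inter> -T) \<ge> rk (-T)" unfolding rk_def by (intro card_mono) auto
  moreover have "card (B \<inter> -T) \<le> rk (-T)"
    by (rule card_le_rk) (use B in \<open>auto simp: spans_by_def\<close>)
  moreover have "card (B \<inter> T) + card (B \<inter> -T) = CARD('n)"
    using spans_by_card[OF B(2)] card_Int_Diff[of B T] by (simp add: Diff_eq)
  ultimately have "card (B \<inter> T) \<noteq> rk T" using assms by simp
  moreover have "B \<in> bases" using B by (simp add: bases_def)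
  ultimately have "\<exists>B\<in>bases. real (card (B \<inter> T)) < real (rk T)"
    using le[of B] by (intro bexI[of _ B]) auto
  hence "(\<Sum>B\<in>bases. real (card (B \<inter> T))) < (\<Sum>B\<in>bases. real (rk T))"
    using le by (intro sum_strict_mono_ex1) auto
  hence "sum centre T < (\<Sum>B\<in>bases. real (rk T)) / real (card bases)"
    unfolding sum_centre using card_bases_pos by (intro divide_strict_right_mono) auto
  thus ?thesis using card_bases_pos by (auto split: if_splits)
qed

end

section \<open>Test functions and integration by parts\<close>

lemma Ck_Suc_imp: "Ck (Suc k) f \<Longrightarrow> Ck k f"
proof (induction k arbitrary: f)
  case 0
  thus ?case by (auto intro!: continuous_at_imp_continuous_on differentiable_imp_continuous_within)
next
  case (Suc k)
  have 1: "\<forall>x. f differentiable (at x)" "\<And>v. Ck (Suc k) (\<lambda>x. frechet_derivative f (at x) v)"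
    using Suc.prems Ck.simps(2)[of "Suc k" f] by blast+
  thus ?case using Suc.IH by simp
qed

lemma Ck_const: "Ck k (\<lambda>x. a)"
  by (induction k arbitrary: a) auto

lemma Ck_bounded_linear: "bounded_linear f \<Longrightarrow> Ck k f"
proof (cases k)
  case 0
  assume "bounded_linear f"
  thus ?thesis using 0 by (simp add: linear_continuous_on)
next
  case (Suc j)
  assume f: "bounded_linear f"
  hence "(f has_derivative f) (at x)" for x by (rule bounded_linear_imp_has_derivative)
  thus ?thesis using Suc frechet_derivative_at[of f f] Ck_const
    by (auto simp: differentiable_def)
qed

lemma Ck_add: "Ck k f \<Longrightarrow> Ck k g \<Longrightarrow> Ck k (\<lambda>x. f x + g x)"
proof (induction k arbitrary: f g)
  case (Suc k)
  have "frechet_derivative (\<lambda>x. f x + g x) (at x) = (\<lambda>v. frechet_derivative f (at x) v + frechet_derivative g (at x) v)" for x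
    by (rule sym, rule frechet_derivative_at, intro has_derivative_add) (use Suc.prems in \<open>auto simp flip: frechet_derivative_works\<close>)
  thus ?case using Suc by auto
qed (auto intro: continuous_intros)

lemma Ck_mult:
  fixes f g :: "'a::real_normed_vector \<Rightarrow> 'b::real_normed_algebra"
  shows "Ck k f \<Longrightarrow> Ck k g \<Longrightarrow> Ck k (\<lambda>x. f x * g x)"
proof (induction k arbitrary: f g)
  case (Suc k)
  have "frechet_derivative (\<lambda>x. f x * g x) (at x) =
      (\<lambda>v. f x * frechet_derivative g (at x) v + frechet_derivative f (at x) v * g x)" for x
    by (rule sym, rule frechet_derivative_at, intro has_derivative_mult) (use Suc.prems in \<open>auto simp flip: frechet_derivative_works\<close>)
  thus ?case using Suc.prems Ck_Suc_imp[OF Suc.prems(1)] Ck_Suc_imp[OF Suc.prems(2)] 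
    by (auto intro!: Ck_add Suc.IH)
qed (auto intro: continuous_intros)

lemma Ck_prod:
  fixes f :: "'i \<Rightarrow> 'a::real_normed_vector \<Rightarrow> 'b::{real_normed_algebra, comm_ring_1}"
  shows "(\<And>i. i \<in> A \<Longrightarrow> Ck k (f i)) \<Longrightarrow> Ck k (\<lambda>x. \<Prod>i\<in>A. f i x)"
  by (induction A rule: infinite_finite_induct) (auto intro: Ck_mult Ck_const)

lemma Ck_power:
  fixes f :: "'a::real_normed_vector \<Rightarrow> 'b::{real_normed_algebra, comm_ring_1}"
  shows "Ck k f \<Longrightarrow> Ck k (\<lambda>x. f x ^ m)"
  by (induction m) (auto intro: Ck_mult Ck_const)

lemma Ck_compose_linear: "Ck k g \<Longrightarrow> bounded_linear A \<Longrightarrow> Ck k (\<lambda>x. g (A x))"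
proof (induction k arbitrary: g)
  case 0
  thus ?case using continuous_on_compose2[of UNIV g UNIV A] by (auto simp: linear_continuous_on)
next
  case (Suc k)
  have A: "(A has_derivative A) (at x)" for x using Suc.prems by (intro bounded_linear_imp_has_derivative)
  have g: "(g has_derivative frechet_derivative g (at y)) (at y)" for y using Suc.prems
    by (auto simp flip: frechet_derivative_works)
  have 1: "((\<lambda>x. g (A x)) has_derivative (\<lambda>v. frechet_derivative g (at (A x)) (A v))) (at x)" for x
    by (rule has_derivative_compose[OF A g])
  hence "frechet_derivative (\<lambda>x. g (A x)) (at x) = (\<lambda>v. frechet_derivative g (at (A x)) (A v))" for x
    using frechet_derivative_at by metis
  thus ?case using Suc.prems 1 Suc.IH[of "\<lambda>x. frechet_derivative g (at x) (A v)" for v]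
    by (auto simp: differentiable_def)
qed

lemma test_function_iff:
  "test_function \<phi> \<longleftrightarrow> (\<forall>k. Ck k \<phi>) \<and> (\<exists>R. \<forall>z. \<phi> z \<noteq> 0 \<longrightarrow> norm z \<le> R)"
  by (auto simp: test_function_def compact_closure bounded_iff support_on_def)

lemma test_function_add: "test_function \<phi> \<Longrightarrow> test_function \<psi> \<Longrightarrow> test_function (\<lambda>z. \<phi> z + \<psi> z)"
proof -
  assume a: "test_function \<phi>" "test_function \<psi>"
  obtain R R' where "\<forall>z. \<phi> z \<noteq> 0 \<longrightarrow> norm z \<le> R" "\<forall>z. \<psi> z \<noteq> 0 \<longrightarrow> norm z \<le> R'"
    using a by (auto simp: test_function_iff)
  hence "\<forall>z. \<phi> z + \<psi> z \<noteq> 0 \<longrightarrow> norm z \<le> max R R'" by (metis add.right_neutral le_max_iff_disj)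
  thus ?thesis using a by (auto simp: test_function_iff Ck_add)
qed

lemma test_function_mult: "(\<And>k. Ck k p) \<Longrightarrow> test_function \<phi> \<Longrightarrow> test_function (\<lambda>z. p z * \<phi> z)"
  by (auto simp: test_function_iff intro!: Ck_mult)

lemma test_function_cmult: "test_function \<phi> \<Longrightarrow> test_function (\<lambda>z. a * \<phi> z)"
  by (intro test_function_mult Ck_const)

lemma frechet_derivative_outside:
  fixes f :: "'a::euclidean_space \<Rightarrow> 'b::real_normed_vector"
  assumes "\<And>z. f z \<noteq> 0 \<Longrightarrow> norm z \<le> R" "norm z > R"
  shows "frechet_derivative f (at z) = (\<lambda>_. 0)"
proof -
  have "((\<lambda>z. 0) has_derivative (\<lambda>_. 0)) (at z)" by simp
  hence "(f has_derivative (\<lambda>_. 0)) (at z)"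
    by (rule has_derivative_transform_within_open[where s="- cball 0 R"]) (use assms in force)+
  thus ?thesis using frechet_derivative_at by metis
qed

lemma test_function_frechet:
  assumes "test_function \<phi>"
  shows "test_function (\<lambda>x. frechet_derivative \<phi> (at x) v)"
proof -
  obtain R where R: "\<And>z. \<phi> z \<noteq> 0 \<Longrightarrow> norm z \<le> R" using assms by (auto simp: test_function_iff)
  have "norm z \<le> R" if "frechet_derivative \<phi> (at z) v \<noteq> 0" for z
    using frechet_derivative_outside[of \<phi> R z, OF R] that by force
  moreover have "Ck k (\<lambda>x. frechet_derivative \<phi> (at x) v)" for k
    using assms Ck.simps(2)[of k \<phi>] unfolding test_function_def by blast
  ultimately show ?thesis unfolding test_function_iff by blast
qed

text \<open>The derivative in the complex direction \<open>v\<close>, i.e. the Wirtinger derivative \<open>\<Sum>\<^sub>j v\<^sub>j \<partial>/\<partial>z\<^sub>j\<close>.\<close>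

definition wirt :: "complex ^ 'n::finite \<Rightarrow> (complex ^ 'n \<Rightarrow> complex) \<Rightarrow> complex ^ 'n \<Rightarrow> complex" where
  "wirt v G z = (frechet_derivative G (at z) v - \<i> * frechet_derivative G (at z) (\<i> *s v)) / 2"

lemma wirt_eqI:
  assumes "(G has_derivative G') (at z)"
  shows "wirt v G z = (G' v - \<i> * G' (\<i> *s v)) / 2"
  using frechet_derivative_at[OF assms] by (simp add: wirt_def)

lemma test_function_wirt: "test_function \<phi> \<Longrightarrow> test_function (wirt v \<phi>)"
proof -
  assume a: "test_function \<phi>"
  have "test_function (\<lambda>z. (1/2) * frechet_derivative \<phi> (at z) v + (- \<i>/2) * frechet_derivative \<phi> (at z) (\<i> *s v))"
    by (intro test_function_add test_function_cmult test_function_frechet a)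
  moreover have "wirt v \<phi> = (\<lambda>z. (1/2) * frechet_derivative \<phi> (at z) v + (- \<i>/2) * frechet_derivative \<phi> (at z) (\<i> *s v))"
    by (rule ext) (simp add: wirt_def field_simps)
  ultimately show ?thesis by simp
qed

lemma wirt_mult:
  assumes "F differentiable (at z)" "G differentiable (at z)"
  shows "wirt v (\<lambda>z. F z * G z) z = wirt v F z * G z + F z * wirt v G z"
proof -
  have *: "((\<lambda>z. F z * G z) has_derivative (\<lambda>h. F z * frechet_derivative G (at z) h + frechet_derivative F (at z) h * G z)) (at z)"
    by (intro has_derivative_mult) (use assms in \<open>auto simp flip: frechet_derivative_works\<close>)
  show ?thesis unfolding wirt_eqI[OF *] by (simp add: wirt_def field_simps)
qed

lemma wirt_const [simp]: "wirt v (\<lambda>z. a) z = 0"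
  by (simp add: wirt_def)

section \<open>Integrals of derivatives of compactly supported functions\<close>

lemma directional_limit:
  assumes "(f has_derivative f') (at x)"
  shows "(\<lambda>n. real (Suc n) *\<^sub>R (f (x + (1 / real (Suc n)) *\<^sub>R v) - f x)) \<longlonglongrightarrow> f' v"
proof (cases "v = 0")
  case True
  thus ?thesis using assms by (simp add: has_derivative_def linear_simps)
next
  case False
  define y where "y = (\<lambda>n. x + (1 / real (Suc n)) *\<^sub>R v)"
  interpret f': bounded_linear f' using assms by (simp add: has_derivative_def)
  have "(\<lambda>n. 1 / real (Suc n)) \<longlonglongrightarrow> 0" by (rule LIMSEQ_Suc[OF lim_1_over_n])
  hence "y \<longlonglongrightarrow> x + 0 *\<^sub>R v" unfolding y_def by (intro tendsto_intros)
  hence "filterlim y (at x) sequentially"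
    using False by (auto simp: filterlim_at y_def)
  hence "(\<lambda>n. norm ((f (y n) - f x) - f' (y n - x)) / norm (y n - x)) \<longlonglongrightarrow> 0"
    using assms unfolding has_derivative_iff_norm by (auto intro: filterlim_compose)
  hence "(\<lambda>n. norm v * (norm ((f (y n) - f x) - f' (y n - x)) / norm (y n - x))) \<longlonglongrightarrow> norm v * 0"
    by (intro tendsto_intros)
  moreover have "norm v * (norm ((f (y n) - f x) - f' (y n - x)) / norm (y n - x))
      = norm (real (Suc n) *\<^sub>R (f (y n) - f x) - f' v)" for n
  proof -
    have "real (Suc n) *\<^sub>R (f (y n) - f x) - f' v = real (Suc n) *\<^sub>R ((f (y n) - f x) - f' (y n - x))"
      by (simp add: y_def f'.scaleR algebra_simps del: of_nat_Suc)
    hence "norm (real (Suc n) *\<^sub>R (f (y n) - f x) - f' v) = real (Suc n) * norm ((f (y n) - f x) - f' (y n - x))"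
      by (metis abs_of_nat norm_scaleR)
    thus ?thesis using False by (simp add: y_def)
  qed
  ultimately have "(\<lambda>n. norm (real (Suc n) *\<^sub>R (f (y n) - f x) - f' v)) \<longlonglongrightarrow> 0" by simp
  hence "(\<lambda>n. real (Suc n) *\<^sub>R (f (y n) - f x) - f' v) \<longlonglongrightarrow> 0" by (rule tendsto_norm_zero_cancel)
  thus ?thesis unfolding y_def by (rule Lim_null[THEN iffD2])
qed

lemma integrable_compact_support:
  fixes f :: "'a::euclidean_space \<Rightarrow> complex"
  assumes "continuous_on UNIV f" "\<And>z. f z \<noteq> 0 \<Longrightarrow> norm z \<le> R"
  shows "integrable lborel f"
proof -
  have "integrable lborel (\<lambda>x. indicator (cball 0 R) x *\<^sub>R f x)"
    by (intro borel_integrable_compact continuous_on_subset[OF assms(1)]) auto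
  moreover have "(\<lambda>x. indicator (cball 0 R) x *\<^sub>R f x) = f"
    using assms(2) by (auto simp: indicator_def fun_eq_iff)
  ultimately show ?thesis by simp
qed

lemma integral_translate:
  fixes f :: "'a::euclidean_space \<Rightarrow> complex"
  assumes [measurable]: "f \<in> borel_measurable borel"
  shows "(LINT x|lborel. f (x + c)) = (LINT x|lborel. f x)"
proof -
  have "(LINT x|lborel. f x) = (LINT x|distr lborel borel ((+) c). f x)" by (simp add: lborel_distr_plus)
  also have "\<dots> = (LINT x|lborel. f (c + x))" by (intro integral_distr) auto
  finally show ?thesis by (simp add: add.commute)
qed

lemma integrable_translate:
  fixes f :: "'a::euclidean_space \<Rightarrow> complex"
  assumes "integrable lborel f"
  shows "integrable lborel (\<lambda>x. f (x + c))"
proof -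
  have "integrable (distr lborel borel ((+) c)) f" using assms by (simp add: lborel_distr_plus)
  hence "integrable lborel (\<lambda>x. f (c + x))" by (subst (asm) integrable_distr_eq) (use assms in auto)
  thus ?thesis by (simp add: add.commute)
qed

text \<open>The difference quotients in direction \<open>v\<close> have integral 0 by translation
  invariance, and they converge to the derivative under a common bound from the mean value theorem.
  \<open>Ck 1\<close> is what the weights below offer when the exponents have real part above
  1.\<close>

lemma integral_frechet_derivative_0:
  fixes G :: "'a::euclidean_space \<Rightarrow> complex"
  assumes "Ck 1 G" and R: "\<And>z. G z \<noteq> 0 \<Longrightarrow> norm z \<le> R"
  shows "integrable lborel (\<lambda>x. frechet_derivative G (at x) v)"
    "(LINT x|lborel. frechet_derivative G (at x) v) = 0"
proof -
  let ?D = "\<lambda>x. frechet_derivative G (at x) v"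
  have diff: "(G has_derivative frechet_derivative G (at x)) (at x)" for x
    using assms(1) by (simp add: numeral_eq_Suc flip: frechet_derivative_works)
  have D: "continuous_on UNIV ?D" using assms(1) by simp
  have G: "continuous_on UNIV G" using Ck_Suc_imp[of 0 G] assms(1) by simp
  have Dz: "?D x = 0" if "norm x > R" for x
    using frechet_derivative_outside[of G R x] R that by simp
  show int: "integrable lborel ?D"
    by (rule integrable_compact_support[OF D, of R]) (use Dz in force)
  have intG: "integrable lborel G" by (rule integrable_compact_support[OF G R])
  obtain C0 where C0: "\<And>x. x \<in> cball 0 R \<Longrightarrow> norm (?D x) \<le> C0"
    using compact_imp_bounded[OF compact_continuous_image[OF continuous_on_subset[OF D subset_UNIV] compact_cball[of 0 R]]]
    unfolding bounded_iff by blast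
  \<comment> \<open>The maximum with 0 covers a negative \<open>R\<close>, for which the ball is
    empty and \<open>C0\<close> may be any number.\<close>
  define C where "C = max C0 0"
  have C: "norm (?D x) \<le> C" for x
    using C0[of x] Dz[of x] by (cases "norm x \<le> R") (auto simp: C_def)
  have mean: "norm (G (x + t *\<^sub>R v) - G x) \<le> C * t" if "t \<ge> 0" for x t
  proof -
    have "norm ((\<lambda>s. G (x + s *\<^sub>R v)) t - (\<lambda>s. G (x + s *\<^sub>R v)) 0) \<le> C * norm (t - 0)"
    proof (rule differentiable_bound[where S=UNIV])
      fix s :: real
      have "((\<lambda>s. x + s *\<^sub>R v) has_derivative (\<lambda>h. h *\<^sub>R v)) (at s)"
        by (auto intro!: derivative_eq_intros)
      from has_derivative_compose[OF this diff]
      have *: "((\<lambda>s. G (x + s *\<^sub>R v)) has_derivative (\<lambda>h. frechet_derivative G (at (x + s *\<^sub>R v)) (h *\<^sub>R v))) (at s)" .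
      interpret L: bounded_linear "frechet_derivative G (at (x + s *\<^sub>R v))"
        using diff by (simp add: has_derivative_def)
      show "((\<lambda>s. G (x + s *\<^sub>R v)) has_derivative (\<lambda>h. h *\<^sub>R ?D (x + s *\<^sub>R v))) (at s within UNIV)"
        using * by (simp add: L.scaleR)
      show "onorm (\<lambda>h. h *\<^sub>R ?D (x + s *\<^sub>R v)) \<le> C"
      proof (rule onorm_bound)
        show "norm (h *\<^sub>R ?D (x + s *\<^sub>R v)) \<le> C * norm h" for h
          using mult_left_mono[OF C[of "x + s *\<^sub>R v"], of "\<bar>h\<bar>"] by (simp add: mult.commute)
      qed (simp add: C_def)
    qed auto
    thus ?thesis using that by simp
  qed
  let ?F = "\<lambda>n x. real (Suc n) *\<^sub>R (G (x + (1 / real (Suc n)) *\<^sub>R v) - G x)"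
  have "(\<lambda>n. LINT x|lborel. ?F n x) \<longlonglongrightarrow> (LINT x|lborel. ?D x)"
  proof (rule integral_dominated_convergence)
    show "?D \<in> borel_measurable lborel" using D by (simp add: borel_measurable_continuous_onI)
    show "?F n \<in> borel_measurable lborel" for n
      using borel_measurable_continuous_onI[OF G] by measurable
    \<comment> \<open>The steps \<open>1 / real (Suc n)\<close> are at most 1, so the translated
      supports stay within radius \<open>R + norm v\<close>.\<close>
    show "integrable lborel (\<lambda>x. indicator (cball 0 (R + norm v)) x * C)"
      using borel_integrable_compact[of "cball 0 (R + norm v)" "\<lambda>_. C"] by (simp add: mult.commute)
    show "AE x in lborel. (\<lambda>n. ?F n x) \<longlonglongrightarrow> ?D x"
      using directional_limit[OF diff] by simp
    show "AE x in lborel. norm (?F n x) \<le> indicator (cball 0 (R + norm v)) x * C" for n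
    proof (rule AE_I2)
      fix x
      let ?t = "1 / real (Suc n)"
      show "norm (?F n x) \<le> indicator (cball 0 (R + norm v)) x * C"
      proof (cases "norm x \<le> R + norm v")
        case True
        have "norm (?F n x) = real (Suc n) * norm (G (x + ?t *\<^sub>R v) - G x)"
          by (simp del: of_nat_Suc)
        also have "\<dots> \<le> real (Suc n) * (C * ?t)"
          by (intro mult_left_mono mean) auto
        also have "\<dots> = C" by (simp del: of_nat_Suc)
        finally show ?thesis using True by simp
      next
        case False
        have "norm (?t *\<^sub>R v) \<le> norm v" 
          using mult_right_mono[of ?t 1 "norm v"] by simp
        moreover have "norm x \<le> norm (x + ?t *\<^sub>R v) + norm (?t *\<^sub>R v)"
          by (metis add_diff_cancel_right' norm_triangle_ineq4)
        ultimately have "norm (x + ?t *\<^sub>R v) > R" using False by linarith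
        hence "G (x + ?t *\<^sub>R v) = 0" using R by force
        moreover have "G x = 0" using R[of x] False norm_ge_zero[of v] by force
        ultimately show ?thesis by (simp add: C_def)
      qed
    qed
  qed
  moreover have "(LINT x|lborel. ?F n x) = 0" for n
  proof -
    have "(LINT x|lborel. ?F n x) = real (Suc n) *\<^sub>R
        ((LINT x|lborel. G (x + (1 / real (Suc n)) *\<^sub>R v)) - (LINT x|lborel. G x))"
      by (subst integral_scaleR_right, subst Bochner_Integration.integral_diff[OF integrable_translate[OF intG] intG]) rule
    also have "\<dots> = 0"
      by (subst integral_translate) (auto intro: borel_measurable_continuous_onI[OF G])
    finally show ?thesis .
  qed
  ultimately have "(\<lambda>n. 0) \<longlonglongrightarrow> (LINT x|lborel. ?D x)" by (simp only:)
  thus "(LINT x|lborel. ?D x) = 0" using LIMSEQ_unique[OF _ tendsto_const] by blast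
qed

lemma integral_wirt_0:
  fixes G :: "complex ^ 'n::finite \<Rightarrow> complex"
  assumes "Ck 1 G" and "\<And>z. G z \<noteq> 0 \<Longrightarrow> norm z \<le> R"
  shows "(LINT x|lborel. wirt v G x) = 0"
  unfolding wirt_def using integral_frechet_derivative_0[OF assms] by simp

section \<open>Differentiable parameter integrals\<close>

lemma norm_vector_smult: "norm (a *s v) = norm a * norm (v :: complex ^ 'n::finite)"
  by (simp add: norm_vec_def L2_set_right_distrib norm_mult)

definition cdiff_at :: "(complex ^ 'r::finite \<Rightarrow> complex) \<Rightarrow> complex ^ 'r \<Rightarrow> bool" where
  "cdiff_at f s \<longleftrightarrow> (\<exists>D. (f has_derivative D) (at s) \<and> (\<forall>a v. D (a *s v) = a * D v))"

lemma cdiff_at_const [simp]: "cdiff_at (\<lambda>s. a) s"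
  unfolding cdiff_at_def by (rule exI[of _ "\<lambda>_. 0"]) auto

lemma cdiff_at_add: "cdiff_at f s \<Longrightarrow> cdiff_at g s \<Longrightarrow> cdiff_at (\<lambda>s. f s + g s) s"
  unfolding cdiff_at_def
proof (elim exE conjE)
  fix D E assume "(f has_derivative D) (at s)" "\<forall>a v. D (a *s v) = a * D v"
    "(g has_derivative E) (at s)" "\<forall>a v. E (a *s v) = a * E v"
  thus "\<exists>D. ((\<lambda>s. f s + g s) has_derivative D) (at s) \<and> (\<forall>a v. D (a *s v) = a * D v)"
    by (intro exI[of _ "\<lambda>h. D h + E h"] conjI has_derivative_add) (auto simp: algebra_simps)
qed

lemma cdiff_at_mult: "cdiff_at f s \<Longrightarrow> cdiff_at g s \<Longrightarrow> cdiff_at (\<lambda>s. f s * g s) s"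
  unfolding cdiff_at_def
proof (elim exE conjE)
  fix D E assume "(f has_derivative D) (at s)" "\<forall>a v. D (a *s v) = a * D v"
    "(g has_derivative E) (at s)" "\<forall>a v. E (a *s v) = a * E v"
  thus "\<exists>D. ((\<lambda>s. f s * g s) has_derivative D) (at s) \<and> (\<forall>a v. D (a *s v) = a * D v)"
    by (intro exI[of _ "\<lambda>h. f s * E h + D h * g s"] conjI has_derivative_mult) (auto simp: algebra_simps)
qed

lemma cdiff_at_uminus: "cdiff_at f s \<Longrightarrow> cdiff_at (\<lambda>s. - f s) s"
  using cdiff_at_mult[of "\<lambda>_. -1" s f] by simp

lemma cdiff_at_sum: "(\<And>i. i \<in> A \<Longrightarrow> cdiff_at (f i) s) \<Longrightarrow> cdiff_at (\<lambda>s. \<Sum>i\<in>A. f i s) s"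
  by (induction A rule: infinite_finite_induct) (auto intro: cdiff_at_add)

lemma cdiff_at_prod: "(\<And>i. i \<in> A \<Longrightarrow> cdiff_at (f i) s) \<Longrightarrow> cdiff_at (\<lambda>s. \<Prod>i\<in>A. f i s) s"
  by (induction A rule: infinite_finite_induct) (auto intro: cdiff_at_mult)

lemma cdiff_at_component:
  assumes "(h has_field_derivative h') (at (s $ i))"
  shows "cdiff_at (\<lambda>s. h (s $ i)) s"
proof -
  have "((\<lambda>s. s $ i) has_derivative (\<lambda>v. v $ i)) (at s)"
    by (intro bounded_linear_imp_has_derivative bounded_linear_vec_nth)
  from has_derivative_compose[OF this assms[unfolded has_field_derivative_def]]
  show ?thesis unfolding cdiff_at_def by (intro exI) (auto simp: algebra_simps)
qed

lemma cdiff_at_nth [simp]: "cdiff_at (\<lambda>s. s $ i) s"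
  using cdiff_at_component[of "\<lambda>x. x" 1 s i] by simp

lemma cdiff_at_line:
  assumes "cdiff_at f (s + w *s v)"
  shows "\<exists>d. ((\<lambda>w. f (s + w *s v)) has_field_derivative d) (at w)"
proof -
  obtain D where D: "(f has_derivative D) (at (s + w *s v))" "\<And>a v. D (a *s v) = a * D v"
    using assms by (auto simp: cdiff_at_def)
  have "bounded_linear (\<lambda>h::complex. h *s v)"
    by (rule bounded_linear_intro[of _ "norm v"])
      (auto simp: norm_vector_smult vec_eq_iff scaleR_conv_of_real[where 'a=complex] algebra_simps)
  hence "((\<lambda>w. s + w *s v) has_derivative (\<lambda>h. 0 + h *s v)) (at w)"
    by (intro has_derivative_add has_derivative_const bounded_linear_imp_has_derivative)
  hence "((\<lambda>w. s + w *s v) has_derivative (\<lambda>h. h *s v)) (at w)" by simp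
  from has_derivative_compose[OF this D(1)]
  have "((\<lambda>w. f (s + w *s v)) has_derivative (\<lambda>h. h * D v)) (at w)" by (simp add: D(2))
  thus ?thesis unfolding has_field_derivative_def by (intro exI[of _ "D v"]) (simp add: mult_commute_abs)
qed

lemma cdiff_line_holomorphic:
  assumes "\<And>w. w \<in> S \<Longrightarrow> cdiff_at f (s + w *s v)"
  shows "(\<lambda>w. f (s + w *s v)) holomorphic_on S"
  using cdiff_at_line[OF assms]
  by (auto simp: holomorphic_on_def field_differentiable_def) (metis has_field_derivative_at_within)

text \<open>Cauchy's inequality on the complex line through \<open>s0\<close> in direction
  \<open>h\<close>. With \<open>R = \<rho> / norm h\<close> the disc of radius \<open>2 * R\<close>
  maps into the ball, so the derivative is at most \<open>H / R\<close> on the disc of radius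
  \<open>R\<close>, which contains both 0 and 1. A bound on values thus becomes a Lipschitz
  bound.\<close>

lemma cauchy_difference_bound:
  assumes "\<And>s. s \<in> ball s0 (2 * \<rho>) \<Longrightarrow> cdiff_at g s" "\<And>s. s \<in> ball s0 (2 * \<rho>) \<Longrightarrow> norm (g s) \<le> H"
    and "\<rho> > 0" "norm h < \<rho>"
  shows "norm (g (s0 + h) - g s0) \<le> H / \<rho> * norm h"
proof (cases "h = 0")
  case False
  define R where "R = \<rho> / norm h"
  have R: "R > 1" using False assms by (simp add: R_def field_simps)
  let ?k = "\<lambda>w. g (s0 + w *s h)"
  have inb: "s0 + w *s h \<in> ball s0 (2 * \<rho>)" if "norm w < 2 * R" for w
    using that False by (simp add: dist_norm norm_vector_smult R_def field_simps)
  have hol: "?k holomorphic_on ball 0 (2 * R)"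
    by (rule cdiff_line_holomorphic) (use assms(1) inb in auto)
  have der: "norm (deriv ?k w) \<le> H / R" if w: "w \<in> ball 0 R" for w
  proof -
    have sub: "cball w R \<subseteq> ball 0 (2 * R)"
    proof
      fix x assume "x \<in> cball w R"
      thus "x \<in> ball 0 (2 * R)" using w norm_triangle_ineq2[of x w]
        by (auto simp: dist_norm norm_minus_commute)
    qed
    have "norm ((deriv ^^ 1) ?k w) \<le> fact 1 * H / R ^ 1"
    proof (rule Cauchy_inequality)
      show "?k holomorphic_on ball w R" using hol sub ball_subset_cball holomorphic_on_subset by blast
      show "continuous_on (cball w R) ?k" using hol sub holomorphic_on_imp_continuous_on continuous_on_subset by blast
      show "norm (?k x) \<le> H" if "norm (w - x) = R" for x
        using sub that inb[of x] assms(2) by (auto simp: dist_norm subset_iff)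
    qed (use R in auto)
    thus ?thesis by simp
  qed
  have "norm (?k 1 - ?k 0) \<le> H / R * norm (1 - 0 :: complex)"
  proof (rule field_differentiable_bound[OF convex_ball[of 0 R]])
    fix w assume "w \<in> ball (0::complex) R"
    hence "w \<in> ball 0 (2 * R)" using R by auto
    thus "(?k has_field_derivative deriv ?k w) (at w within ball 0 R)"
      using holomorphic_derivI[OF hol, of w] by (auto intro: has_field_derivative_at_within)
  qed (use der R in auto)
  thus ?thesis by (simp add: R_def)
qed auto

text \<open>Only \<open>g\<close> itself is dominated. The bounds on difference quotients and
  derivatives that dominated convergence asks for come from
  \<open>cauchy_difference_bound\<close>.\<close>

lemma cdiff_at_integral:
  fixes g :: "complex ^ 'r::finite \<Rightarrow> 'z \<Rightarrow> complex"
  assumes \<rho>: "\<rho> > 0"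
    and diff: "\<And>s z. s \<in> ball s0 (2 * \<rho>) \<Longrightarrow> cdiff_at (\<lambda>s. g s z) s"
    and meas: "\<And>s. g s \<in> borel_measurable M"
    and H: "integrable M H" and le: "\<And>s z. s \<in> ball s0 (2 * \<rho>) \<Longrightarrow> norm (g s z) \<le> H z"
  shows "cdiff_at (\<lambda>s. LINT z|M. g s z) s0"
proof -
  have s0: "s0 \<in> ball s0 (2 * \<rho>)" using \<rho> by simp
  have "\<forall>z. \<exists>D. ((\<lambda>s. g s z) has_derivative D) (at s0) \<and> (\<forall>a v. D (a *s v) = a * D v)"
    using diff[OF s0] by (simp add: cdiff_at_def)
  then obtain D where D: "\<And>z. ((\<lambda>s. g s z) has_derivative D z) (at s0)" "\<And>z a v. D z (a *s v) = a * D z v"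
    by metis
  have H0: "H z \<ge> 0" for z using le[OF s0, of z] norm_ge_zero order_trans by blast
  have int: "integrable M (g s)" if "s \<in> ball s0 (2 * \<rho>)" for s
    by (rule Bochner_Integration.integrable_bound[OF H meas]) (use le[OF that] H0 in auto)
  have lip: "norm (g (s0 + h) z - g s0 z) \<le> H z / \<rho> * norm h" if "norm h < \<rho>" for h z
    by (rule cauchy_difference_bound[OF _ _ \<rho> that]) (use diff le in auto)
  have lin: "bounded_linear (D z)" for z using D(1) by (simp add: has_derivative_def)
  \<comment> \<open>The Lipschitz bound passes to the limit along difference quotients, whose steps
    are eventually shorter than \<rho>.\<close>
  have Dle: "norm (D z v) \<le> H z / \<rho> * norm v" for z v
  proof -
    obtain N where N: "norm v / \<rho> < real N" using reals_Archimedean2 by blast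
    have *: "norm v / real (Suc n) < \<rho>" if "n \<ge> N" for n
    proof -
      have "norm v / \<rho> < real (Suc n)" using N that by linarith
      thus ?thesis using \<rho> by (simp add: field_simps)
    qed
    show ?thesis
    proof (rule LIMSEQ_le_const2[OF tendsto_norm[OF directional_limit[OF D(1)[of z], of v]]], intro exI allI impI)
      fix n assume n: "n \<ge> N"
      have small: "norm ((1 / real (Suc n)) *\<^sub>R v) < \<rho>" using *[OF n] by simp
      have "norm (real (Suc n) *\<^sub>R (g (s0 + (1 / real (Suc n)) *\<^sub>R v) z - g s0 z)) =
          real (Suc n) * norm (g (s0 + (1 / real (Suc n)) *\<^sub>R v) z - g s0 z)" by (simp del: of_nat_Suc)
      also have "\<dots> \<le> real (Suc n) * (H z / \<rho> * norm ((1 / real (Suc n)) *\<^sub>R v))"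
        by (intro mult_left_mono lip small) auto
      also have "\<dots> = H z / \<rho> * norm v" by (simp del: of_nat_Suc)
      finally show "norm (real (Suc n) *\<^sub>R (g (s0 + (1 / real (Suc n)) *\<^sub>R v) z - g s0 z)) \<le> H z / \<rho> * norm v" .
    qed
  qed
  have Dmeas [measurable]: "(\<lambda>z. D z v) \<in> borel_measurable M" for v
  proof (rule borel_measurable_LIMSEQ_metric)
    show "(\<lambda>z. real (Suc n) *\<^sub>R (g (s0 + (1 / real (Suc n)) *\<^sub>R v) z - g s0 z)) \<in> borel_measurable M" for n
      using meas by measurable
    show "(\<lambda>n. real (Suc n) *\<^sub>R (g (s0 + (1 / real (Suc n)) *\<^sub>R v) z - g s0 z)) \<longlonglongrightarrow> D z v" for z
      by (rule directional_limit[OF D(1)])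
  qed
  have Dint: "integrable M (\<lambda>z. D z v)" for v
  proof (rule Bochner_Integration.integrable_bound)
    show "integrable M (\<lambda>z. H z / \<rho> * norm v)" using H by simp
    show "AE z in M. norm (D z v) \<le> norm (H z / \<rho> * norm v)" using Dle H0 \<rho> by (auto intro!: AE_I2)
  qed auto
  define D' where "D' v = (LINT z|M. D z v)" for v
  have "((\<lambda>s. LINT z|M. g s z) has_derivative D') (at s0)"
    unfolding has_derivative_iff_norm
  proof (rule conjI)
    show "bounded_linear D'"
    proof (rule bounded_linear_intro[of _ "(LINT z|M. H z) / \<rho>"])
      show "D' (x + y) = D' x + D' y" for x y
        unfolding D'_def using Dint lin by (simp add: linear_simps(1) flip: Bochner_Integration.integral_add)
      show "D' (r *\<^sub>R x) = r *\<^sub>R D' x" for r x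
        unfolding D'_def using lin by (simp add: linear_simps(5) flip: integral_scaleR_right)
      show "norm (D' x) \<le> norm x * ((LINT z|M. H z) / \<rho>)" for x
      proof -
        have "norm (D' x) \<le> (LINT z|M. H z / \<rho> * norm x)"
          unfolding D'_def
          by (rule order_trans[OF integral_norm_bound integral_mono]) (use Dint H Dle in auto)
        thus ?thesis by (simp add: mult.commute)
      qed
    qed
    show "((\<lambda>y. norm ((LINT z|M. g y z) - (LINT z|M. g s0 z) - D' (y - s0)) / norm (y - s0)) \<longlongrightarrow> 0) (at s0)"
      unfolding tendsto_at_iff_sequentially comp_def
    proof (intro allI impI)
      fix X :: "nat \<Rightarrow> complex ^ 'r"
      assume X: "\<forall>i. X i \<in> UNIV - {s0}" "X \<longlonglongrightarrow> s0"
      obtain N where N: "\<And>n. n \<ge> N \<Longrightarrow> dist (X n) s0 < \<rho>" using metric_LIMSEQ_D[OF X(2) \<rho>] by blast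
      \<comment> \<open>Dropping finitely many terms puts the whole sequence into the ball on which
        the Lipschitz bound holds.\<close>
      define Y where "Y n = X (n + N)" for n
      have Y: "Y n \<noteq> s0" "norm (Y n - s0) < \<rho>" for n using X(1) N[of "n + N"] by (auto simp: Y_def dist_norm)
      have Ylim: "Y \<longlonglongrightarrow> s0" unfolding Y_def using X(2) by (rule LIMSEQ_ignore_initial_segment)
      let ?q = "\<lambda>n z. (g (Y n) z - g s0 z - D z (Y n - s0)) /\<^sub>R norm (Y n - s0)"
      have Yb: "Y n \<in> ball s0 (2 * \<rho>)" for n using Y(2)[of n] \<rho> by (simp add: dist_norm norm_minus_commute)
      have "(\<lambda>n. LINT z|M. ?q n z) \<longlonglongrightarrow> (LINT z|M. 0)"
      proof (rule integral_dominated_convergence)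
        \<comment> \<open>One \<open>H z / \<rho>\<close> bounds the increment of \<open>g\<close>,
          the other its linear part.\<close>
        show "integrable M (\<lambda>z. 2 * (H z / \<rho>))" using H by simp
        show "?q n \<in> borel_measurable M" for n using meas by measurable
        show "AE z in M. (\<lambda>n. ?q n z) \<longlonglongrightarrow> 0"
        proof (rule AE_I2)
          fix z
          have "((\<lambda>y. (g y z - g s0 z - D z (y - s0)) /\<^sub>R norm (y - s0)) \<longlongrightarrow> 0) (at s0)"
            using D(1)[of z] unfolding has_derivative_at_within by (simp add: algebra_simps)
          moreover have "filterlim Y (at s0) sequentially" using Ylim Y(1) by (simp add: filterlim_at)
          ultimately show "(\<lambda>n. ?q n z) \<longlonglongrightarrow> 0" by (rule filterlim_compose)
        qed
        show "AE z in M. norm (?q n z) \<le> 2 * (H z / \<rho>)" for n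
        proof (rule AE_I2)
          fix z
          have "norm (g (Y n) z - g s0 z - D z (Y n - s0)) \<le> H z / \<rho> * norm (Y n - s0) + H z / \<rho> * norm (Y n - s0)"
            using lip[OF Y(2), of n z] Dle[of z "Y n - s0"]
              norm_triangle_ineq4[of "g (Y n) z - g s0 z" "D z (Y n - s0)"] by simp
          moreover have "norm (Y n - s0) > 0" using Y(1)[of n] by simp
          ultimately show "norm (?q n z) \<le> 2 * (H z / \<rho>)"
            unfolding norm_scaleR by (simp add: divide_simps mult_ac split: if_splits)
        qed
      qed auto
      hence "(\<lambda>n. norm (LINT z|M. ?q n z)) \<longlonglongrightarrow> 0" using tendsto_norm_zero by fastforce
      moreover have "norm (LINT z|M. ?q n z) =
          norm ((LINT z|M. g (Y n) z) - (LINT z|M. g s0 z) - D' (Y n - s0)) / norm (Y n - s0)" for n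
        using int[OF Yb] int[OF s0] Dint by (simp add: D'_def divide_inverse mult.commute)
      ultimately have "(\<lambda>n. norm ((LINT z|M. g (Y n) z) - (LINT z|M. g s0 z) - D' (Y n - s0)) / norm (Y n - s0)) \<longlonglongrightarrow> 0"
        by simp
      thus "(\<lambda>x. norm ((LINT z|M. g (X x) z) - (LINT z|M. g s0 z) - D' (X x - s0)) / norm (X x - s0)) \<longlonglongrightarrow> 0"
        unfolding Y_def by (rule LIMSEQ_offset)
    qed
  qed
  moreover have "D' (a *s v) = a * D' v" for a v unfolding D'_def by (simp add: D(2))
  ultimately show ?thesis unfolding cdiff_at_def by blast
qed

section \<open>Complex powers of the squared modulus\<close>

definition abs_powr :: "complex \<Rightarrow> complex \<Rightarrow> complex" where
  "abs_powr s \<zeta> = of_real (norm \<zeta>) powr (2 * s)"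

text \<open>This includes \<open>s = 0\<close>, as \<open>0 powr 0 = 0\<close> for complex numbers.
  Products of these powers therefore vanish on the hyperplanes for every exponent, and
  \<open>wt 0\<close> below is the indicator of the complement of the arrangement.\<close>

lemma abs_powr_0 [simp]: "abs_powr s 0 = 0"
  by (simp add: abs_powr_def)

lemma abs_powr_exp: "\<zeta> \<noteq> 0 \<Longrightarrow> abs_powr s \<zeta> = exp (2 * s * of_real (ln (norm \<zeta>)))"
  by (simp add: abs_powr_def powr_def Ln_of_real)

lemma norm_abs_powr: "norm (abs_powr s \<zeta>) = norm \<zeta> powr (2 * Re s)"
  by (simp add: abs_powr_def norm_powr_real_powr)

lemma has_field_derivative_abs_powr_exponent:
  "((\<lambda>s. abs_powr s \<zeta>) has_field_derivative 2 * of_real (ln (norm \<zeta>)) * abs_powr s \<zeta>) (at s)"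
proof (cases "\<zeta> = 0")
  case False
  have "((\<lambda>s. exp (2 * s * of_real (ln (norm \<zeta>)))) has_field_derivative
      2 * of_real (ln (norm \<zeta>)) * exp (2 * s * of_real (ln (norm \<zeta>)))) (at s)"
    by (auto intro!: derivative_eq_intros)
  thus ?thesis using False by (simp add: abs_powr_exp)
qed simp

lemma borel_measurable_abs_powr [measurable]: "abs_powr s \<in> borel_measurable borel"
proof -
  have "abs_powr s = (\<lambda>\<zeta>. if \<zeta> = 0 then 0 else exp (2 * s * of_real (ln (norm \<zeta>))))"
    by (auto simp: abs_powr_exp)
  also have "\<dots> \<in> borel_measurable borel"
    by (intro measurable_If measurable_compose[OF _ borel_measurable_continuous_onI[OF continuous_on_exp[OF continuous_on_id]]]) auto
  finally show ?thesis .
qed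

definition abs_powr_deriv :: "complex \<Rightarrow> complex \<Rightarrow> complex \<Rightarrow> complex" where
  "abs_powr_deriv s \<zeta> \<eta> = 2 * s * abs_powr s \<zeta> * of_real (Re (cnj \<zeta> * \<eta>)) / of_real (norm \<zeta> ^ 2)"

text \<open>Away from 0 this is the chain rule. At 0, where \<open>abs_powr_deriv\<close> evaluates
  to 0, the estimate \<open>norm y powr (2 * Re s) \<le> norm y powr 2\<close> near the origin makes
  the difference quotient vanish in the limit. This is why integration by parts takes place on
  \<open>orthant 1\<close>.\<close>

lemma has_derivative_abs_powr:
  assumes "Re s > 1"
  shows "(abs_powr s has_derivative abs_powr_deriv s \<zeta>) (at \<zeta>)"
proof (cases "\<zeta> = 0")
  case False
  have n: "(norm has_derivative (\<lambda>h. inner h (sgn \<zeta>))) (at \<zeta>)"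
    using has_derivative_norm[OF False] by (simp add: inner_commute)
  have "((\<lambda>x. of_real x powr (2 * s) :: complex) has_derivative
     (\<lambda>h. of_real h * (2 * s * of_real (norm \<zeta>) powr (2 * s - 1)))) (at (norm \<zeta>))"
    using has_derivative_compose[of of_real of_real "norm \<zeta>" UNIV "\<lambda>z::complex. z powr (2 * s)"
      "\<lambda>h. h * (2 * s * of_real (norm \<zeta>) powr (2 * s - 1))"]
      has_field_derivative_powr[of "of_real (norm \<zeta>)" "2 * s"] False
    by (simp add: has_field_derivative_def mult_commute_abs bounded_linear_of_real bounded_linear_imp_has_derivative
        complex_nonpos_Reals_iff)
  from has_derivative_compose[OF n this]
  have "(abs_powr s has_derivative
     (\<lambda>h. of_real (inner h (sgn \<zeta>)) * (2 * s * of_real (norm \<zeta>) powr (2 * s - 1)))) (at \<zeta>)"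
    by (simp add: abs_powr_def[abs_def])
  also have "(\<lambda>h. of_real (inner h (sgn \<zeta>)) * (2 * s * of_real (norm \<zeta>) powr (2 * s - 1))) = abs_powr_deriv s \<zeta>"
  proof
    fix h
    have "inner h (sgn \<zeta>) = Re (cnj \<zeta> * h) / norm \<zeta>"
      using False by (simp add: sgn_div_norm inner_complex_def field_simps)
    moreover have "of_real (norm \<zeta>) powr (2 * s - 1) = abs_powr s \<zeta> / of_real (norm \<zeta>)"
      using False by (simp add: abs_powr_def powr_diff)
    ultimately show "of_real (inner h (sgn \<zeta>)) * (2 * s * of_real (norm \<zeta>) powr (2 * s - 1)) = abs_powr_deriv s \<zeta> h"
      using False by (simp add: abs_powr_deriv_def power2_eq_square)
  qed
  finally show ?thesis .
next
  case True
  have "(abs_powr s has_derivative (\<lambda>_. 0)) (at 0)"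
    unfolding has_derivative_iff_norm
  proof (intro conjI)
    show "((\<lambda>y. norm (abs_powr s y - abs_powr s 0 - 0) / norm (y - 0)) \<longlongrightarrow> 0) (at 0)"
    proof (rule tendsto_sandwich[of "\<lambda>_. 0" _ _ norm])
      have "\<forall>\<^sub>F y in at (0::complex). y \<in> ball 0 1 \<and> y \<noteq> 0 \<and> y \<in> UNIV" by (rule eventually_at_ball') simp
      thus "\<forall>\<^sub>F y in at 0. norm (abs_powr s y - abs_powr s 0 - 0) / norm (y - 0) \<le> norm y"
      proof eventually_elim
        case (elim y)
        have "norm y powr (2 * Re s) \<le> norm y powr 2"
          using elim assms by (intro powr_mono') (auto simp: dist_norm)
        thus ?case using elim by (simp add: norm_abs_powr field_simps power2_eq_square)
      qed
      show "(norm \<longlongrightarrow> 0) (at (0::complex))" by (rule tendsto_norm_zero) (rule tendsto_ident_at)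
    qed auto
  qed auto
  thus ?thesis using True by (simp add: abs_powr_deriv_def[abs_def])
qed

lemma Ck_1_abs_powr:
  assumes "Re s > 1"
  shows "Ck 1 (abs_powr s)"
proof -
  have fd: "frechet_derivative (abs_powr s) (at \<zeta>) = abs_powr_deriv s \<zeta>" for \<zeta>
    using frechet_derivative_at[OF has_derivative_abs_powr[OF assms]] by metis
  have cont: "isCont (abs_powr s) \<zeta>" for \<zeta>
    using has_derivative_continuous[OF has_derivative_abs_powr[OF assms]] .
  have "isCont (\<lambda>\<zeta>. abs_powr_deriv s \<zeta> \<eta>) \<zeta>" for \<zeta> \<eta>
  proof (cases "\<zeta> = 0")
    case False
    thus ?thesis unfolding abs_powr_deriv_def using cont by (intro continuous_intros) auto
  next
    case True
    have "((\<lambda>\<zeta>. abs_powr_deriv s \<zeta> \<eta>) \<longlongrightarrow> 0) (at 0)"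
    proof (rule Lim_null_comparison)
      have "\<forall>\<^sub>F y in at (0::complex). y \<in> ball 0 1 \<and> y \<noteq> 0 \<and> y \<in> UNIV" by (rule eventually_at_ball') simp
      thus "\<forall>\<^sub>F y in at 0. norm (abs_powr_deriv s y \<eta>) \<le> 2 * norm s * norm \<eta> * norm y"
      proof eventually_elim
        case (elim y)
        have "norm y powr (2 * Re s) \<le> norm y powr 2"
          using elim assms by (intro powr_mono') (auto simp: dist_norm)
        hence 1: "norm (abs_powr s y) \<le> norm y ^ 2" using elim by (simp add: norm_abs_powr)
        have 2: "\<bar>Re (cnj y * \<eta>)\<bar> \<le> norm y * norm \<eta>"
          using abs_Re_le_cmod[of "cnj y * \<eta>"] by (simp add: norm_mult)
        have "norm (abs_powr_deriv s y \<eta>) = 2 * norm s * (norm (abs_powr s y) / norm y ^ 2) * \<bar>Re (cnj y * \<eta>)\<bar>"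
          unfolding abs_powr_deriv_def by (simp only: norm_mult norm_divide norm_of_real) (simp add: norm_power)
        also have "\<dots> \<le> 2 * norm s * 1 * (norm y * norm \<eta>)"
          using 1 2 elim by (intro mult_mono) auto
        finally show ?case by (simp add: mult_ac)
      qed
      show "((\<lambda>y. 2 * norm s * norm \<eta> * norm y) \<longlongrightarrow> 0) (at (0::complex))"
        by (rule tendsto_mult_right_zero, rule tendsto_norm_zero, rule tendsto_ident_at)
    qed
    thus ?thesis using True by (simp add: isCont_def abs_powr_deriv_def)
  qed
  thus ?thesis using has_derivative_abs_powr[OF assms]
    by (auto simp: fd differentiable_def intro!: continuous_at_imp_continuous_on)
qed

text \<open>Heuristically the power is the product of the \<open>s\<close>-th powers of the form and
  of its conjugate, and the Wirtinger derivative sees the first only; hence \<open>s\<close> and not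
  \<open>2 * s\<close>. Where the form vanishes both sides are 0, the right one through division by
  zero.\<close>

lemma wirt_abs_powr:
  assumes "Re s > 1"
  shows "wirt v (\<lambda>z. abs_powr s (lform c z)) z = s * lform c v / lform c z * abs_powr s (lform c z)"
proof -
  let ?\<zeta> = "lform c z"
  have "(lform c has_derivative lform c) (at z)"
    by (rule bounded_linear_imp_has_derivative[OF bounded_linear_lform])
  note * = has_derivative_compose[OF this has_derivative_abs_powr[OF assms]]
  define q where "q = cnj ?\<zeta> * lform c v"
  \<comment> \<open>A complex number is recovered from the real parts of itself and of its multiple
    by \<open>\<i>\<close>; this is how \<open>wirt\<close> extracts the complex linear part of a
    real derivative.\<close>
  have q: "of_real (Re q) - \<i> * of_real (Re (\<i> * q)) = q" by (simp add: complex_eq_iff)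
  have alg: "(2 * s * W * a / N - \<i> * (2 * s * W * b / N)) / 2 = s * W / N * (a - \<i> * b)" for W a N b
    by (simp add: field_simps diff_divide_distrib)
  have iq: "cnj ?\<zeta> * lform c (\<i> *s v) = \<i> * q" by (simp add: q_def)
  have "wirt v (\<lambda>z. abs_powr s (lform c z)) z =
      s * abs_powr s ?\<zeta> / of_real (norm ?\<zeta> ^ 2) * (of_real (Re q) - \<i> * of_real (Re (\<i> * q)))"
    unfolding wirt_eqI[OF *] abs_powr_deriv_def iq q_def[symmetric] alg ..
  also have "\<dots> = s * abs_powr s ?\<zeta> / (?\<zeta> * cnj ?\<zeta>) * q" unfolding q complex_norm_square ..
  also have "\<dots> = s * lform c v / ?\<zeta> * abs_powr s ?\<zeta>"
    by (cases "?\<zeta> = 0") (auto simp: q_def field_simps)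
  finally show ?thesis .
qed

lemma wirt_lform: "wirt v (lform c) z = lform c v"
  by (subst wirt_eqI[OF bounded_linear_imp_has_derivative[OF bounded_linear_lform]]) simp

section \<open>Continuation in several exponents\<close>

text \<open>Logarithmic differentiation that allows factors to vanish: \<open>d t\<close> plays the
  role of the logarithmic derivative of \<open>f t\<close>.\<close>

lemma wirt_prod:
  assumes "finite A" "\<And>t. t \<in> A \<Longrightarrow> f t differentiable (at z)" "\<And>t. t \<in> A \<Longrightarrow> wirt v (f t) z = d t * f t z"
  shows "wirt v (\<lambda>z. \<Prod>t\<in>A. f t z) z = (\<Sum>t\<in>A. d t) * (\<Prod>t\<in>A. f t z) \<and>
    (\<lambda>z. \<Prod>t\<in>A. f t z) differentiable (at z)"
  using assms
proof (induction A rule: finite_induct)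
  case (insert x A)
  thus ?case by (auto simp: wirt_mult algebra_simps intro!: differentiable_mult)
qed auto

section \<open>Holomorphic extension from an orthant\<close>

definition orthant :: "real \<Rightarrow> (complex ^ 'r::finite) set" where
  "orthant a = {s. \<forall>i. Re (s $ i) > a}"

lemma orthant_mono: "a \<le> b \<Longrightarrow> orthant b \<subseteq> orthant a"
  by (auto simp: orthant_def intro: le_less_trans)


text \<open>\<open>orthant 1\<close> is where integration by parts is valid. On
  \<open>orthant (-(K/2))\<close> an additional factor \<open>lform (c i) z ^ K\<close> for every
  \<open>i\<close> keeps the integrand bounded near the hyperplanes.\<close>

definition extends :: "nat \<Rightarrow> (complex ^ 'r::finite \<Rightarrow> complex) \<Rightarrow> bool" where
  "extends K G \<longleftrightarrow> (\<exists>H. (\<forall>s\<in>orthant (-(K/2)). cdiff_at H s) \<and> (\<forall>s\<in>orthant 1. H s = G s))"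

lemma extends_cong: "(\<And>s. s \<in> orthant 1 \<Longrightarrow> G s = G' s) \<Longrightarrow> extends K G \<Longrightarrow> extends K G'"
  by (auto simp: extends_def)

lemma extends_add: "extends K F \<Longrightarrow> extends K G \<Longrightarrow> extends K (\<lambda>s. F s + G s)"
  unfolding extends_def
proof (elim exE conjE)
  fix H H' assume "\<forall>s\<in>orthant (-(K/2)). cdiff_at H s" "\<forall>s\<in>orthant 1. H s = F s"
    "\<forall>s\<in>orthant (-(K/2)). cdiff_at H' s" "\<forall>s\<in>orthant 1. H' s = G s"
  thus "\<exists>H. (\<forall>s\<in>orthant (-(K/2)). cdiff_at H s) \<and> (\<forall>s\<in>orthant 1. H s = F s + G s)"
    by (intro exI[of _ "\<lambda>s. H s + H' s"]) (auto intro!: cdiff_at_add)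
qed

lemma extends_mult: "(\<And>s. cdiff_at p s) \<Longrightarrow> extends K G \<Longrightarrow> extends K (\<lambda>s. p s * G s)"
  unfolding extends_def
proof (elim exE conjE)
  fix H assume "\<And>s. cdiff_at p s" "\<forall>s\<in>orthant (-(K/2)). cdiff_at H s" "\<forall>s\<in>orthant 1. H s = G s"
  thus "\<exists>H. (\<forall>s\<in>orthant (-(K/2)). cdiff_at H s) \<and> (\<forall>s\<in>orthant 1. H s = p s * G s)"
    by (intro exI[of _ "\<lambda>s. p s * H s"]) (auto intro!: cdiff_at_mult)
qed

lemma extends_0: "extends K (\<lambda>s. 0)"
  unfolding extends_def by (rule exI[of _ "\<lambda>_. 0"]) auto

lemma extends_sum: "(\<And>i. i \<in> A \<Longrightarrow> extends K (F i)) \<Longrightarrow> extends K (\<lambda>s. \<Sum>i\<in>A. F i s)"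
  by (induction A rule: infinite_finite_induct) (auto intro: extends_add extends_0)

section \<open>Integrals of products of powers of the forms\<close>

context arrangement
begin

definition wt :: "complex ^ 'r \<Rightarrow> complex ^ 'n \<Rightarrow> complex" where
  "wt s z = (\<Prod>i\<in>UNIV. abs_powr (s $ i) (lform (c i) z))"

definition lpow :: "('r \<Rightarrow> nat) \<Rightarrow> complex ^ 'n \<Rightarrow> complex" where
  "lpow \<alpha> z = (\<Prod>i\<in>UNIV. lform (c i) z ^ \<alpha> i)"

definition zint :: "complex ^ 'r \<Rightarrow> (complex ^ 'n \<Rightarrow> complex) \<Rightarrow> complex" where
  "zint s \<psi> = (LINT z|lborel. wt s z * \<psi> z)"

lemma Ck_lform: "Ck k (lform d)"
  by (rule Ck_bounded_linear[OF bounded_linear_lform])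

lemma Ck_lpow: "Ck k (lpow \<alpha>)"
  unfolding lpow_def by (intro Ck_prod Ck_power Ck_lform)

lemma lpow_0 [simp]: "lpow (\<lambda>_. 0) z = 1"
  by (simp add: lpow_def)

lemma lpow_Suc: "lpow (\<alpha>(i := Suc (\<alpha> i))) z = lform (c i) z * lpow \<alpha> z"
proof -
  have "lpow (\<alpha>(i := Suc (\<alpha> i))) z = lform (c i) z ^ Suc (\<alpha> i) * (\<Prod>j\<in>UNIV - {i}. lform (c j) z ^ \<alpha> j)"
    unfolding lpow_def by (subst prod.remove[of _ i]) (auto intro!: prod.cong)
  also have "\<dots> = lform (c i) z * (\<Prod>j\<in>UNIV. lform (c j) z ^ \<alpha> j)"
    by (subst prod.remove[of UNIV i]) (auto simp: mult_ac)
  finally show ?thesis by (simp add: lpow_def)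
qed

lemma lpow_le: "(\<And>i. \<alpha> i \<le> \<beta> i) \<Longrightarrow> lpow \<beta> z = lpow \<alpha> z * lpow (\<lambda>i. \<beta> i - \<alpha> i) z"
  by (simp add: lpow_def flip: prod.distrib power_add)

lemma test_function_lpow: "test_function \<psi> \<Longrightarrow> test_function (\<lambda>z. lpow \<alpha> z * \<psi> z)"
  by (intro test_function_mult Ck_lpow)

lemma test_function_continuous: "test_function \<psi> \<Longrightarrow> continuous_on UNIV \<psi>"
  by (auto simp: test_function_def dest: spec[of _ 0])

lemma borel_measurable_lform [measurable]: "lform d \<in> borel_measurable borel"
  by (intro borel_measurable_continuous_onI linear_continuous_on bounded_linear_lform)

lemma borel_measurable_wt [measurable]: "wt s \<in> borel_measurable borel"
  unfolding wt_def by measurable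

lemma cdiff_at_wt: "cdiff_at (\<lambda>s. wt s z) s"
  unfolding wt_def
  by (intro cdiff_at_prod cdiff_at_component[OF has_field_derivative_abs_powr_exponent])

lemma wt_eq_0_iff: "wt s z = 0 \<longleftrightarrow> (\<exists>i. lform (c i) z = 0)"
proof -
  have "abs_powr a \<zeta> = 0 \<longleftrightarrow> \<zeta> = 0" for a \<zeta>
    by (cases "\<zeta> = 0") (auto simp: abs_powr_exp)
  thus ?thesis by (auto simp: wt_def)
qed

text \<open>Each \<open>norm (lform (c i) z)\<close> carries the positive exponent
  \<open>2 * Re (s $ i) + real K\<close>. Enlarging the base to
  \<open>1 + norm (lform (c i) z)\<close> makes the power monotone in the exponent, so that one
  bound serves a whole neighbourhood of exponents.\<close>

lemma norm_wt_le:
  assumes "s \<in> orthant (-(real K/2))" "\<And>i. 2 * Re (s $ i) + real K \<le> P"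
  shows "norm (wt s z * (lpow (\<lambda>_. K) z * \<psi> z)) \<le>
    norm (of_real (\<Prod>i\<in>UNIV. (1 + norm (lform (c i) z)) powr P) * \<psi> z)"
proof -
  have "norm (abs_powr (s $ i) \<zeta>) * norm \<zeta> ^ K \<le> (1 + norm \<zeta>) powr P" for i \<zeta>
  proof (cases "\<zeta> = 0")
    case False
    have pos: "2 * Re (s $ i) + real K \<ge> 0" using assms(1) by (auto simp: orthant_def field_simps dest!: spec[of _ i])
    have "norm (abs_powr (s $ i) \<zeta>) * norm \<zeta> ^ K = norm \<zeta> powr (2 * Re (s $ i) + real K)"
      using False by (simp add: norm_abs_powr powr_add powr_realpow)
    also have "\<dots> \<le> (1 + norm \<zeta>) powr (2 * Re (s $ i) + real K)"
      using pos by (intro powr_mono2) auto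
    also have "\<dots> \<le> (1 + norm \<zeta>) powr P"
      using assms(2) by (intro powr_mono) auto
    finally show ?thesis .
  qed simp
  hence "(\<Prod>i\<in>UNIV. norm (abs_powr (s $ i) (lform (c i) z)) * norm (lform (c i) z) ^ K) \<le>
      (\<Prod>i\<in>UNIV. (1 + norm (lform (c i) z)) powr P)"
    by (intro prod_mono) auto
  hence "(\<Prod>i\<in>UNIV. norm (abs_powr (s $ i) (lform (c i) z)) * norm (lform (c i) z) ^ K) * norm (\<psi> z) \<le>
      (\<Prod>i\<in>UNIV. (1 + norm (lform (c i) z)) powr P) * norm (\<psi> z)"
    by (rule mult_right_mono) auto
  thus ?thesis
    by (simp add: wt_def lpow_def norm_mult norm_power prod.distrib abs_prod mult.assoc flip: prod_norm)
qed

lemma integrable_bound_function: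
  assumes "test_function \<psi>"
  shows "integrable lborel (\<lambda>z. norm (of_real (\<Prod>i\<in>UNIV. (1 + norm (lform (c i) z)) powr P) * \<psi> z))"
proof -
  obtain R where R: "\<And>z. \<psi> z \<noteq> 0 \<Longrightarrow> norm z \<le> R" using assms by (auto simp: test_function_iff)
  have "1 + norm (\<zeta>::complex) \<noteq> 0" for \<zeta> using norm_ge_zero[of \<zeta>] by linarith
  hence "continuous_on UNIV (\<lambda>z. of_real (\<Prod>i\<in>UNIV. (1 + norm (lform (c i) z)) powr P) * \<psi> z)"
    by (intro continuous_intros test_function_continuous assms linear_continuous_on bounded_linear_lform ballI) auto
  thus ?thesis
    by (intro integrable_norm integrable_compact_support[of _ R]) (use R in auto)
qed

lemma borel_measurable_test:
  assumes "test_function \<psi>"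
  shows "\<psi> \<in> borel_measurable borel"
  using test_function_continuous[OF assms] by (rule borel_measurable_continuous_onI)

lemma borel_measurable_lpow [measurable]: "lpow \<alpha> \<in> borel_measurable borel"
  unfolding lpow_def by measurable

lemma integrable_wt_lpow:
  assumes "s \<in> orthant (-(real K/2))" "test_function \<psi>"
  shows "integrable lborel (\<lambda>z. wt s z * (lpow (\<lambda>_. K) z * \<psi> z))"
proof -
  note [measurable] = borel_measurable_test[OF assms(2)]
  have "2 * Re (s $ i) + real K \<le> (\<Sum>i\<in>UNIV. \<bar>2 * Re (s $ i) + real K\<bar>)" for i
    using member_le_sum[of i UNIV "\<lambda>i. \<bar>2 * Re (s $ i) + real K\<bar>"] by simp
  from norm_wt_le[OF assms(1) this, of _ \<psi>] show ?thesis
    by (intro Bochner_Integration.integrable_bound[OF integrable_bound_function[OF assms(2)]] AE_I2) auto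
qed

lemma integrable_wt: "s \<in> orthant 0 \<Longrightarrow> test_function \<psi> \<Longrightarrow> integrable lborel (\<lambda>z. wt s z * \<psi> z)"
  using integrable_wt_lpow[of s 0 \<psi>] by simp

lemma cdiff_at_zint:
  assumes "s \<in> orthant (-(real K/2))" "test_function \<psi>"
  shows "cdiff_at (\<lambda>s. zint s (\<lambda>z. lpow (\<lambda>_. K) z * \<psi> z)) s"
proof -
  note [measurable] = borel_measurable_test[OF assms(2)]
  \<comment> \<open>The distance from \<open>s\<close> to the boundary of the orthant, so that the
    ball of radius \<eta> stays inside. The summand \<open>2 * \<eta>\<close> of \<open>P\<close>
    below absorbs the variation of \<open>2 * Re (s $ i)\<close> on that ball.\<close>
  define \<eta> where "\<eta> = Min (range (\<lambda>i. Re (s $ i) + K / 2))"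
  have \<eta>: "\<eta> > 0" using assms(1) by (auto simp: \<eta>_def orthant_def) (metis add.commute add.inverse_inverse diff_gt_0_iff_gt diff_minus_eq_add)
  have \<eta>le: "\<eta> \<le> Re (s $ i) + K / 2" for i unfolding \<eta>_def by (rule Min_le) auto
  define P where "P = (\<Sum>i\<in>UNIV. \<bar>2 * Re (s $ i) + real K\<bar>) + 2 * \<eta>"
  have near: "\<bar>Re (s' $ i) - Re (s $ i)\<bar> < \<eta>" if "s' \<in> ball s \<eta>" for s' i
  proof -
    have "\<bar>Re (s' $ i) - Re (s $ i)\<bar> \<le> norm ((s' - s) $ i)" using abs_Re_le_cmod[of "(s' - s) $ i"] by simp
    also have "\<dots> \<le> norm (s' - s)" unfolding norm_vec_def by (rule member_le_L2_set) auto
    finally show ?thesis using that by (simp add: dist_norm norm_minus_commute)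
  qed
  show ?thesis
    unfolding zint_def
  proof (rule cdiff_at_integral[where \<rho>="\<eta> / 2", OF _ _ _ integrable_bound_function[OF assms(2), of P]])
    show "cdiff_at (\<lambda>s. wt s z * (lpow (\<lambda>_. K) z * \<psi> z)) s" for s z
      by (intro cdiff_at_mult cdiff_at_wt cdiff_at_const)
    show "norm (wt s' z * (lpow (\<lambda>_. K) z * \<psi> z)) \<le>
      norm (of_real (\<Prod>i\<in>UNIV. (1 + norm (lform (c i) z)) powr P) * \<psi> z)" if "s' \<in> ball s (2 * (\<eta> / 2))" for s' z
    proof (rule norm_wt_le)
      show "s' \<in> orthant (-(real K/2))"
        unfolding orthant_def
      proof (intro CollectI allI)
        fix i show "- (real K / 2) < Re (s' $ i)" using near[of s' i] \<eta>le[of i] that by (simp add: abs_less_iff)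
      qed
      fix i
      have "\<bar>2 * Re (s $ i) + real K\<bar> \<le> (\<Sum>i\<in>UNIV. \<bar>2 * Re (s $ i) + real K\<bar>)"
        using member_le_sum[of i UNIV "\<lambda>i. \<bar>2 * Re (s $ i) + real K\<bar>"] by simp
      thus "2 * Re (s' $ i) + real K \<le> P" using near[of s' i] that abs_ge_self[of "2 * Re (s $ i) + real K"]
        by (simp add: P_def abs_less_iff)
    qed
  qed (use \<eta> in auto)
qed

lemma wirt_lpow_wt:
  assumes "s \<in> orthant 1"
  shows "wirt v (\<lambda>z. lpow \<alpha> z * wt s z) z =
    (\<Sum>t\<in>UNIV. (of_nat (\<alpha> t) + s $ t) * lform (c t) v / lform (c t) z) * (lpow \<alpha> z * wt s z)"
    "Ck 1 (\<lambda>z. lpow \<alpha> z * wt s z)"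
proof -
  have Re: "Re (s $ t) > 1" for t using assms by (auto simp: orthant_def)
  let ?h = "\<lambda>t z. lform (c t) z ^ \<alpha> t * abs_powr (s $ t) (lform (c t) z)"
  have prod: "lpow \<alpha> z * wt s z = (\<Prod>t\<in>UNIV. ?h t z)" for z by (simp add: lpow_def wt_def prod.distrib)
  have Ck: "Ck 1 (\<lambda>z. abs_powr (s $ t) (lform (c t) z))" for t
    by (rule Ck_compose_linear[OF Ck_1_abs_powr[OF Re] bounded_linear_lform])
  show "Ck 1 (\<lambda>z. lpow \<alpha> z * wt s z)"
    unfolding prod by (intro Ck_prod Ck_mult Ck_power Ck_lform Ck)
  have d1: "(\<lambda>z. lform (c t) z ^ \<alpha> t) differentiable (at z)" for t
    using Ck_power[OF Ck_lform, of 1 "c t" "\<alpha> t"] by simp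
  have d2: "(\<lambda>z. abs_powr (s $ t) (lform (c t) z)) differentiable (at z)" for t using Ck[of t] by simp
  have w: "wirt v (?h t) z = ((of_nat (\<alpha> t) + s $ t) * lform (c t) v / lform (c t) z) * ?h t z" for t
  proof (cases "lform (c t) z = 0")
    case True
    thus ?thesis unfolding wirt_mult[OF d1 d2] wirt_abs_powr[OF Re] by simp
  next
    case False
    have "((\<lambda>z. lform (c t) z ^ \<alpha> t) has_derivative (\<lambda>h. of_nat (\<alpha> t) * lform (c t) h * lform (c t) z ^ (\<alpha> t - 1))) (at z)"
      by (rule has_derivative_power, rule bounded_linear_imp_has_derivative, rule bounded_linear_lform)
    note der = this
    have "wirt v (\<lambda>z. lform (c t) z ^ \<alpha> t) z = of_nat (\<alpha> t) * lform (c t) v * lform (c t) z ^ (\<alpha> t - 1)"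
      unfolding wirt_eqI[OF der] by (simp add: algebra_simps)
    also have "\<dots> = of_nat (\<alpha> t) * lform (c t) v / lform (c t) z * lform (c t) z ^ \<alpha> t"
      using False by (cases "\<alpha> t") auto
    finally show ?thesis unfolding wirt_mult[OF d1 d2] wirt_abs_powr[OF Re]
      using False by (simp add: field_simps)
  qed
  have "wirt v (\<lambda>z. \<Prod>t\<in>UNIV. ?h t z) z =
     (\<Sum>t\<in>UNIV. (of_nat (\<alpha> t) + s $ t) * lform (c t) v / lform (c t) z) * (\<Prod>t\<in>UNIV. ?h t z)"
    by (rule conjunct1[OF wirt_prod[OF finite differentiable_mult[OF d1 d2] w]])
  thus "wirt v (\<lambda>z. lpow \<alpha> z * wt s z) z =
    (\<Sum>t\<in>UNIV. (of_nat (\<alpha> t) + s $ t) * lform (c t) v / lform (c t) z) * (lpow \<alpha> z * wt s z)"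
    by (simp only: prod)
qed

text \<open>The integral of a divergence is 0. The first sum on the right arises when the derivative
  falls on \<psi>, the second collects the traded forms; the hypothesis on \<alpha> makes
  \<open>\<alpha> t - 1\<close> a true decrease.\<close>

lemma integration_by_parts:
  assumes s: "s \<in> orthant 1" and \<psi>: "test_function \<psi>" and \<alpha>: "\<And>t. t \<notin> T \<Longrightarrow> \<alpha> t \<ge> 1"
  shows "(of_nat (rk T) + (\<Sum>t\<in>T. of_nat (\<alpha> t) + s $ t)) * zint s (\<lambda>z. lpow \<alpha> z * \<psi> z) =
    - (\<Sum>i\<in>bas T. zint s (\<lambda>z. lpow (\<alpha>(i := Suc (\<alpha> i))) z * wirt (dual T i) \<psi> z))
    - (\<Sum>i\<in>bas T. \<Sum>t\<in>-T. (of_nat (\<alpha> t) + s $ t) * lform (c t) (dual T i) *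
         zint s (\<lambda>z. lpow (\<alpha>(i := Suc (\<alpha> i), t := \<alpha> t - 1)) z * \<psi> z))"
proof -
  define u where "u t = of_nat (\<alpha> t) + s $ t" for t
  let ?G = "\<lambda>i z. (lpow (\<alpha>(i := Suc (\<alpha> i))) z * wt s z) * \<psi> z"
  let ?a = "\<lambda>z. wt s z * (lpow \<alpha> z * \<psi> z)"
  let ?b = "\<lambda>i z. wt s z * (lpow (\<alpha>(i := Suc (\<alpha> i))) z * wirt (dual T i) \<psi> z)"
  let ?e = "\<lambda>i t z. wt s z * (lpow (\<alpha>(i := Suc (\<alpha> i), t := \<alpha> t - 1)) z * \<psi> z)"
  let ?F = "of_nat (rk T) + (\<Sum>t\<in>T. u t)"
  have diff: "\<psi> differentiable (at z)" for z using \<psi> Ck.simps(2)[of 0 \<psi>] by (auto simp: test_function_def)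
  have Ck1: "Ck 1 (?G i)" for i
    by (rule Ck_mult[OF wirt_lpow_wt(2)[OF s]]) (use \<psi> in \<open>auto simp: test_function_def\<close>)
  obtain R where R: "\<And>z. \<psi> z \<noteq> 0 \<Longrightarrow> norm z \<le> R" using \<psi> by (auto simp: test_function_iff)
  have wG: "wirt v (?G i) z = (\<Sum>t\<in>UNIV. (of_nat ((\<alpha>(i := Suc (\<alpha> i))) t) + s $ t) * lform (c t) v / lform (c t) z) *
       (lform (c i) z * lpow \<alpha> z * wt s z * \<psi> z) +
       wt s z * (lpow (\<alpha>(i := Suc (\<alpha> i))) z * wirt v \<psi> z)" for v i z
  proof -
    have "wirt v (?G i) z = wirt v (\<lambda>z. lpow (\<alpha>(i := Suc (\<alpha> i))) z * wt s z) z * \<psi> z +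
        (lpow (\<alpha>(i := Suc (\<alpha> i))) z * wt s z) * wirt v \<psi> z"
      by (rule wirt_mult[OF _ diff]) (use wirt_lpow_wt(2)[OF s, of "\<alpha>(i := Suc (\<alpha> i))"] in simp)
    thus ?thesis unfolding wirt_lpow_wt(1)[OF s] by (simp only: lpow_Suc mult_ac)
  qed
  have pointwise: "(\<Sum>i\<in>bas T. wirt (dual T i) (?G i) z) =
      ?F * ?a z + (\<Sum>i\<in>bas T. ?b i z) + (\<Sum>i\<in>bas T. \<Sum>t\<in>-T. u t * lform (c t) (dual T i) * ?e i t z)" for z
  \<comment> \<open>Every term contains \<open>wt s z\<close>, so the identity is trivial on the
    hyperplanes; elsewhere one may divide by the forms.\<close>
  proof (cases "wt s z = 0")
    case True
    thus ?thesis by (simp add: wG)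
  next
    case False
    hence nz: "lform (c t) z \<noteq> 0" for t by (simp add: wt_eq_0_iff)
    let ?q = "\<lambda>i t. lform (c t) (dual T i) * lform (c i) z / lform (c t) z"
    \<comment> \<open>Raising the exponent of \<open>i\<close> adds one diagonal term, equal to 1 by
      duality. Over the basis these terms add up to \<open>rk T\<close>.\<close>
    have 1: "(\<Sum>t\<in>UNIV. (of_nat ((\<alpha>(i := Suc (\<alpha> i))) t) + s $ t) * lform (c t) (dual T i) / lform (c t) z) * lform (c i) z
        = (\<Sum>t\<in>UNIV. u t * ?q i t) + 1" if i: "i \<in> bas T" for i
    proof -
      have "(\<Sum>t\<in>UNIV. (of_nat ((\<alpha>(i := Suc (\<alpha> i))) t) + s $ t) * lform (c t) (dual T i) / lform (c t) z) * lform (c i) z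
        = (\<Sum>t\<in>UNIV. u t * ?q i t + (if t = i then ?q i i else 0))"
        unfolding sum_distrib_right by (rule sum.cong) (auto simp: u_def field_simps add_divide_distrib)
      also have "\<dots> = (\<Sum>t\<in>UNIV. u t * ?q i t) + ?q i i" by (simp add: sum.distrib)
      also have "?q i i = 1" using lform_dual[OF i i] nz by simp
      finally show ?thesis .
    qed
    \<comment> \<open>For \<open>t\<close> in \<open>T\<close> the sum over the basis collapses by
      \<open>lform_expand\<close> and leaves the bare coefficient \<open>u t\<close>.\<close>
    have 2: "(\<Sum>i\<in>bas T. \<Sum>t\<in>UNIV. u t * ?q i t) = (\<Sum>t\<in>T. u t) + (\<Sum>i\<in>bas T. \<Sum>t\<in>-T. u t * ?q i t)"
    proof -
      have "(\<Sum>i\<in>bas T. \<Sum>t\<in>UNIV. u t * ?q i t) = (\<Sum>i\<in>bas T. (\<Sum>t\<in>T. u t * ?q i t) + (\<Sum>t\<in>-T. u t * ?q i t))"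
        by (rule sum.cong) (auto simp: sum.union_disjoint[symmetric])
      also have "\<dots> = (\<Sum>i\<in>bas T. \<Sum>t\<in>T. u t * ?q i t) + (\<Sum>i\<in>bas T. \<Sum>t\<in>-T. u t * ?q i t)"
        by (rule sum.distrib)
      also have "(\<Sum>i\<in>bas T. \<Sum>t\<in>T. u t * ?q i t) = (\<Sum>t\<in>T. \<Sum>i\<in>bas T. u t * ?q i t)" by (rule sum.swap)
      also have "\<dots> = (\<Sum>t\<in>T. u t)"
      proof (rule sum.cong[OF refl])
        fix t assume t: "t \<in> T"
        have "(\<Sum>i\<in>bas T. u t * ?q i t) = u t / lform (c t) z * (\<Sum>i\<in>bas T. lform (c t) (dual T i) * lform (c i) z)"
          by (simp add: sum_distrib_left)
        thus "(\<Sum>i\<in>bas T. u t * ?q i t) = u t" using lform_expand[OF t] nz[of t] by simp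
      qed
      finally show ?thesis .
    qed
    \<comment> \<open>For \<open>t\<close> outside \<open>T\<close> the quotient of two forms is
      absorbed by the monomial, which has a factor of \<open>t\<close> to give up.\<close>
    have 3: "?q i t * ?a z = lform (c t) (dual T i) * ?e i t z" if "i \<in> bas T" "t \<notin> T" for i t
    proof -
      have "t \<noteq> i" using that bas_subset by auto
      hence "lpow (\<alpha>(i := Suc (\<alpha> i))) z = lform (c t) z * lpow (\<alpha>(i := Suc (\<alpha> i), t := \<alpha> t - 1)) z"
        using lpow_Suc[of "\<alpha>(i := Suc (\<alpha> i), t := \<alpha> t - 1)" t z] \<alpha>[OF that(2)] by (simp add: fun_upd_twist)
      hence "lform (c i) z * lpow \<alpha> z = lform (c t) z * lpow (\<alpha>(i := Suc (\<alpha> i), t := \<alpha> t - 1)) z"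
        by (simp add: lpow_Suc)
      hence "?e i t z = lform (c i) z / lform (c t) z * ?a z"
        using nz[of t] by (simp add: field_simps)
      thus ?thesis by simp
    qed
    have "(\<Sum>i\<in>bas T. wirt (dual T i) (?G i) z) = (\<Sum>i\<in>bas T. ((\<Sum>t\<in>UNIV. u t * ?q i t) + 1) * ?a z + ?b i z)"
    proof (rule sum.cong[OF refl])
      fix i assume i: "i \<in> bas T"
      have rearrange: "X * (l * P * w * p) = X * l * (w * (P * p))" for X l P w p :: complex
        by (simp only: mult_ac)
      show "wirt (dual T i) (?G i) z = ((\<Sum>t\<in>UNIV. u t * ?q i t) + 1) * ?a z + ?b i z"
        unfolding wG rearrange 1[OF i] ..
    qed
    also have "\<dots> = ((\<Sum>i\<in>bas T. \<Sum>t\<in>UNIV. u t * ?q i t) + of_nat (rk T)) * ?a z + (\<Sum>i\<in>bas T. ?b i z)"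
      by (simp add: sum.distrib rk_def flip: sum_distrib_right)
    also have "\<dots> = ?F * ?a z + (\<Sum>i\<in>bas T. \<Sum>t\<in>-T. u t * (?q i t * ?a z)) + (\<Sum>i\<in>bas T. ?b i z)"
      unfolding 2 by (simp add: distrib_right sum_distrib_right mult.assoc)
    also have "(\<Sum>i\<in>bas T. \<Sum>t\<in>-T. u t * (?q i t * ?a z)) =
        (\<Sum>i\<in>bas T. \<Sum>t\<in>-T. u t * lform (c t) (dual T i) * ?e i t z)"
    proof (intro sum.cong refl)
      fix i t assume "i \<in> bas T" "t \<in> - T"
      hence "?q i t * ?a z = lform (c t) (dual T i) * ?e i t z" by (intro 3) auto
      thus "u t * (?q i t * ?a z) = u t * lform (c t) (dual T i) * ?e i t z" by (simp only: mult.assoc)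
    qed
    finally show ?thesis by (simp only: add_ac)
  qed
  have s0: "s \<in> orthant 0" using s orthant_mono[of 0 1] by auto
  have int: "integrable lborel (\<lambda>z. wt s z * (lpow \<beta> z * g z))" if "test_function g" for \<beta> g
    by (intro integrable_wt s0 test_function_lpow that)
  have "0 = (\<Sum>i\<in>bas T. (LINT z|lborel. wirt (dual T i) (?G i) z))"
    by (intro sum.neutral[symmetric] ballI integral_wirt_0[OF Ck1, of _ R]) (use R in auto)
  also have "\<dots> = (LINT z|lborel. (\<Sum>i\<in>bas T. wirt (dual T i) (?G i) z))"
  proof (rule Bochner_Integration.integral_sum[symmetric])
    fix i
    show "integrable lborel (wirt (dual T i) (?G i))"
      unfolding wirt_def using integral_frechet_derivative_0(1)[OF Ck1, of _ R] R by auto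
  qed
  also have "\<dots> = ?F * zint s (\<lambda>z. lpow \<alpha> z * \<psi> z)
      + (\<Sum>i\<in>bas T. zint s (\<lambda>z. lpow (\<alpha>(i := Suc (\<alpha> i))) z * wirt (dual T i) \<psi> z))
      + (\<Sum>i\<in>bas T. \<Sum>t\<in>-T. u t * lform (c t) (dual T i) *
         zint s (\<lambda>z. lpow (\<alpha>(i := Suc (\<alpha> i), t := \<alpha> t - 1)) z * \<psi> z))"
  proof -
    have add3: "(LINT z|lborel. f z + g z + h z) = (LINT z|lborel. f z) + (LINT z|lborel. g z) + (LINT z|lborel. h z)"
      if "integrable lborel f" "integrable lborel g" "integrable lborel h" for f g h :: "complex ^ 'n \<Rightarrow> complex"
      using that by simp
    have I1: "integrable lborel ?a" by (rule int[OF \<psi>])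
    have I2: "integrable lborel (?b i)" for i by (rule int[OF test_function_wirt[OF \<psi>]])
    have I3: "integrable lborel (?e i t)" for i t by (rule int[OF \<psi>])
    have "(LINT z|lborel. ?F * ?a z + (\<Sum>i\<in>bas T. ?b i z) +
          (\<Sum>i\<in>bas T. \<Sum>t\<in>-T. u t * lform (c t) (dual T i) * ?e i t z)) =
        (LINT z|lborel. ?F * ?a z) + (LINT z|lborel. (\<Sum>i\<in>bas T. ?b i z)) +
          (LINT z|lborel. (\<Sum>i\<in>bas T. \<Sum>t\<in>-T. u t * lform (c t) (dual T i) * ?e i t z))"
      by (intro add3 Bochner_Integration.integrable_sum integrable_mult_right I1 I2 I3)
    also have "(LINT z|lborel. (\<Sum>i\<in>bas T. ?b i z)) = (\<Sum>i\<in>bas T. (LINT z|lborel. ?b i z))"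
      by (rule Bochner_Integration.integral_sum) (rule I2)
    also have "(LINT z|lborel. (\<Sum>i\<in>bas T. \<Sum>t\<in>-T. u t * lform (c t) (dual T i) * ?e i t z))
        = (\<Sum>i\<in>bas T. (LINT z|lborel. (\<Sum>t\<in>-T. u t * lform (c t) (dual T i) * ?e i t z)))"
      by (rule Bochner_Integration.integral_sum) (intro Bochner_Integration.integrable_sum integrable_mult_right I3)
    also have "\<dots> = (\<Sum>i\<in>bas T. \<Sum>t\<in>-T. (LINT z|lborel. u t * lform (c t) (dual T i) * ?e i t z))"
      by (intro sum.cong refl Bochner_Integration.integral_sum integrable_mult_right I3)
    finally show ?thesis unfolding pointwise zint_def by (simp only: integral_mult_right_zero)
  qed
  finally have sum0: "0 = ?F * zint s (\<lambda>z. lpow \<alpha> z * \<psi> z)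
      + (\<Sum>i\<in>bas T. zint s (\<lambda>z. lpow (\<alpha>(i := Suc (\<alpha> i))) z * wirt (dual T i) \<psi> z))
      + (\<Sum>i\<in>bas T. \<Sum>t\<in>-T. u t * lform (c t) (dual T i) *
         zint s (\<lambda>z. lpow (\<alpha>(i := Suc (\<alpha> i), t := \<alpha> t - 1)) z * \<psi> z))" .
  have alg: "A = - B - C" if "0 = A + B + C" for A B C :: complex
  proof -
    have "A = (A + B + C) - B - C" by simp
    also have "\<dots> = - B - C" unfolding that[symmetric] by simp
    finally show ?thesis .
  qed
  show ?thesis by (rule alg[OF sum0, unfolded u_def])
qed

section \<open>Continuation by descent on the exponents\<close>

definition fac :: "'r set \<Rightarrow> nat \<Rightarrow> complex ^ 'r \<Rightarrow> complex" where
  "fac T d s = of_nat (rk T + d) + (\<Sum>t\<in>T. s $ t)"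

definition ev :: "('r set \<times> nat) multiset \<Rightarrow> complex ^ 'r \<Rightarrow> complex" where
  "ev L s = (\<Prod>(T, d)\<in>#L. fac T d s)"

lemma ev_simps [simp]: "ev {#} s = 1" "ev (add_mset (T, d) L) s = fac T d s * ev L s" "ev (L + L') s = ev L s * ev L' s"
  by (simp_all add: ev_def)

lemma cdiff_at_fac: "cdiff_at (fac T d) s"
  unfolding fac_def[abs_def] by (intro cdiff_at_add cdiff_at_const cdiff_at_sum cdiff_at_nth)

lemma cdiff_at_ev: "cdiff_at (ev L) s"
proof (induction L)
  case (add x L)
  show ?case by (cases x) (use add in \<open>auto intro!: cdiff_at_mult cdiff_at_fac\<close>)
qed auto

definition continues :: "nat \<Rightarrow> ('r set \<times> nat) multiset \<Rightarrow> ('r \<Rightarrow> nat) \<Rightarrow> bool" where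
  "continues K L \<alpha> \<longleftrightarrow> (\<forall>\<psi>. test_function \<psi> \<longrightarrow> extends K (\<lambda>s. ev L s * zint s (\<lambda>z. lpow \<alpha> z * \<psi> z)))"

lemma continues_step:
  assumes \<alpha>: "\<And>t. t \<notin> T \<Longrightarrow> \<alpha> t \<ge> 1"
    and 1: "\<And>i. i \<in> bas T \<Longrightarrow> continues K L (\<alpha>(i := Suc (\<alpha> i)))"
    and 2: "\<And>i t. i \<in> bas T \<Longrightarrow> t \<notin> T \<Longrightarrow> continues K L (\<alpha>(i := Suc (\<alpha> i), t := \<alpha> t - 1))"
  shows "continues K (add_mset (T, sum \<alpha> T) L) \<alpha>"
  unfolding continues_def
proof (intro allI impI)
  fix \<psi> :: "complex ^ 'n \<Rightarrow> complex" assume \<psi>: "test_function \<psi>"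
  let ?B = "\<lambda>i s. zint s (\<lambda>z. lpow (\<alpha>(i := Suc (\<alpha> i))) z * wirt (dual T i) \<psi> z)"
  let ?C = "\<lambda>i t s. zint s (\<lambda>z. lpow (\<alpha>(i := Suc (\<alpha> i), t := \<alpha> t - 1)) z * \<psi> z)"
  show "extends K (\<lambda>s. ev (add_mset (T, sum \<alpha> T) L) s * zint s (\<lambda>z. lpow \<alpha> z * \<psi> z))"
  proof (rule extends_cong)
    show "extends K (\<lambda>s. (-1) * (\<Sum>i\<in>bas T. ev L s * ?B i s) +
        (\<Sum>i\<in>bas T. \<Sum>t\<in>-T. - ((of_nat (\<alpha> t) + s $ t) * lform (c t) (dual T i)) * (ev L s * ?C i t s)))"
    proof (rule extends_add)
      have "extends K (\<lambda>s. ev L s * ?B i s)" if "i \<in> bas T" for i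
        using 1[OF that] test_function_wirt[OF \<psi>] unfolding continues_def by blast
      thus "extends K (\<lambda>s. (-1) * (\<Sum>i\<in>bas T. ev L s * ?B i s))"
        by (intro extends_mult[where p = "\<lambda>_. -1"] extends_sum cdiff_at_const)
      have "extends K (\<lambda>s. ev L s * ?C i t s)" if "i \<in> bas T" "t \<in> -T" for i t
        using 2[OF that(1), of t] that(2) \<psi> unfolding continues_def by blast
      thus "extends K (\<lambda>s. \<Sum>i\<in>bas T. \<Sum>t\<in>-T.
          - ((of_nat (\<alpha> t) + s $ t) * lform (c t) (dual T i)) * (ev L s * ?C i t s))"
        by (intro extends_sum extends_mult[where p = "\<lambda>s. - ((of_nat (\<alpha> t) + s $ t) * lform (c t) (dual T i))" for t i]
            cdiff_at_const cdiff_at_mult cdiff_at_add cdiff_at_nth cdiff_at_uminus)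
    qed
    fix s :: "complex ^ 'r" assume s: "s \<in> orthant 1"
    have "ev (add_mset (T, sum \<alpha> T) L) s * zint s (\<lambda>z. lpow \<alpha> z * \<psi> z) =
      ev L s * ((of_nat (rk T) + (\<Sum>t\<in>T. of_nat (\<alpha> t) + s $ t)) * zint s (\<lambda>z. lpow \<alpha> z * \<psi> z))"
      by (simp add: fac_def sum.distrib mult_ac add_ac)
    also have "\<dots> = ev L s * (- (\<Sum>i\<in>bas T. ?B i s)
        - (\<Sum>i\<in>bas T. \<Sum>t\<in>-T. (of_nat (\<alpha> t) + s $ t) * lform (c t) (dual T i) * ?C i t s))"
      by (subst integration_by_parts[OF s \<psi>, of T \<alpha>]) (rule \<alpha>, assumption, rule refl)
    also have "\<dots> = (-1) * (\<Sum>i\<in>bas T. ev L s * ?B i s) +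
        (\<Sum>i\<in>bas T. \<Sum>t\<in>-T. - ((of_nat (\<alpha> t) + s $ t) * lform (c t) (dual T i)) * (ev L s * ?C i t s))"
      by (simp only: distrib_left mult_minus_right mult_minus_left sum_negf sum_distrib_left mult_1_left mult_ac
          diff_conv_add_uminus)
    finally show "(-1) * (\<Sum>i\<in>bas T. ev L s * ?B i s) +
        (\<Sum>i\<in>bas T. \<Sum>t\<in>-T. - ((of_nat (\<alpha> t) + s $ t) * lform (c t) (dual T i)) * (ev L s * ?C i t s)) =
        ev (add_mset (T, sum \<alpha> T) L) s * zint s (\<lambda>z. lpow \<alpha> z * \<psi> z)" ..
  qed
qed

lemma continues_mono:
  assumes "continues K L \<alpha>" "L \<subseteq># L'" "\<And>i. \<alpha> i \<le> \<beta> i"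
  shows "continues K L' \<beta>"
  unfolding continues_def
proof (intro allI impI)
  fix \<psi> :: "complex ^ 'n \<Rightarrow> complex" assume \<psi>: "test_function \<psi>"
  have "extends K (\<lambda>s. ev (L' - L) s * (ev L s * zint s (\<lambda>z. lpow \<alpha> z * (lpow (\<lambda>i. \<beta> i - \<alpha> i) z * \<psi> z))))"
    by (rule extends_mult[OF cdiff_at_ev], rule assms(1)[unfolded continues_def, rule_format],
      rule test_function_lpow[OF \<psi>])
  moreover have "ev L' s = ev (L' - L) s * ev L s" for s
    using assms(2) by (metis ev_simps(3) subset_mset.diff_add)
  ultimately show "extends K (\<lambda>s. ev L' s * zint s (\<lambda>z. lpow \<beta> z * \<psi> z))"
    by (simp add: lpow_le[OF assms(3)] mult.assoc)
qed

text \<open>With exponent \<open>K\<close> on every form the integral itself converges, and is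
  holomorphic, on the larger orthant.\<close>

lemma continues_start: "continues K {#} (\<lambda>_. K)"
  unfolding continues_def extends_def using cdiff_at_zint by auto

theorem continues_lform:
  "\<exists>L. admissible L \<and> (\<forall>i\<in>bas UNIV. \<forall>\<psi>. test_function \<psi> \<longrightarrow> extends K (\<lambda>s. ev L s * zint s (\<lambda>z. lform (c i) z * \<psi> z)))"
proof -
  interpret exponent_descent bas "continues K" K
    by unfold_locales
      (fact bas_nonempty bas_subset continues_start | rule continues_mono continues_step; assumption)+
  obtain L where L: "admissible L" "\<forall>i\<in>bas UNIV. continues K L ((\<lambda>_. 0)(i := 1))"
    using descent_full by blast
  have "lpow ((\<lambda>_. 0)(i := 1)) z = lform (c i) z" for i z
    using lpow_Suc[of "\<lambda>_. 0" i z] by simp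
  thus ?thesis using L unfolding continues_def by auto
qed

text \<open>One more step, for the full set and \<alpha> = 0: no index lies outside, so nothing is
  traded. The same \<open>L\<close> is reported for the integrals with an additional form, because
  \<open>root_of_tame\<close> compares the two continuations.\<close>

theorem zint_continuation:
  assumes "test_function \<phi>"
  shows "\<exists>L R. admissible L \<and> (\<forall>s\<in>orthant (-(real K/2)). cdiff_at R s) \<and>
    (\<forall>s\<in>orthant 1. ev L s * (of_nat CARD('n) + (\<Sum>i\<in>UNIV. s $ i)) * zint s \<phi> = R s) \<and>
    (\<forall>i\<in>bas UNIV. \<forall>\<psi>. test_function \<psi> \<longrightarrow> extends K (\<lambda>s. ev L s * zint s (\<lambda>z. lform (c i) z * \<psi> z)))"
proof -
  obtain L where L: "admissible L"
    "\<And>i \<psi>. i \<in> bas UNIV \<Longrightarrow> test_function \<psi> \<Longrightarrow> extends K (\<lambda>s. ev L s * zint s (\<lambda>z. lform (c i) z * \<psi> z))"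
    using continues_lform by blast
  have "extends K (\<lambda>s. \<Sum>i\<in>bas UNIV. (-1) * (ev L s * zint s (\<lambda>z. lform (c i) z * wirt (dual UNIV i) \<phi> z)))"
    by (intro extends_sum extends_mult[where p = "\<lambda>_. -1"] cdiff_at_const L test_function_wirt assms)
  then obtain R where R: "\<forall>s\<in>orthant (-(real K/2)). cdiff_at R s"
    "\<And>s. s \<in> orthant 1 \<Longrightarrow> R s = (\<Sum>i\<in>bas UNIV. (-1) * (ev L s * zint s (\<lambda>z. lform (c i) z * wirt (dual UNIV i) \<phi> z)))"
    unfolding extends_def by blast
  have "ev L s * (of_nat CARD('n) + (\<Sum>i\<in>UNIV. s $ i)) * zint s \<phi> = R s" if s: "s \<in> orthant 1" for s
  proof -
    have "lpow ((\<lambda>_. 0)(i := Suc 0)) z = lform (c i) z" for i z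
      using lpow_Suc[of "\<lambda>_. 0" i z] by simp
    hence "(of_nat CARD('n) + (\<Sum>i\<in>UNIV. s $ i)) * zint s \<phi> =
        - (\<Sum>i\<in>bas UNIV. zint s (\<lambda>z. lform (c i) z * wirt (dual UNIV i) \<phi> z))"
      using integration_by_parts[OF s assms, of UNIV "\<lambda>_. 0"] by (simp add: rk_UNIV)
    thus ?thesis unfolding R(2)[OF s] by (simp add: sum_distrib_left sum_negf mult.assoc)
  qed
  thus ?thesis using L R(1) by blast
qed

end

section \<open>Generic exponents and the zeta function\<close>

lemma open_halfplane: "open {w::complex. Re w > b}" "connected {w::complex. Re w > b}"
  by (simp_all add: open_halfspace_Re_gt convex_connected convex_halfspace_Re_gt)

lemma halfplane_identity:
  assumes "f holomorphic_on {w. Re w > b}" "g holomorphic_on {w. Re w > b}"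
    and "\<And>w. Re w > M \<Longrightarrow> f w = g w" and "Re z > b"
  shows "f z = g z"
proof (rule analytic_continuation_open[of "{w. Re w > max b M}" "{w. Re w > b}" f g z])
  show "{w. Re w > max b M} \<noteq> {}"
    by (auto intro!: exI[of _ "of_real (max b M + 1)"])
  show "f w = g w" if "w \<in> {w. Re w > max b M}" for w using that assms(3) by auto
qed (use assms open_halfplane in \<open>auto simp del: max_less_iff_conj\<close>)

lemma vec_1_nth [simp]: "(s + w *s 1) $ i = s $ i + (w :: complex)"
  by simp

text \<open>Reduction to one variable along the diagonal direction \<open>1\<close>, which leads
  from any \<open>s\<close> into \<open>orthant 1\<close> without leaving
  \<open>orthant a\<close>.\<close>

lemma cdiff_identity:
  fixes F G :: "complex ^ 'r::finite \<Rightarrow> complex"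
  assumes F: "\<And>s. s \<in> orthant a \<Longrightarrow> cdiff_at F s" and G: "\<And>s. s \<in> orthant a \<Longrightarrow> cdiff_at G s"
    and eq: "\<And>s. s \<in> orthant 1 \<Longrightarrow> F s = G s" and s: "s \<in> orthant a"
  shows "F s = G s"
proof -
  define \<delta> where "\<delta> = Min (range (\<lambda>i. Re (s $ i) - a))"
  have \<delta>: "\<delta> > 0" "\<And>i. \<delta> \<le> Re (s $ i) - a"
    using s by (auto simp: \<delta>_def orthant_def)
  have in_a: "s + w *s 1 \<in> orthant a" if "Re w > -\<delta>" for w
    unfolding orthant_def
  proof (intro CollectI allI)
    fix i show "a < Re ((s + w *s 1) $ i)" using \<delta>(2)[of i] that by simp
  qed
  define M where "M = (\<Sum>i\<in>UNIV. \<bar>Re (s $ i)\<bar>) + 1"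
  have in_1: "s + w *s 1 \<in> orthant 1" if "Re w > M" for w
    unfolding orthant_def
  proof (intro CollectI allI)
    fix i show "1 < Re ((s + w *s 1) $ i)"
      using member_le_sum[of i UNIV "\<lambda>i. \<bar>Re (s $ i)\<bar>"] that by (simp add: M_def)
  qed
  have "F (s + 0 *s 1) = G (s + 0 *s 1)"
  proof (rule halfplane_identity[where b = "-\<delta>" and M = M and z = 0])
    show "(\<lambda>w. F (s + w *s 1)) holomorphic_on {w. - \<delta> < Re w}"
      by (rule cdiff_line_holomorphic) (use F in_a in auto)
    show "(\<lambda>w. G (s + w *s 1)) holomorphic_on {w. - \<delta> < Re w}"
      by (rule cdiff_line_holomorphic) (use G in_a in auto)
  qed (use eq in_1 \<delta> in auto)
  thus ?thesis by simp
qed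

lemma cdiff_imp_holomorphic_within:
  assumes "\<And>a. a \<in> W \<Longrightarrow> cdiff_at F (k *s a)"
  shows "holomorphic_within (\<lambda>a. F (k *s a)) W"
  unfolding holomorphic_within_def
proof
  fix a assume "a \<in> W"
  then obtain D where D: "(F has_derivative D) (at (k *s a))" "\<forall>a v. D (a *s v) = a * D v"
    using assms unfolding cdiff_at_def by blast
  have "bounded_linear (\<lambda>a. k *s (a :: complex ^ 'a))"
    by (rule bounded_linear_intro[of _ "norm k"])
      (auto simp: norm_vector_smult vec_eq_iff scaleR_conv_of_real[where 'a=complex] algebra_simps)
  hence "((\<lambda>a. k *s a) has_derivative (\<lambda>a. k *s a)) (at a)" by (rule bounded_linear_imp_has_derivative)
  from has_derivative_compose[OF this D(1)]
  have "((\<lambda>a. F (k *s a)) has_derivative (\<lambda>v. D (k *s v))) (at a within W)" by (rule has_derivative_at_withinI)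
  thus "\<exists>D. ((\<lambda>a. F (k *s a)) has_derivative D) (at a within W) \<and> (\<forall>c v. D (c *s v) = c * D v)"
    by (rule exI[of _ "\<lambda>v. D (k *s v)", OF conjI]) (simp add: D(2) mult_ac)
qed

section \<open>Generic points of the hyperplane\<close>

locale continued_arrangement = arrangement c
  for c :: "'r::finite \<Rightarrow> complex ^ 'n::finite" +
  fixes \<phi> :: "complex ^ 'n \<Rightarrow> complex"
    and LL :: "nat \<Rightarrow> ('r set \<times> nat) multiset" and RR :: "nat \<Rightarrow> complex ^ 'r \<Rightarrow> complex"
  assumes test: "test_function \<phi>"
    and admissible_LL: "admissible (LL K)"
    and cdiff_RR: "s \<in> orthant (-(real K/2)) \<Longrightarrow> cdiff_at (RR K) s"
    and RR_eq: "s \<in> orthant 1 \<Longrightarrow> ev (LL K) s * (of_nat CARD('n) + (\<Sum>i\<in>UNIV. s $ i)) * zint s \<phi> = RR K s"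
    and extends_lform: "i \<in> bas UNIV \<Longrightarrow> test_function \<psi> \<Longrightarrow>
      extends K (\<lambda>s. ev (LL K) s * zint s (\<lambda>z. lform (c i) z * \<psi> z))"
begin

text \<open>Independent of \<open>K\<close>: no factor that an admissible multiset can contain
  vanishes at \<open>s\<close>, not only those in \<open>LL K\<close>.\<close>

definition regular :: "complex ^ 'r \<Rightarrow> bool" where
  "regular s \<longleftrightarrow> (\<forall>T d. T \<noteq> {} \<longrightarrow> (T = UNIV \<longrightarrow> d \<ge> 1) \<longrightarrow> fac T d s \<noteq> 0)"

lemma regular_ev: "regular s \<Longrightarrow> admissible L \<Longrightarrow> ev L s \<noteq> 0"
proof (induction L)
  case (add x L)
  thus ?case by (cases x) (auto simp: regular_def)
qed auto

text \<open>On \<open>orthant 1\<close> both sides are the same multiple of the integral.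
  Cross-multiplication lets the identity pass through the zeros of the factors.\<close>

lemma RR_consistent:
  assumes "s \<in> orthant (-(real K/2))" "s \<in> orthant (-(real K'/2))"
  shows "RR K s * ev (LL K') s = RR K' s * ev (LL K) s"
proof (rule cdiff_identity[where a = "-(real (min K K')/2)"])
  show "s \<in> orthant (-(real (min K K')/2))" using assms by (auto simp: min_def)
  fix s :: "complex ^ 'r" assume "s \<in> orthant (-(real (min K K')/2))"
  hence "s \<in> orthant (-(real K/2))" "s \<in> orthant (-(real K'/2))"
    using orthant_mono[of "-(real K/2)" "-(real (min K K')/2)"] orthant_mono[of "-(real K'/2)" "-(real (min K K')/2)"]
    by auto
  thus "cdiff_at (\<lambda>s. RR K s * ev (LL K') s) s" "cdiff_at (\<lambda>s. RR K' s * ev (LL K) s) s"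
    by (auto intro!: cdiff_at_mult cdiff_RR cdiff_at_ev)
next
  fix s :: "complex ^ 'r" assume "s \<in> orthant 1"
  thus "RR K s * ev (LL K') s = RR K' s * ev (LL K) s" by (simp add: mult_ac flip: RR_eq)
qed

definition dimn :: complex where "dimn = of_nat (rk UNIV)"

lemma dimn_eq: "dimn = of_nat CARD('n)"
  by (simp add: dimn_def rk_UNIV)

definition hyper :: "(complex ^ 'r) set" where
  "hyper = {a. (\<Sum>i\<in>UNIV. a $ i) = 1}"

text \<open>Multiplication by \<open>- dimn\<close> carries \<open>hyper\<close> onto the exponents
  with sum \<open>-n\<close>. Quantifying over all \<open>K\<close> avoids a choice; by
  \<open>RR_consistent\<close> a single suitable \<open>K\<close> decides membership.\<close>

definition generic :: "(complex ^ 'r) set" where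
  "generic = {a\<in>hyper. regular ((- dimn) *s a) \<and>
     (\<forall>K. (- dimn) *s a \<in> orthant (-(real K/2)) \<longrightarrow> RR K ((- dimn) *s a) \<noteq> 0)}"

text \<open>On a bounded set a factor with large \<open>d\<close> cannot vanish. The finitely many
  remaining ones, multiplied together and by \<open>RR K\<close>, give one local equation for the
  complement.\<close>

lemma analytically_open_generic: "analytically_open hyper generic"
  unfolding analytically_open_def analytic_subset_def
proof (intro conjI ballI)
  fix a0 assume a0: "a0 \<in> hyper"
  \<comment> \<open>A bound for the components of \<open>(- dimn) *s a\<close> on the unit ball
    around \<open>a0\<close>. \<open>K\<close> keeps these points inside the orthant, and
    \<open>d > D\<close> prevents cancellation because a sum over \<open>T\<close> has norm at most
    \<open>CARD('r) * N\<close>.\<close>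
  define N where "N = real CARD('n) * (norm a0 + 1)"
  obtain K :: nat where K: "real K / 2 > N" using reals_Archimedean2[of "2 * N"] by (auto simp: field_simps)
  obtain D :: nat where D: "real D > real CARD('r) * N" using reals_Archimedean2 by blast
  define X where "X = {(T :: 'r set, d). T \<noteq> {} \<and> (T = UNIV \<longrightarrow> d \<ge> 1) \<and> d \<le> D}"
  have finX: "finite X" by (rule finite_subset[of _ "UNIV \<times> {..D}"]) (auto simp: X_def)
  define F where "F s = (\<Prod>(T, d)\<in>X. fac T d s) * RR K s" for s
  define W where "W = hyper \<inter> ball a0 1"
  have comp: "norm (((- dimn) *s a) $ i) < N" if "a \<in> W" for a i
  proof -
    have "norm (a $ i) \<le> norm a" unfolding norm_vec_def by (rule member_le_L2_set) auto
    also have "norm a < norm a0 + 1" using that norm_triangle_ineq2[of a a0]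
      by (auto simp: W_def dist_norm norm_minus_commute)
    finally show ?thesis by (simp add: norm_mult N_def dimn_eq)
  qed
  have inK: "(- dimn) *s a \<in> orthant (-(real K/2))" if "a \<in> W" for a
    unfolding orthant_def
  proof (intro CollectI allI)
    fix i
    show "- (real K/2) < Re (((- dimn) *s a) $ i)"
      using comp[OF that, of i] abs_Re_le_cmod[of "((- dimn) *s a) $ i"] K by linarith
  qed
  have big: "fac T d ((- dimn) *s a) \<noteq> 0" if a: "a \<in> W" and d: "d > D" for a T d
  proof
    let ?s = "(- dimn) *s a"
    assume "fac T d ?s = 0"
    hence "norm (of_nat (rk T + d) :: complex) = norm (\<Sum>t\<in>T. ?s $ t)"
      unfolding fac_def by (metis add_eq_0_iff norm_minus_cancel)
    also have "\<dots> \<le> (\<Sum>t\<in>T. norm (?s $ t))" by (rule norm_sum)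
    also have "\<dots> \<le> (\<Sum>t\<in>T. N)" by (rule sum_mono) (use comp[OF a] in \<open>auto intro: less_imp_le\<close>)
    also have "\<dots> \<le> real CARD('r) * N"
      unfolding sum_constant by (intro mult_right_mono) (auto simp: N_def card_mono)
    also have "\<dots> < real d" using D d by linarith
    finally show False by (simp add: norm_of_nat del: of_nat_add)
  qed
  have iff: "a \<notin> generic \<longleftrightarrow> F ((- dimn) *s a) = 0" if a: "a \<in> W" for a
  proof -
    let ?s = "(- dimn) *s a"
    have reg: "regular ?s \<longleftrightarrow> (\<Prod>(T, d)\<in>X. fac T d ?s) \<noteq> 0"
    proof -
      have "regular ?s \<longleftrightarrow> (\<forall>x\<in>X. fac (fst x) (snd x) ?s \<noteq> 0)"
      proof
        assume r: "\<forall>x\<in>X. fac (fst x) (snd x) ?s \<noteq> 0"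
        show "regular ?s"
          unfolding regular_def
        proof (intro allI impI)
          fix T :: "'r set" and d :: nat assume "T \<noteq> {}" "T = UNIV \<longrightarrow> 1 \<le> d"
          hence "d \<le> D \<Longrightarrow> (T, d) \<in> X" by (simp add: X_def)
          thus "fac T d ?s \<noteq> 0" using bspec[OF r, of "(T, d)"] big[OF a, of d T] by (cases "d \<le> D") auto
        qed
      next
        assume "regular ?s"
        thus "\<forall>x\<in>X. fac (fst x) (snd x) ?s \<noteq> 0" by (simp add: regular_def X_def case_prod_beta)
      qed
      thus ?thesis using finX by (simp add: case_prod_beta)
    qed
    have "generic = {a\<in>hyper. regular ((- dimn) *s a) \<and> 
       (\<forall>K. (- dimn) *s a \<in> orthant (-(real K/2)) \<longrightarrow> RR K ((- dimn) *s a) \<noteq> 0)}" by (rule generic_def)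
    moreover have "RR K ?s \<noteq> 0 \<Longrightarrow> regular ?s \<Longrightarrow> ?s \<in> orthant (-(real K'/2)) \<Longrightarrow> RR K' ?s \<noteq> 0" for K'
      using RR_consistent[OF inK[OF a], of K'] regular_ev[OF _ admissible_LL] by auto
    moreover have "a \<in> hyper" using a by (simp add: W_def)
    ultimately have "a \<in> generic \<longleftrightarrow> regular ?s \<and> RR K ?s \<noteq> 0" using inK[OF a] by blast
    thus ?thesis using reg by (simp add: F_def)
  qed
  show "\<exists>W G. openin (top_of_set hyper) W \<and> a0 \<in> W \<and> finite G \<and> (\<forall>g\<in>G. holomorphic_within g W) \<and>
      (hyper - generic) \<inter> W = {w \<in> W. \<forall>g\<in>G. g w = 0}"
  proof (intro exI[of _ W] exI[of _ "{\<lambda>a. F ((- dimn) *s a)}"] conjI)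
    show "openin (top_of_set hyper) W" unfolding W_def by (intro openin_open_Int) auto
    show "a0 \<in> W" using a0 by (simp add: W_def)
    have "cdiff_at F s" if "s \<in> orthant (-(real K/2))" for s
      unfolding F_def[abs_def] case_prod_beta
      by (intro cdiff_at_mult cdiff_at_prod cdiff_at_fac cdiff_RR that)
    from cdiff_imp_holomorphic_within[OF this[OF inK]]
    have "holomorphic_within (\<lambda>a. F ((- dimn) *s a)) W" by blast
    thus "\<forall>g\<in>{\<lambda>a. F ((- dimn) *s a)}. holomorphic_within g W"
      by (simp only: ball_simps simp_thms)
    show "(hyper - generic) \<inter> W = {w \<in> W. \<forall>g\<in>{\<lambda>a. F ((- dimn) *s a)}. g w = 0}"
      using iff by (auto simp: W_def)
  qed auto
qed (auto simp: generic_def)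

end

section \<open>The zeta function as the restriction to a ray\<close>

locale zeta_arrangement = continued_arrangement c \<phi> LL RR
  for c :: "'r::finite \<Rightarrow> complex ^ 'n::finite" and \<phi> LL RR +
  fixes a :: "'r \<Rightarrow> nat"
  assumes a_pos: "a i > 0"
begin

definition A :: nat where "A = sum a UNIV"

definition ray :: "complex \<Rightarrow> complex ^ 'r" where
  "ray \<sigma> = \<sigma> *s (\<chi> i. of_nat (a i))"

lemma ray_nth [simp]: "ray \<sigma> $ i = \<sigma> * of_nat (a i)"
  by (simp add: ray_def)

lemma A_pos: "A > 0"
  using a_pos member_le_sum[of undefined UNIV a] by (auto simp: A_def intro: less_le_trans)

lemma a_le_A: "a i \<le> A"
  unfolding A_def by (rule member_le_sum) auto

text \<open>For \<open>K > 0\<close> the ray over this half plane stays in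
  \<open>orthant (-(real K/2))\<close>, since \<open>a i \<le> A\<close>.\<close>

definition HK :: "nat \<Rightarrow> complex set" where
  "HK K = {\<sigma>. Re \<sigma> > -(real K / (2 * real A))}"

lemma ray_orthant:
  assumes "\<sigma> \<in> HK K" "K > 0"
  shows "ray \<sigma> \<in> orthant (-(real K/2))"
  unfolding orthant_def
proof (intro CollectI allI)
  fix i
  show "-(real K/2) < Re (ray \<sigma> $ i)"
  proof (cases "Re \<sigma> \<ge> 0")
    case True
    hence "0 \<le> Re \<sigma> * real (a i)" by simp
    thus ?thesis using assms(2) by simp
  next
    case False
    have "-(real K/2) < Re \<sigma> * real A" using assms(1) A_pos by (simp add: HK_def field_simps)
    also have "\<dots> \<le> Re \<sigma> * real (a i)" using False a_le_A[of i] by (intro mult_left_mono_neg) auto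
    finally show ?thesis by simp
  qed
qed

lemma ray_orthant_pos: "b \<ge> 0 \<Longrightarrow> Re \<sigma> > b \<Longrightarrow> ray \<sigma> \<in> orthant b"
  unfolding orthant_def
proof (intro CollectI allI)
  fix i assume *: "b \<ge> 0" "Re \<sigma> > b"
  have "Re \<sigma> * 1 \<le> Re \<sigma> * real (a i)" using * a_pos[of i] by (intro mult_left_mono) auto
  moreover have "Re (ray \<sigma> $ i) = Re \<sigma> * real (a i)" by simp
  ultimately show "b < Re (ray \<sigma> $ i)" using * by linarith
qed

lemma cdiff_ray_holomorphic:
  assumes "\<And>w. w \<in> S \<Longrightarrow> cdiff_at F (ray w)"
  shows "(\<lambda>w. F (ray w)) holomorphic_on S"
  using cdiff_line_holomorphic[of S F 0 "\<chi> i. of_nat (a i)"] assms by (simp add: ray_def)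

definition Z0 :: "complex \<Rightarrow> complex" where "Z0 \<sigma> = zint (ray \<sigma>) \<phi>"
definition num :: "nat \<Rightarrow> complex \<Rightarrow> complex" where "num K \<sigma> = RR K (ray \<sigma>)"
definition den :: "nat \<Rightarrow> complex \<Rightarrow> complex" where
  "den K \<sigma> = ev (LL K) (ray \<sigma>) * (dimn + \<sigma> * of_nat A)"

lemma holomorphic_num: "K > 0 \<Longrightarrow> num K holomorphic_on HK K"
  unfolding num_def[abs_def] by (intro cdiff_ray_holomorphic cdiff_RR ray_orthant)

lemma holomorphic_ev: "(\<lambda>\<sigma>. ev L (ray \<sigma>)) holomorphic_on S"
  by (intro cdiff_ray_holomorphic cdiff_at_ev)

lemma holomorphic_den: "den K holomorphic_on S"
  unfolding den_def[abs_def] by (intro holomorphic_intros holomorphic_ev)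

lemma holomorphic_Z0: "Z0 holomorphic_on {\<sigma>. Re \<sigma> > 0}"
  unfolding Z0_def[abs_def]
proof (rule cdiff_ray_holomorphic)
  fix \<sigma> :: complex assume "\<sigma> \<in> {\<sigma>. Re \<sigma> > 0}"
  hence "ray \<sigma> \<in> orthant (-(real 0/2))" using ray_orthant_pos[of 0 \<sigma>] by simp
  from cdiff_at_zint[OF this test] show "cdiff_at (\<lambda>s. zint s \<phi>) (ray \<sigma>)" by simp
qed

text \<open>Known for real parts above 1, where the ray runs in \<open>orthant 1\<close>; the
  identity theorem carries it to the whole half plane of convergence considered.\<close>

lemma den_Z0:
  assumes "Re \<sigma> > 0" "K > 0"
  shows "den K \<sigma> * Z0 \<sigma> = num K \<sigma>"
proof (rule halfplane_identity[where b = 0 and M = 1 and f = "\<lambda>\<sigma>. den K \<sigma> * Z0 \<sigma>" and g = "num K"])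
  show "(\<lambda>\<sigma>. den K \<sigma> * Z0 \<sigma>) holomorphic_on {w. 0 < Re w}"
    by (intro holomorphic_intros holomorphic_den holomorphic_Z0)
  show "num K holomorphic_on {w. 0 < Re w}"
    by (rule holomorphic_on_subset[OF holomorphic_num[OF assms(2)]])
      (auto simp: HK_def intro: le_less_trans[of _ 0])
  fix w :: complex assume "Re w > 1"
  hence "ray w \<in> orthant 1" using ray_orthant_pos[of 1 w] by simp
  from RR_eq[OF this, of K] show "den K w * Z0 w = num K w"
    by (simp add: den_def Z0_def num_def A_def sum_distrib_left dimn_eq)
qed (use assms in auto)

lemma num_den_consistent:
  assumes "\<sigma> \<in> HK K" "\<sigma> \<in> HK K'" "K > 0" "K' > 0"
  shows "num K \<sigma> * den K' \<sigma> = num K' \<sigma> * den K \<sigma>"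
  using RR_consistent[OF ray_orthant[OF assms(1,3)] ray_orthant[OF assms(2,4)]]
  by (simp add: num_def den_def)

text \<open>Along the ray each factor is affine with slope \<open>sum a T\<close>, positive because
  \<open>T\<close> is nonempty.\<close>

lemma finite_zeros_den: "finite {\<sigma>. den K \<sigma> = 0}"
proof -
  have 1: "finite {\<sigma>. x + \<sigma> * y = (0::complex)}" if "y \<noteq> 0" for x y
  proof (rule finite_subset)
    show "{\<sigma>. x + \<sigma> * y = 0} \<subseteq> {- x / y}" using that by (auto simp: field_simps add_eq_0_iff)
  qed auto
  have "finite {\<sigma>. ev L (ray \<sigma>) = 0}" if "admissible L" for L
    using that
  proof (induction L)
    case (add x L)
    obtain T d where x: "x = (T, d)" by (cases x)
    obtain t where "t \<in> T" using add.prems by (auto simp: x)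
    hence "sum a T \<noteq> 0" using a_pos[of t] by auto
    moreover have "(\<Sum>t\<in>T. of_nat (a t)) = (of_nat (sum a T) :: complex)" by simp
    ultimately have "(\<Sum>t\<in>T. of_nat (a t)) \<noteq> (0::complex)" by (simp only: of_nat_eq_0_iff) simp
    hence "finite {\<sigma>. fac T d (ray \<sigma>) = 0}"
      using 1[of "\<Sum>t\<in>T. of_nat (a t)" "of_nat (rk T + d)"] by (simp add: fac_def sum_distrib_left)
    moreover have "{\<sigma>. ev (add_mset x L) (ray \<sigma>) = 0} = {\<sigma>. fac T d (ray \<sigma>) = 0} \<union> {\<sigma>. ev L (ray \<sigma>) = 0}"
      by (auto simp: x)
    ultimately show ?case using add by (simp add: x)
  qed auto
  moreover have "{\<sigma>. den K \<sigma> = 0} = {\<sigma>. ev (LL K) (ray \<sigma>) = 0} \<union> {\<sigma>. dimn + \<sigma> * of_nat A = 0}"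
    by (auto simp: den_def)
  ultimately show ?thesis using 1[of "of_nat A" dimn] A_pos admissible_LL by simp
qed

lemma eventually_den_nonzero: "\<forall>\<^sub>F \<sigma> in at \<sigma>0. den K \<sigma> \<noteq> 0"
proof -
  have "\<forall>\<^sub>F \<sigma> in at \<sigma>0. \<sigma> \<in> - ({\<sigma>. den K \<sigma> = 0} - {\<sigma>0}) - {\<sigma>0}"
    by (rule eventually_at_in_open[OF open_Compl[OF finite_imp_closed[OF finite_Diff[OF finite_zeros_den]]]]) simp
  thus ?thesis by eventually_elim auto
qed

lemma open_HK: "open (HK K)"
  unfolding HK_def by (rule open_halfplane)

lemma HK_exhaust: "\<exists>K>0. \<sigma> \<in> HK K"
proof -
  obtain K where K: "real K > - Re \<sigma> * (2 * real A)" using reals_Archimedean2 by blast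
  hence "\<sigma> \<in> HK (Suc K)" using A_pos by (simp add: HK_def field_simps)
  thus ?thesis by blast
qed

definition level :: "complex \<Rightarrow> nat" where "level \<sigma> = (LEAST K. K > 0 \<and> \<sigma> \<in> HK K)"

lemma level: "level \<sigma> > 0" "\<sigma> \<in> HK (level \<sigma>)"
  using LeastI_ex[of "\<lambda>K. K > 0 \<and> \<sigma> \<in> HK K"] HK_exhaust by (auto simp: level_def)

lemma level_le: "\<sigma> \<in> HK K \<Longrightarrow> K > 0 \<Longrightarrow> level \<sigma> \<le> K"
  unfolding level_def by (rule Least_le) auto

text \<open>The quotients for different \<open>K\<close> are glued by using, at each point, the
  least \<open>K\<close> whose half plane contains it. At zeros of the denominator the value is 0 by
  convention; \<open>remove_sings\<close> corrects this afterwards.\<close>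

definition Y :: "complex \<Rightarrow> complex" where
  "Y \<sigma> = num (level \<sigma>) \<sigma> / den (level \<sigma>) \<sigma>"

text \<open>Near \<open>\<sigma>1\<close> all levels are at most \<open>K\<close>, so only finitely
  many denominators have to be avoided.\<close>

lemma eventually_Y:
  assumes "\<sigma>1 \<in> HK K" "K > 0"
  shows "\<forall>\<^sub>F \<sigma> in at \<sigma>1. Y \<sigma> = num K \<sigma> / den K \<sigma> \<and> den K \<sigma> \<noteq> 0"
proof -
  have "\<forall>\<^sub>F \<sigma> in at \<sigma>1. \<forall>K'\<in>{..K}. den K' \<sigma> \<noteq> 0"
    by (intro eventually_ball_finite ballI eventually_den_nonzero) auto
  moreover have "\<forall>\<^sub>F \<sigma> in at \<sigma>1. \<sigma> \<in> HK K"
    by (rule eventually_at_in_open'[OF open_HK assms(1)])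
  ultimately show ?thesis
  proof eventually_elim
    case (elim \<sigma>)
    have "level \<sigma> \<le> K" by (rule level_le[OF elim(2) assms(2)])
    hence "den (level \<sigma>) \<sigma> \<noteq> 0" "den K \<sigma> \<noteq> 0" using elim by auto
    thus ?case
      using num_den_consistent[OF level(2) elim(2) level(1) assms(2)] by (simp add: Y_def field_simps)
  qed
qed

lemma Y_meromorphic: "Y meromorphic_on UNIV"
proof -
  have "Y meromorphic_on {\<sigma>1}" for \<sigma>1
  proof -
    let ?K = "level \<sigma>1"
    have "num ?K analytic_on HK ?K" "den ?K analytic_on HK ?K"
      using holomorphic_num[OF level(1)] holomorphic_den open_HK analytic_on_open by blast+
    hence "(\<lambda>\<sigma>. num ?K \<sigma> / den ?K \<sigma>) meromorphic_on HK ?K"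
      by (intro meromorphic_intros analytic_on_imp_meromorphic_on)
    hence "(\<lambda>\<sigma>. num ?K \<sigma> / den ?K \<sigma>) meromorphic_on {\<sigma>1}"
      by (rule meromorphic_on_subset) (use level in auto)
    moreover have "\<forall>\<^sub>F \<sigma> in at \<sigma>1. Y \<sigma> = num ?K \<sigma> / den ?K \<sigma>"
      using eventually_Y[OF level(2,1)] by eventually_elim auto
    ultimately show ?thesis by (subst meromorphic_on_cong) auto
  qed
  thus ?thesis by (simp add: meromorphic_on_def)
qed

lemma continuation_exists:
  "\<exists>Z. Z nicely_meromorphic_on UNIV \<and> (\<forall>s. Re s > 0 \<longrightarrow> Z s = Z0 s) \<and>
     (\<forall>\<sigma>1. is_pole Y \<sigma>1 \<longrightarrow> is_pole Z \<sigma>1)"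
proof (intro exI conjI allI impI)
  show "remove_sings Y nicely_meromorphic_on UNIV"
    by (rule remove_sings_nicely_meromorphic[OF Y_meromorphic])
  show "remove_sings Y s = Z0 s" if "Re s > 0" for s
  proof (rule remove_sings_eqI)
    have "s \<in> HK 1" using that by (auto simp: HK_def intro: le_less_trans[of _ 0])
    from eventually_Y[OF this]
    have "\<forall>\<^sub>F \<sigma> in at s. Y \<sigma> = num 1 \<sigma> / den 1 \<sigma> \<and> den 1 \<sigma> \<noteq> 0" by simp
    moreover have "\<forall>\<^sub>F \<sigma> in at s. \<sigma> \<in> {\<sigma>. Re \<sigma> > 0}"
      by (rule eventually_at_in_open'[OF open_halfplane(1)]) (use that in auto)
    ultimately have ev: "\<forall>\<^sub>F \<sigma> in at s. Z0 \<sigma> = Y \<sigma>"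
    proof eventually_elim
      case (elim \<sigma>)
      thus ?case using den_Z0[of \<sigma> 1] by (simp add: field_simps)
    qed
    have "isCont Z0 s"
      using holomorphic_Z0 open_halfplane(1)[of 0] that
      by (metis continuous_on_eq_continuous_at holomorphic_on_imp_continuous_on mem_Collect_eq)
    hence "Z0 \<midarrow>s\<rightarrow> Z0 s" by (simp add: isCont_def)
    thus "Y \<midarrow>s\<rightarrow> Z0 s" using ev by (rule Lim_transform_eventually)
  qed
  fix \<sigma>1 assume "is_pole Y \<sigma>1"
  moreover have "isolated_singularity_at Y \<sigma>1" using Y_meromorphic by (simp add: meromorphic_on_altdef)
  ultimately show "is_pole (remove_sings Y) \<sigma>1"
    using is_pole_cong[OF eventually_remove_sings_eq_at refl] by blast
qed

lemma num_nonzero: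
  assumes "(\<chi> i. of_nat (a i) / of_nat A) \<in> generic" "- dimn / of_nat A \<in> HK K" "K > 0"
  shows "num K (- dimn / of_nat A) \<noteq> 0"
proof -
  have "ray (- dimn / of_nat A) = (- dimn) *s (\<chi> i. of_nat (a i) / of_nat A)"
    by (simp add: vec_eq_iff)
  thus ?thesis using assms(1) ray_orthant[OF assms(2,3)] by (auto simp: generic_def num_def)
qed

lemma pole_of_generic:
  assumes "(\<chi> i. of_nat (a i) / of_nat A) \<in> generic"
  shows "is_pole Y (- dimn / of_nat A)"
proof -
  let ?\<sigma> = "- dimn / of_nat A"
  obtain K where K: "K > 0" "?\<sigma> \<in> HK K" using HK_exhaust by blast
  have cont: "isCont (num K) ?\<sigma>" "isCont (den K) ?\<sigma>"
    using holomorphic_num[OF K(1)] holomorphic_den open_HK K(2)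
    by (metis continuous_on_eq_continuous_at holomorphic_on_imp_continuous_on)+
  have "den K ?\<sigma> = 0" using A_pos by (simp add: den_def)
  hence "(den K \<longlongrightarrow> 0) (at ?\<sigma>)" using cont(2) by (simp add: isCont_def)
  hence "filterlim (den K) (at 0) (at ?\<sigma>)"
    unfolding filterlim_at using eventually_den_nonzero by auto
  hence "is_pole (\<lambda>\<sigma>. num K \<sigma> / den K \<sigma>) ?\<sigma>"
    by (intro is_pole_divide cont num_nonzero assms K)
  moreover have ev: "\<forall>\<^sub>F \<sigma> in at ?\<sigma>. Y \<sigma> = num K \<sigma> / den K \<sigma>"
    using eventually_Y[OF K(2,1)] by eventually_elim auto
  ultimately show ?thesis using is_pole_cong[OF ev refl] by blast
qed


text \<open>\<open>G\<close> continues holomorphically after multiplication by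
  \<open>ev (LL K)\<close> alone, without the factor \<open>dimn + \<sigma> * of_nat A\<close> of
  the hyperplane. The bound \<open>M\<close> is left free because each integration by parts asks for
  a larger real part.\<close>

definition tame :: "nat \<Rightarrow> (complex \<Rightarrow> complex) \<Rightarrow> bool" where
  "tame K G \<longleftrightarrow> (\<exists>H M. H holomorphic_on HK K \<and> (\<forall>\<sigma>. Re \<sigma> > M \<longrightarrow> ev (LL K) (ray \<sigma>) * G \<sigma> = H \<sigma>))"

lemma tame_lform:
  assumes "i \<in> bas UNIV" "test_function \<psi>" "K > 0"
  shows "tame K (\<lambda>\<sigma>. zint (ray \<sigma>) (\<lambda>z. lform (c i) z * \<psi> z))"
proof -
  obtain H where H: "\<forall>s\<in>orthant (-(K/2)). cdiff_at H s"
    "\<forall>s\<in>orthant 1. H s = ev (LL K) s * zint s (\<lambda>z. lform (c i) z * \<psi> z)"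
    using extends_lform[OF assms(1,2), of K] unfolding extends_def by blast
  have "(\<lambda>\<sigma>. H (ray \<sigma>)) holomorphic_on HK K"
    by (intro cdiff_ray_holomorphic) (use H ray_orthant assms(3) in auto)
  moreover have "ray \<sigma> \<in> orthant 1" if "Re \<sigma> > 1" for \<sigma> using ray_orthant_pos[of 1 \<sigma>] that by simp
  ultimately show ?thesis unfolding tame_def using H(2)
    by (intro exI[of _ "\<lambda>\<sigma>. H (ray \<sigma>)"] exI[of _ 1]) auto
qed

lemma tame_add: "tame K F \<Longrightarrow> tame K G \<Longrightarrow> tame K (\<lambda>\<sigma>. F \<sigma> + G \<sigma>)"
  unfolding tame_def
proof (elim exE conjE)
  fix H M H' M' assume "H holomorphic_on HK K" "\<forall>\<sigma>. M < Re \<sigma> \<longrightarrow> ev (LL K) (ray \<sigma>) * F \<sigma> = H \<sigma>"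
    "H' holomorphic_on HK K" "\<forall>\<sigma>. M' < Re \<sigma> \<longrightarrow> ev (LL K) (ray \<sigma>) * G \<sigma> = H' \<sigma>"
  thus "\<exists>H M. H holomorphic_on HK K \<and> (\<forall>\<sigma>. Re \<sigma> > M \<longrightarrow> ev (LL K) (ray \<sigma>) * (F \<sigma> + G \<sigma>) = H \<sigma>)"
    by (intro exI[of _ "\<lambda>\<sigma>. H \<sigma> + H' \<sigma>"] exI[of _ "max M M'"]) (auto intro!: holomorphic_intros simp: distrib_left)
qed

lemma tame_mult: "p holomorphic_on UNIV \<Longrightarrow> tame K G \<Longrightarrow> tame K (\<lambda>\<sigma>. p \<sigma> * G \<sigma>)"
  unfolding tame_def
proof (elim exE conjE)
  fix H M assume p: "p holomorphic_on UNIV" and "H holomorphic_on HK K"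
    "\<forall>\<sigma>. M < Re \<sigma> \<longrightarrow> ev (LL K) (ray \<sigma>) * G \<sigma> = H \<sigma>"
  thus "\<exists>H M. H holomorphic_on HK K \<and> (\<forall>\<sigma>. Re \<sigma> > M \<longrightarrow> ev (LL K) (ray \<sigma>) * (p \<sigma> * G \<sigma>) = H \<sigma>)"
    by (intro exI[of _ "\<lambda>\<sigma>. p \<sigma> * H \<sigma>"] exI[of _ M])
      (auto intro!: holomorphic_intros holomorphic_on_subset[OF p] simp: mult.left_commute)
qed

lemma tame_0: "tame K (\<lambda>\<sigma>. 0)"
  unfolding tame_def by (intro exI[of _ "\<lambda>_. 0"]) auto

lemma tame_cong: "(\<And>\<sigma>. Re \<sigma> > M \<Longrightarrow> F \<sigma> = G \<sigma>) \<Longrightarrow> tame K F \<Longrightarrow> tame K G"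
  unfolding tame_def
proof (elim exE conjE)
  fix H M' assume "\<And>\<sigma>. Re \<sigma> > M \<Longrightarrow> F \<sigma> = G \<sigma>" "H holomorphic_on HK K"
    "\<forall>\<sigma>. M' < Re \<sigma> \<longrightarrow> ev (LL K) (ray \<sigma>) * F \<sigma> = H \<sigma>"
  thus "\<exists>H M. H holomorphic_on HK K \<and> (\<forall>\<sigma>. Re \<sigma> > M \<longrightarrow> ev (LL K) (ray \<sigma>) * G \<sigma> = H \<sigma>)"
    by (intro exI[of _ H] exI[of _ "max M M'"]) auto
qed

text \<open>Far to the right \<open>p \<sigma> * num K \<sigma>\<close> and
  \<open>(dimn + \<sigma> * of_nat A) * H \<sigma>\<close> are the same multiple of the integral, so
  they agree on \<open>HK K\<close>. At the point in question the second is 0 while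
  \<open>num K\<close> is not.\<close>

lemma root_of_tame:
  assumes gen: "(\<chi> i. of_nat (a i) / of_nat A) \<in> generic"
    and p: "p holomorphic_on UNIV" and tame: "\<And>K. K > 0 \<Longrightarrow> tame K (\<lambda>\<sigma>. p \<sigma> * Z0 \<sigma>)"
  shows "p (- dimn / of_nat A) = 0"
proof -
  let ?\<sigma> = "- dimn / of_nat A"
  obtain K where K: "K > 0" "?\<sigma> \<in> HK K" using HK_exhaust by blast
  obtain H M where H: "H holomorphic_on HK K"
    "\<And>\<sigma>. Re \<sigma> > M \<Longrightarrow> ev (LL K) (ray \<sigma>) * (p \<sigma> * Z0 \<sigma>) = H \<sigma>"
    using tame[OF K(1)] by (auto simp: tame_def)
  have "p ?\<sigma> * num K ?\<sigma> = (dimn + ?\<sigma> * of_nat A) * H ?\<sigma>"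
  proof (rule halfplane_identity[where M = "max 0 M" and f = "\<lambda>\<sigma>. p \<sigma> * num K \<sigma>"
        and g = "\<lambda>\<sigma>. (dimn + \<sigma> * of_nat A) * H \<sigma>"])
    show "- (real K / (2 * real A)) < Re ?\<sigma>" using K(2) by (simp add: HK_def)
    show "(\<lambda>\<sigma>. p \<sigma> * num K \<sigma>) holomorphic_on {w. - (real K / (2 * real A)) < Re w}"
      using holomorphic_num[OF K(1)] unfolding HK_def
      by (intro holomorphic_intros holomorphic_on_subset[OF p]) auto
    show "(\<lambda>\<sigma>. (dimn + \<sigma> * of_nat A) * H \<sigma>) holomorphic_on {w. - (real K / (2 * real A)) < Re w}"
      using H(1) unfolding HK_def by (intro holomorphic_intros) auto
    fix w :: complex assume w: "Re w > max 0 M"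
    hence "num K w = den K w * Z0 w" using den_Z0[of w K] K(1) by simp
    thus "p w * num K w = (dimn + w * of_nat A) * H w"
      using H(2)[of w] w by (simp add: den_def mult_ac flip: H(2))
  qed
  thus ?thesis using num_nonzero[OF gen K(2,1)] A_pos by simp
qed

end

section \<open>Landau's theorem and positivity\<close>

lemma exp_partial_sum_le:
  assumes "x \<ge> (0::real)"
  shows "(\<Sum>k<N. x ^ k / fact k) \<le> exp x"
proof -
  have "(\<lambda>k. x ^ k /\<^sub>R fact k) sums exp x" by (rule exp_converges)
  hence s: "(\<lambda>k. x ^ k / fact k) sums exp x" by (simp add: divide_inverse mult.commute)
  have "(\<Sum>k<N. x ^ k / fact k) \<le> (suminf (\<lambda>k. x ^ k / fact k))"
    by (rule sum_le_suminf[OF sums_summable[OF s]]) (use assms in auto)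
  thus ?thesis using sums_unique[OF s] by simp
qed

text \<open>Landau's theorem: the Taylor coefficients at \<open>-m-1\<close> are nonnegative.\<close>

lemma landau_convergence:
  fixes lam w :: "'z \<Rightarrow> real" and g :: "complex \<Rightarrow> complex"
  assumes [measurable]: "lam \<in> borel_measurable M" "w \<in> borel_measurable M"
    and w: "integrable M w" "\<And>z. w z \<ge> 0" and lam: "\<And>z. lam z \<ge> 0"
    and m: "m > 0" and \<beta>: "\<beta> > 1" and g: "g holomorphic_on {\<tau>. Re \<tau> < \<beta>}"
    and eq: "\<And>\<tau>. Re \<tau> < - m \<Longrightarrow> g \<tau> = (LINT z|M. of_real (w z) * exp (\<tau> * of_real (lam z)))"
  shows "(\<integral>\<^sup>+ z. ennreal (w z * exp (lam z)) \<partial>M) < \<infinity>"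
proof -
  \<comment> \<open>The unit disc around \<open>- m0\<close> lies in the half plane where
    \<open>g\<close> is the integral, and the distance \<open>m0 + 1\<close> from
    \<open>- m0\<close> to 1 is below the radius \<open>m0 + \<beta>\<close> of holomorphy.\<close>
  define m0 where "m0 = m + 1"
  \<comment> \<open>The density whose integral is the \<open>k\<close>-th Taylor coefficient of
    \<open>g\<close> at \<open>- m0\<close>.\<close>
  define h where "h k z = lam z ^ k / fact k * exp (- m0 * lam z) * w z" for k z
  define cf where "cf k = (LINT z|M. h k z)" for k
  have h0: "h k z \<ge> 0" for k z unfolding h_def using lam w by simp
  have bound: "x * exp (- m0 * lam z) * w z \<le> w z" if "x \<le> exp (lam z)" for x z
  proof -
    have "x * exp (- m0 * lam z) \<le> exp (lam z) * exp (- m0 * lam z)"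
      by (rule mult_right_mono[OF that]) simp
    also have "\<dots> = exp (- m * lam z)" by (simp add: m0_def algebra_simps flip: exp_add)
    also have "\<dots> \<le> 1" using m lam[of z] by simp
    finally show ?thesis using mult_right_mono[of _ 1 "w z"] w(2)[of z] by simp
  qed
  have term_le: "lam z ^ k / fact k \<le> exp (lam z)" for k z
  proof -
    have "lam z ^ k / fact k \<le> (\<Sum>j<Suc k. lam z ^ j / fact j)"
      by (rule member_le_sum[of k "{..<Suc k}" "\<lambda>j. lam z ^ j / fact j"]) (use lam in auto)
    thus ?thesis using exp_partial_sum_le[OF lam[of z], of "Suc k"] by linarith
  qed
  have hint: "integrable M (h k)" for k
  proof (rule Bochner_Integration.integrable_bound[OF w(1)])
    show "h k \<in> borel_measurable M" unfolding h_def by measurable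
    show "AE z in M. norm (h k z) \<le> norm (w z)"
    proof (rule AE_I2)
      fix z
      have "h k z \<le> w z" using bound[OF term_le[of z k]] by (simp add: h_def)
      thus "norm (h k z) \<le> norm (w z)" using h0[of k z] by simp
    qed
  qed
  define f where "f u = g (u - of_real m0)" for u
  have "f holomorphic_on ball 0 (m0 + \<beta>)"
  proof -
    have "(\<lambda>u::complex. u - of_real m0) ` ball 0 (m0 + \<beta>) \<subseteq> {\<tau>. Re \<tau> < \<beta>}"
    proof
      fix x assume "x \<in> (\<lambda>u::complex. u - of_real m0) ` ball 0 (m0 + \<beta>)"
      then obtain u where "x = u - of_real m0" "norm u < m0 + \<beta>" by auto
      thus "x \<in> {\<tau>. Re \<tau> < \<beta>}" using complex_Re_le_cmod[of u] by simp
    qed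
    thus ?thesis unfolding f_def[abs_def]
      using holomorphic_on_compose_gen[OF _ g, of "\<lambda>u. u - of_real m0" "ball 0 (m0 + \<beta>)"]
      by (simp add: o_def holomorphic_intros)
  qed
  note taylor = holomorphic_power_series[OF this]
  define d where "d k = (deriv ^^ k) f 0 / fact k" for k
  have d: "(\<lambda>k. d k * u ^ k) sums f u" if "norm u < m0 + \<beta>" for u
    using taylor[of u] that by (simp add: d_def)
  \<comment> \<open>In the unit disc the exponential series may be integrated term by term, its
    partial sums being dominated by \<open>w\<close>.\<close>
  have c: "(\<lambda>k. of_real (cf k) * u ^ k) sums f u" if u: "norm u < 1" for u
    unfolding sums_def
  proof -
    let ?S = "\<lambda>N z. (\<Sum>k<N. of_real (h k z) * u ^ k)"
    have "(\<lambda>N. LINT z|M. ?S N z) \<longlonglongrightarrow> (LINT z|M. of_real (w z) * exp ((u - of_real m0) * of_real (lam z)))"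
    proof (rule integral_dominated_convergence[OF _ _ w(1)])
      show "?S N \<in> borel_measurable M" for N unfolding h_def by measurable
      show "(\<lambda>z. of_real (w z) * exp ((u - of_real m0) * of_real (lam z))) \<in> borel_measurable M"
        by measurable
      show "AE z in M. (\<lambda>N. ?S N z) \<longlonglongrightarrow> of_real (w z) * exp ((u - of_real m0) * of_real (lam z))"
      proof (rule AE_I2)
        fix z
        have "(\<lambda>k. (u * of_real (lam z)) ^ k /\<^sub>R fact k) sums exp (u * of_real (lam z))" by (rule exp_converges)
        from sums_mult[OF this, of "of_real (w z) * exp (- of_real m0 * of_real (lam z))"]
        have "(\<lambda>k. (of_real (w z) * exp (- of_real m0 * of_real (lam z))) * ((u * of_real (lam z)) ^ k /\<^sub>R fact k)) sums
          (of_real (w z) * exp (- of_real m0 * of_real (lam z)) * exp (u * of_real (lam z)))" .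
        also have "(\<lambda>k. (of_real (w z) * exp (- of_real m0 * of_real (lam z))) * ((u * of_real (lam z)) ^ k /\<^sub>R fact k)) =
            (\<lambda>k. of_real (h k z) * u ^ k)"
        proof
          fix k
          have "exp (- of_real m0 * of_real (lam z)) = (of_real (exp (- m0 * lam z)) :: complex)"
            by (simp flip: exp_of_real)
          thus "(of_real (w z) * exp (- of_real m0 * of_real (lam z))) * ((u * of_real (lam z)) ^ k /\<^sub>R fact k) =
              of_real (h k z) * u ^ k"
            by (simp add: h_def scaleR_conv_of_real power_mult_distrib divide_inverse mult_ac)
        qed
        also have "of_real (w z) * exp (- of_real m0 * of_real (lam z)) * exp (u * of_real (lam z)) =
            of_real (w z) * exp ((u - of_real m0) * of_real (lam z))"
          by (simp add: algebra_simps flip: exp_add)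
        finally show "(\<lambda>N. ?S N z) \<longlonglongrightarrow> of_real (w z) * exp ((u - of_real m0) * of_real (lam z))"
          by (simp add: sums_def)
      qed
      show "AE z in M. norm (?S N z) \<le> w z" for N
      proof (rule AE_I2)
        fix z
        have "norm (?S N z) \<le> (\<Sum>k<N. norm (of_real (h k z) * u ^ k))" by (rule norm_sum)
        also have "\<dots> \<le> (\<Sum>k<N. h k z)"
          using u h0 by (intro sum_mono) (auto simp: norm_mult norm_power intro!: mult_left_le power_le_one)
        also have "\<dots> = (\<Sum>k<N. lam z ^ k / fact k) * exp (- m0 * lam z) * w z"
          by (simp add: h_def sum_distrib_right)
        also have "\<dots> \<le> w z" by (rule bound[OF exp_partial_sum_le[OF lam]])
        finally show "norm (?S N z) \<le> w z" .
      qed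
    qed
    moreover have "(LINT z|M. ?S N z) = (\<Sum>k<N. of_real (cf k) * u ^ k)" for N
      using hint by (simp add: cf_def integral_complex_of_real)
    moreover have "f u = (LINT z|M. of_real (w z) * exp ((u - of_real m0) * of_real (lam z)))"
      unfolding f_def by (rule eq) (use u complex_Re_le_cmod[of u] in \<open>auto simp: m0_def\<close>)
    ultimately show "(\<lambda>N. \<Sum>k<N. of_real (cf k) * u ^ k) \<longlonglongrightarrow> f u" by simp
  qed
  have ev: "\<forall>\<^sub>F u in nhds (0::complex). norm u < 1"
    using eventually_nhds_in_open[of "ball 0 1" "0::complex"] by simp
  have "f has_fps_expansion Abs_fps (\<lambda>k. of_real (cf k))"
    using ev by (intro has_fps_expansionI) (auto elim!: eventually_mono intro: c)
  moreover have "f has_fps_expansion Abs_fps d"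
    using ev by (intro has_fps_expansionI) (auto elim!: eventually_mono intro!: d simp: m0_def, use m \<beta> in linarith)
  ultimately have "Abs_fps (\<lambda>k. of_real (cf k)) = Abs_fps d" by (rule fps_expansion_unique_complex)
  hence cd: "of_real (cf k) = d k" for k by (metis fps_nth_Abs_fps)
  \<comment> \<open>The coefficients \<open>cf\<close> are those of a series converging up to radius
    \<open>m0 + \<beta>\<close>; the point \<open>m0 + 1\<close> is
    \<open>\<tau> = 1\<close>.\<close>
  have "summable (\<lambda>k. d k * of_real (m0 + 1) ^ k)"
    by (rule sums_summable[OF d], unfold norm_of_real) (use m \<beta> in \<open>simp add: m0_def\<close>)
  hence "summable (\<lambda>k. of_real (cf k * (m0 + 1) ^ k) :: complex)" by (simp flip: cd)
  hence summ: "summable (\<lambda>k. cf k * (m0 + 1) ^ k)" by (simp only: summable_of_real_iff)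
  have cf0: "cf k * (m0 + 1) ^ k \<ge> 0" for k
    using h0 m unfolding cf_def by (intro mult_nonneg_nonneg integral_nonneg) (auto simp: m0_def)
  have pos: "m0 + 1 \<ge> 0" using m by (simp add: m0_def)
  \<comment> \<open>At \<open>\<tau> = 1\<close> all terms are nonnegative, so sum and integral may
    be exchanged without knowing integrability beforehand.\<close>
  have "(\<integral>\<^sup>+ z. ennreal (w z * exp (lam z)) \<partial>M) = (\<integral>\<^sup>+ z. (suminf (\<lambda>k. ennreal (h k z * (m0 + 1) ^ k))) \<partial>M)"
  proof (rule nn_integral_cong)
    fix z
    have "(\<lambda>k. ((m0 + 1) * lam z) ^ k /\<^sub>R fact k) sums exp ((m0 + 1) * lam z)" by (rule exp_converges)
    from sums_mult[OF this, of "w z * exp (- m0 * lam z)"]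
    have "(\<lambda>k. w z * exp (- m0 * lam z) * (((m0 + 1) * lam z) ^ k /\<^sub>R fact k)) sums
        (w z * exp (- m0 * lam z) * exp ((m0 + 1) * lam z))" .
    also have "(\<lambda>k. w z * exp (- m0 * lam z) * (((m0 + 1) * lam z) ^ k /\<^sub>R fact k)) = (\<lambda>k. h k z * (m0 + 1) ^ k)"
      by (rule ext) (simp only: h_def power_mult_distrib real_scaleR_def divide_inverse mult_ac)
    also have "w z * exp (- m0 * lam z) * exp ((m0 + 1) * lam z) = w z * exp (lam z)"
      by (simp add: algebra_simps flip: exp_add)
    finally show "ennreal (w z * exp (lam z)) = (suminf (\<lambda>k. ennreal (h k z * (m0 + 1) ^ k)))"
      using h0 pos by (intro sums_unique sums_ennreal[THEN iffD2]) (auto simp: w(2))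
  qed
  also have "\<dots> = (suminf (\<lambda>k. \<integral>\<^sup>+ z. ennreal (h k z * (m0 + 1) ^ k) \<partial>M))"
    by (rule nn_integral_suminf) (simp add: h_def)
  also have "\<dots> = (suminf (\<lambda>k. ennreal (cf k * (m0 + 1) ^ k)))"
  proof (rule suminf_cong)
    fix k
    show "(\<integral>\<^sup>+ z. ennreal (h k z * (m0 + 1) ^ k) \<partial>M) = ennreal (cf k * (m0 + 1) ^ k)"
      using hint h0 pos by (subst nn_integral_eq_integral) (auto simp: cf_def)
  qed
  also have "\<dots> < \<infinity>"
    using ennreal_suminf_neq_top[OF summ cf0] by (simp add: less_top)
  finally show ?thesis .
qed

text \<open>A complex hyperplane lies in the real hyperplane on which the real part of the form
  vanishes.\<close>

lemma negligible_lform_zeros: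
  assumes "c \<noteq> 0"
  shows "{z. lform c z = 0} \<in> null_sets lborel"
proof -
  define b where "b = (\<chi> j. cnj (c $ j))"
  have "b \<noteq> 0" using assms by (auto simp: b_def vec_eq_iff)
  hence "negligible {x. inner b x = 0}" by (intro negligible_hyperplane) auto
  moreover have "{z. lform c z = 0} \<subseteq> {x. inner b x = 0}"
  proof safe
    fix z assume "lform c z = 0"
    moreover have "inner b z = Re (lform c z)"
      by (simp add: inner_vec_def b_def lform_def inner_complex_def)
    ultimately show "inner b z = 0" by simp
  qed
  ultimately have "negligible {z. lform c z = 0}" by (rule negligible_subset)
  moreover have "{z. lform c z = 0} \<in> sets lborel"
    using borel_measurable_vimage[of "lform c" borel 0] 
      borel_measurable_continuous_onI[OF linear_continuous_on[OF bounded_linear_lform[of c]]]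
    by (simp add: vimage_def)
  ultimately show ?thesis by (simp add: negligible_iff_null_sets null_sets_completion_iff)
qed

lemma nn_integral_scale:
  fixes f :: "'a::euclidean_space \<Rightarrow> ennreal"
  assumes [measurable]: "f \<in> borel_measurable borel" and t: "t > 0"
  shows "(\<integral>\<^sup>+ z. f z \<partial>lborel) = ennreal (t ^ DIM('a)) * (\<integral>\<^sup>+ z. f (t *\<^sub>R z) \<partial>lborel)"
proof -
  have "(\<integral>\<^sup>+ z. f z \<partial>lborel) =
      (\<integral>\<^sup>+ z. f z \<partial>density (distr lborel borel (\<lambda>x. 0 + t *\<^sub>R x)) (\<lambda>_. ennreal (\<bar>t\<bar> ^ DIM('a))))"
    using lborel_affine[of t "0::'a"] t by simp
  also have "\<dots> = (\<integral>\<^sup>+ z. ennreal (t ^ DIM('a)) * f z \<partial>distr lborel borel (\<lambda>x. 0 + t *\<^sub>R x))"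
    using t by (subst nn_integral_density) auto
  also have "\<dots> = (\<integral>\<^sup>+ z. ennreal (t ^ DIM('a)) * f (t *\<^sub>R z) \<partial>lborel)"
    by (subst nn_integral_distr) auto
  also have "\<dots> = ennreal (t ^ DIM('a)) * (\<integral>\<^sup>+ z. f (t *\<^sub>R z) \<partial>lborel)"
    by (rule nn_integral_cmult) auto
  finally show ?thesis .
qed

text \<open>A positive function homogeneous of degree \<open>-dim\<close> has the same integral over all dyadic shells.\<close>

lemma homogeneous_not_integrable:
  fixes h :: "'a::euclidean_space \<Rightarrow> real"
  assumes [measurable]: "h \<in> borel_measurable borel" and h0: "\<And>z. h z \<ge> 0"
    and hom: "\<And>t z. t > 0 \<Longrightarrow> h (t *\<^sub>R z) = h z / t ^ DIM('a)"
    and pos: "AE z in lborel. h z > 0" and r: "r > 0"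
  shows "(\<integral>\<^sup>+ z. ennreal (h z) * indicator (ball 0 r) z \<partial>lborel) = \<infinity>"
proof -
  define S where "S k = {z::'a. r / 2 ^ Suc k \<le> norm z \<and> norm z < r / 2 ^ k}" for k
  have [measurable]: "S k \<in> sets borel" for k unfolding S_def by measurable
  define J where "J = (\<integral>\<^sup>+ z. ennreal (h z) * indicator (S 0) z \<partial>lborel)"
  have shell: "(\<integral>\<^sup>+ z. ennreal (h z) * indicator (S k) z \<partial>lborel) = J" for k
  proof -
    define t where "t = (1/2 :: real) ^ k"
    have t: "t > 0" by (simp add: t_def)
    have ind: "indicator (S k) (t *\<^sub>R z) = (indicator (S 0) z :: ennreal)" for z
      by (auto simp: S_def indicator_def t_def field_simps)
    have "(\<integral>\<^sup>+ z. ennreal (h z) * indicator (S k) z \<partial>lborel)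
      = ennreal (t ^ DIM('a)) * (\<integral>\<^sup>+ z. ennreal (h (t *\<^sub>R z)) * indicator (S k) (t *\<^sub>R z) \<partial>lborel)"
      by (rule nn_integral_scale[OF _ t]) measurable
    also have "\<dots> = (\<integral>\<^sup>+ z. ennreal (t ^ DIM('a)) * (ennreal (h (t *\<^sub>R z)) * indicator (S k) (t *\<^sub>R z)) \<partial>lborel)"
      by (rule nn_integral_cmult[symmetric]) measurable
    also have "\<dots> = J" unfolding J_def
    proof (rule nn_integral_cong)
      fix z
      have "ennreal (t ^ DIM('a)) * ennreal (h (t *\<^sub>R z)) = ennreal (h z)"
        using t h0[of z] by (simp add: hom[OF t] flip: ennreal_mult)
      thus "ennreal (t ^ DIM('a)) * (ennreal (h (t *\<^sub>R z)) * indicator (S k) (t *\<^sub>R z)) =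
          ennreal (h z) * indicator (S 0) z" by (simp add: ind flip: mult.assoc)
    qed
    finally show ?thesis .
  qed
  \<comment> \<open>Otherwise positivity almost everywhere would make the nonempty open interior of
    the shell negligible.\<close>
  have "J \<noteq> 0"
  proof
    assume "J = 0"
    hence "AE z in lborel. ennreal (h z) * indicator (S 0) z = 0"
      unfolding J_def by (subst (asm) nn_integral_0_iff_AE) auto
    with pos have "AE z::'a in lborel. z \<notin> ball 0 r - cball 0 (r / 2)"
      by eventually_elim (auto simp: S_def indicator_def split: if_splits)
    hence "ball 0 r - cball 0 (r / 2) \<in> null_sets (lborel :: 'a measure)"
      by (subst (asm) AE_iff_null_sets[symmetric]) auto
    hence "negligible (ball 0 r - cball 0 (r / 2) :: 'a set)"
      by (simp add: negligible_iff_null_sets null_sets_completionI)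
    moreover have "open (ball 0 r - cball 0 (r / 2) :: 'a set)" by auto
    moreover obtain x :: 'a where "norm x = 3 * r / 4"
      using vector_choose_size[of "3 * r / 4"] r by auto
    hence "x \<in> ball 0 r - cball 0 (r / 2)" using r by (simp add: dist_norm)
    ultimately show False using open_not_negligible by blast
  qed
  hence "(suminf (\<lambda>k. J)) = \<infinity>" 
    by (simp add: suminf_eq_SUP ennreal_SUP_of_nat_eq_top ennreal_top_mult flip: SUP_mult_right_ennreal)
  also have "(suminf (\<lambda>k::nat. J)) = (suminf (\<lambda>k. \<integral>\<^sup>+ z. ennreal (h z) * indicator (S k) z \<partial>lborel))" by (simp add: shell)
  finally have inf: "(suminf (\<lambda>k. \<integral>\<^sup>+ z. ennreal (h z) * indicator (S k) z \<partial>lborel)) = \<infinity>" .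
  also have "(suminf (\<lambda>k. \<integral>\<^sup>+ z. ennreal (h z) * indicator (S k) z \<partial>lborel)) =
      (\<integral>\<^sup>+ z. (suminf (\<lambda>k. ennreal (h z) * indicator (S k) z)) \<partial>lborel)"
    by (rule nn_integral_suminf[symmetric]) measurable
  finally have inf: "(\<integral>\<^sup>+ z. (suminf (\<lambda>k. ennreal (h z) * indicator (S k) z)) \<partial>lborel) = \<infinity>"
    using inf by simp
  have disj: "disjoint_family S"
    unfolding disjoint_family_on_def
  proof (intro ballI impI)
    have *: "S j \<inter> S k = {}" if "j < k" for j k
    proof -
      have "r / 2 ^ k \<le> r / 2 ^ Suc j" using that r by (intro divide_left_mono power_increasing) auto
      thus ?thesis by (auto simp: S_def)
    qed
    fix j k :: nat assume "j \<noteq> k"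
    thus "S j \<inter> S k = {}" using *[of j k] *[of k j] by (cases j k rule: linorder_cases) auto
  qed
  have sub: "(\<Union>k. S k) \<subseteq> ball 0 r"
  proof
    fix z assume "z \<in> (\<Union>k. S k)"
    then obtain k where "norm z < r / 2 ^ k" by (auto simp: S_def)
    also have "r / 2 ^ k \<le> r / 1" using r by (intro divide_left_mono) auto
    finally show "z \<in> ball 0 r" by simp
  qed
  have "(suminf (\<lambda>k. ennreal (h z) * indicator (S k) z)) \<le> ennreal (h z) * indicator (ball 0 r) z" for z
  proof -
    have "(suminf (\<lambda>k. ennreal (h z) * indicator (S k) z)) = ennreal (h z) * indicator (\<Union>k. S k) z"
      using suminf_indicator[OF disj, of z] by (simp add: ennreal_suminf_cmult)
    also have "\<dots> \<le> ennreal (h z) * indicator (ball 0 r) z"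
      using subsetD[OF sub, of z] by (intro mult_left_mono) (simp_all add: indicator_def)
    finally show ?thesis .
  qed
  hence "(\<integral>\<^sup>+ z. (suminf (\<lambda>k. ennreal (h z) * indicator (S k) z)) \<partial>lborel) \<le>
      (\<integral>\<^sup>+ z. ennreal (h z) * indicator (ball 0 r) z \<partial>lborel)"
    by (intro nn_integral_mono)
  thus ?thesis using inf by (simp add: top_unique)
qed

section \<open>Non-vanishing of the numerator at the barycentre\<close>

context continued_arrangement
begin

definition centre_vec :: "complex ^ 'r" where
  "centre_vec = (\<chi> i. of_real (centre i))"

text \<open>The sign is reversed so that the integral converges for \<tau> far to the left, as in
  \<open>landau_convergence\<close>; at \<open>\<tau> = 1\<close> the exponents add up to
  \<open>-n\<close>.\<close>

definition anti :: "complex \<Rightarrow> complex ^ 'r" where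
  "anti \<tau> = \<tau> *s (- centre_vec)"

lemma anti_nth [simp]: "anti \<tau> $ i = - (\<tau> * of_real (centre i))"
  by (simp add: anti_def centre_vec_def)

lemma sum_centre_pos: "T \<noteq> {} \<Longrightarrow> sum centre T > 0"
  by (intro sum_pos centre_pos) auto

lemma fac_anti: "fac T d (anti \<tau>) = of_real (real (rk T + d)) - \<tau> * of_real (sum centre T)"
  by (simp add: fac_def sum_negf sum_distrib_left)

text \<open>For the full set \<open>sum centre UNIV\<close> equals the rank, and
  \<open>d \<ge> 1\<close> supplies the strictness; for other sets it comes from the rank
  condition.\<close>

lemma sum_centre_less_factor:
  assumes "\<And>T. T \<noteq> {} \<Longrightarrow> T \<noteq> UNIV \<Longrightarrow> rk T + rk (-T) \<noteq> CARD('n)"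
    and "T \<noteq> {}" "T = UNIV \<Longrightarrow> d \<ge> 1"
  shows "sum centre T < real (rk T + d)"
proof (cases "T = UNIV")
  case True
  thus ?thesis using sum_centre_UNIV assms(3) rk_UNIV by simp
next
  case False
  thus ?thesis using sum_centre_less[OF assms(1)[OF assms(2)]] by simp
qed

lemma fac_anti_nonzero:
  assumes "T \<noteq> {}" "Re \<tau> < real (rk T + d) / sum centre T"
  shows "fac T d (anti \<tau>) \<noteq> 0"
proof
  assume "fac T d (anti \<tau>) = 0"
  hence "Re (\<tau> * of_real (sum centre T)) = Re (of_real (real (rk T + d)))"
    unfolding fac_anti by (simp only: eq_iff_diff_eq_0[symmetric])
  thus False using assms sum_centre_pos[OF assms(1)] by (simp add: field_simps)
qed

text \<open>Each factor is affine in \<tau> with the real root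
  \<open>(rk T + d) / sum centre T > 1\<close>, and there are finitely many factors.\<close>

lemma ev_anti_nonzero:
  assumes irr: "\<And>T. T \<noteq> {} \<Longrightarrow> T \<noteq> UNIV \<Longrightarrow> rk T + rk (-T) \<noteq> CARD('n)"
    and "admissible L"
  shows "\<exists>\<beta>>1. \<forall>\<tau>. Re \<tau> < \<beta> \<longrightarrow> ev L (anti \<tau>) \<noteq> 0"
  using assms(2)
proof (induction L)
  case empty
  show ?case by (intro exI[of _ 2]) auto
next
  case (add x L)
  obtain T d where x: "x = (T, d)" by (cases x)
  obtain \<beta> where \<beta>: "\<beta> > 1" "\<And>\<tau>. Re \<tau> < \<beta> \<Longrightarrow> ev L (anti \<tau>) \<noteq> 0" using add by (auto simp: x)
  have T: "T \<noteq> {}" "T = UNIV \<Longrightarrow> d \<ge> 1" using add.prems by (auto simp: x)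
  have "real (rk T + d) / sum centre T > 1"
    using sum_centre_less_factor[OF irr T] sum_centre_pos[OF T(1)] by simp
  moreover have "ev (add_mset x L) (anti \<tau>) \<noteq> 0" if "Re \<tau> < min \<beta> (real (rk T + d) / sum centre T)" for \<tau>
    using that \<beta>(2)[of \<tau>] fac_anti_nonzero[OF T(1), of \<tau> d] by (simp add: x)
  ultimately show ?case using \<beta>(1)
    by (intro exI[of _ "min \<beta> (real (rk T + d) / sum centre T)"]) auto
qed

lemma anti_orthant:
  assumes "anti 1 \<in> orthant (-(real K/2))"
  shows "\<exists>\<beta>>1. \<forall>\<tau>. Re \<tau> < \<beta> \<longrightarrow> anti \<tau> \<in> orthant (-(real K/2))"
proof (intro exI conjI allI impI)
  let ?\<beta> = "Min (range (\<lambda>i. real K / (2 * centre i)))"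
  have "real K / (2 * centre i) > 1" for i
    using assms centre_pos[of i] by (auto simp: orthant_def field_simps dest!: spec[of _ i])
  thus "?\<beta> > 1" by simp
  fix \<tau> :: complex assume \<tau>: "Re \<tau> < ?\<beta>"
  show "anti \<tau> \<in> orthant (-(real K/2))"
    unfolding orthant_def
  proof (intro CollectI allI)
    fix i
    have "?\<beta> \<le> real K / (2 * centre i)" by (rule Min_le) auto
    hence "Re \<tau> < real K / (2 * centre i)" using \<tau> by linarith
    thus "-(real K/2) < Re (anti \<tau> $ i)" using centre_pos[of i] by (simp add: field_simps)
  qed
qed

lemma cdiff_anti_holomorphic:
  assumes "\<And>\<tau>. \<tau> \<in> S \<Longrightarrow> cdiff_at F (anti \<tau>)"
  shows "(\<lambda>\<tau>. F (anti \<tau>)) holomorphic_on S"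
  using cdiff_line_holomorphic[of S F 0 "- centre_vec"] assms by (simp add: anti_def)

definition centre_density :: "complex ^ 'n \<Rightarrow> real" where
  "centre_density z = (\<Prod>i\<in>UNIV. norm (lform (c i) z) powr (- 2 * centre i))"

lemma centre_density_not_integrable:
  assumes "r > 0"
  shows "(\<integral>\<^sup>+ z. ennreal (centre_density z) * indicator (ball 0 r) z \<partial>lborel) = \<infinity>"
proof (rule homogeneous_not_integrable[OF _ _ _ _ assms])
  show "centre_density \<in> borel_measurable borel" unfolding centre_density_def by measurable
  show "centre_density z \<ge> 0" for z unfolding centre_density_def by (intro prod_nonneg) auto
  have "AE z in lborel. lform (c i) z \<noteq> 0" for i
    using AE_not_in[OF negligible_lform_zeros[OF c_nonzero, of i]] by simp
  hence "AE z in lborel. \<forall>i\<in>UNIV. lform (c i) z \<noteq> 0" by (subst AE_ball_countable) auto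
  thus "AE z in lborel. centre_density z > 0"
    by eventually_elim (auto simp: centre_density_def intro!: prod_pos)
  fix t :: real and z :: "complex ^ 'n" assume t: "t > 0"
  have "centre_density (t *\<^sub>R z) = (\<Prod>i\<in>UNIV. t powr (- 2 * centre i) * norm (lform (c i) z) powr (- 2 * centre i))"
    unfolding centre_density_def using t by (intro prod.cong refl) (simp add: norm_mult powr_mult)
  also have "\<dots> = (\<Prod>i\<in>UNIV. t powr (- 2 * centre i)) * centre_density z"
    by (simp add: centre_density_def prod.distrib)
  also have "(\<Prod>i\<in>UNIV. t powr (- 2 * centre i)) = t powr (\<Sum>i\<in>UNIV. - 2 * centre i)"
    using t by (subst powr_sum) auto
  also have "(\<Sum>i\<in>UNIV. - 2 * centre i) = - 2 * sum centre UNIV"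
    by (simp only: sum_distrib_left)
  also have "\<dots> = - real (DIM(complex ^ 'n))" by (simp add: sum_centre_UNIV)
  also have "t powr (- real (DIM(complex ^ 'n))) = 1 / t ^ DIM(complex ^ 'n)"
    using t by (subst powr_minus) (simp only: powr_realpow inverse_eq_divide)
  finally show "centre_density (t *\<^sub>R z) = centre_density z / t ^ DIM(complex ^ 'n)" by simp
qed

text \<open>A zero of the numerator at \<open>\<tau> = 1\<close> would cancel the simple zero of
  \<open>dimn - \<tau> * dimn\<close>, and the integral would continue to some
  \<open>\<beta> > 1\<close>; Landau's theorem then contradicts the divergence at the
  origin.\<close>

lemma RR_centre_nonzero:
  assumes irr: "\<And>T. T \<noteq> {} \<Longrightarrow> T \<noteq> UNIV \<Longrightarrow> rk T + rk (-T) \<noteq> CARD('n)"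
    and pos: "\<And>z. \<phi> z \<ge> 0" and \<phi>0: "\<phi> 0 > 0"
    and K: "anti 1 \<in> orthant (-(real K/2))"
  shows "RR K (anti 1) \<noteq> 0"
proof
  assume zero: "RR K (anti 1) = 0"
  obtain \<beta>1 where \<beta>1: "\<beta>1 > 1" "\<And>\<tau>. Re \<tau> < \<beta>1 \<Longrightarrow> ev (LL K) (anti \<tau>) \<noteq> 0"
    using ev_anti_nonzero[OF irr admissible_LL, of K] by blast
  obtain \<beta>2 where \<beta>2: "\<beta>2 > 1" "\<And>\<tau>. Re \<tau> < \<beta>2 \<Longrightarrow> anti \<tau> \<in> orthant (-(real K/2))"
    using anti_orthant[OF K] by blast
  define \<beta> where "\<beta> = min \<beta>1 \<beta>2"
  have \<beta>: "\<beta> > 1" using \<beta>1 \<beta>2 by (simp add: \<beta>_def)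
  \<comment> \<open>The continuation of the integral times \<open>dimn - \<tau> * dimn\<close>. Up
    to \<beta> the factors do not vanish and the exponents stay in the orthant.\<close>
  define Q where "Q \<tau> = RR K (anti \<tau>) / ev (LL K) (anti \<tau>)" for \<tau>
  have Q: "Q holomorphic_on {\<tau>. Re \<tau> < \<beta>}"
    unfolding Q_def[abs_def]
    by (intro holomorphic_on_divide cdiff_anti_holomorphic cdiff_RR cdiff_at_ev) (use \<beta>1 \<beta>2 in \<open>auto simp: \<beta>_def\<close>)
  \<comment> \<open>The difference quotient of \<open>Q\<close> at 1 with the removable singularity
    filled in. As \<open>Q 1 = 0\<close>, it is the integral up to the constant
    \<open>- dimn\<close>.\<close>
  define G where "G \<tau> = (if \<tau> = 1 then deriv Q 1 else (Q \<tau> - Q 1) / (\<tau> - 1))" for \<tau>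
  have G: "G holomorphic_on {\<tau>. Re \<tau> < \<beta>}"
    unfolding G_def by (rule pole_lemma_open[OF Q open_halfspace_Re_lt])
  have dimn0: "dimn \<noteq> 0" by (simp add: dimn_eq)
  \<comment> \<open>At least every \<open>1 / centre i\<close>, so that
    \<open>Re \<tau> < - m\<close> puts \<open>anti \<tau>\<close> into
    \<open>orthant 1\<close>.\<close>
  define m where "m = (\<Sum>i\<in>UNIV. 1 / centre i)"
  have m: "m > 0" unfolding m_def by (intro sum_pos) (auto simp: centre_pos)
  have G_zint: "zint (anti \<tau>) \<phi> = - G \<tau> / dimn" "anti \<tau> \<in> orthant 1" if \<tau>: "Re \<tau> < - m" for \<tau>
  proof -
    show anti: "anti \<tau> \<in> orthant 1"
      unfolding orthant_def
    proof (intro CollectI allI)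
      fix i
      have "1 / centre i \<le> m"
        unfolding m_def by (rule member_le_sum) (auto simp: centre_pos less_imp_le)
      hence "1 / centre i < - Re \<tau>" using \<tau> by linarith
      thus "1 < Re (anti \<tau> $ i)" using centre_pos[of i] by (simp add: field_simps)
    qed
    have ev0: "ev (LL K) (anti \<tau>) \<noteq> 0" using \<beta>1 \<tau> m by (intro \<beta>1(2)) auto
    have \<tau>1: "\<tau> \<noteq> 1" using \<tau> m by auto
    have "(\<Sum>i\<in>UNIV. anti \<tau> $ i) = - \<tau> * dimn"
      using sum_centre_UNIV by (simp add: sum_negf dimn_eq flip: sum_distrib_left of_real_sum)
    hence "ev (LL K) (anti \<tau>) * (dimn - \<tau> * dimn) * zint (anti \<tau>) \<phi> = RR K (anti \<tau>)"
      using RR_eq[OF anti, of K] by (simp add: dimn_eq)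
    hence "Q \<tau> = (dimn - \<tau> * dimn) * zint (anti \<tau>) \<phi>"
      using ev0 by (simp add: Q_def field_simps)
    moreover have "Q 1 = 0" by (simp add: Q_def zero)
    moreover have "G \<tau> * (\<tau> - 1) = Q \<tau> - Q 1" using \<tau>1 by (simp add: G_def)
    ultimately have "G \<tau> * (\<tau> - 1) = - dimn * zint (anti \<tau>) \<phi> * (\<tau> - 1)"
      by (simp add: algebra_simps)
    hence "G \<tau> = - dimn * zint (anti \<tau>) \<phi>"
      by (subst (asm) mult_right_cancel) (use \<tau>1 in auto)
    thus "zint (anti \<tau>) \<phi> = - G \<tau> / dimn" using dimn0 by simp
  qed
  obtain R where R: "\<And>z. \<phi> z \<noteq> 0 \<Longrightarrow> norm z \<le> R" using test by (auto simp: test_function_iff)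
  have "\<exists>B>0. \<forall>z. norm (lform (c i) z) \<le> norm z * B" for i
    using bounded_linear.pos_bounded[OF bounded_linear_lform] by blast
  then obtain B where B: "\<And>i. B i > 0" "\<And>i z. norm (lform (c i) z) \<le> norm z * B i" by metis
  \<comment> \<open>An upper bound for
    \<open>\<Sum>i\<in>UNIV. 2 * centre i * ln (norm (lform (c i) z))\<close> on the support of
    \<phi>, off the hyperplanes. Adding it makes \<open>lam\<close> nonnegative; the price is the
    harmless factor \<open>exp (\<tau> * of_real C)\<close>.\<close>
  define C where "C = (\<Sum>i\<in>UNIV. 2 * centre i * (\<bar>R\<bar> * B i))"
  \<comment> \<open>The values on the hyperplanes, where the logarithms in \<open>lam\<close> have
    no meaning, are set to 0; \<open>wt 0\<close> detects these points.\<close>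
  define w where "w z = (if wt 0 z = 0 then 0 else Re (\<phi> z))" for z
  define lam where "lam z = (if w z = 0 then 0 else C + (\<Sum>i\<in>UNIV. - 2 * centre i * ln (norm (lform (c i) z))))" for z
  have \<phi>_real: "of_real (Re (\<phi> z)) = \<phi> z" "Re (\<phi> z) \<ge> 0" for z
    using pos[of z] by (auto simp: less_eq_complex_def complex_eq_iff)
  have w0: "w z \<ge> 0" for z using \<phi>_real by (simp add: w_def)
  have lam0: "lam z \<ge> 0" for z
  proof (cases "w z = 0")
    case False
    hence "wt 0 z \<noteq> 0" "\<phi> z \<noteq> 0" by (auto simp: w_def split: if_splits)
    hence nz: "lform (c i) z \<noteq> 0" and nR: "norm z \<le> \<bar>R\<bar>" for i using R[of z] by (auto simp: wt_eq_0_iff)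
    have "(\<Sum>i\<in>UNIV. 2 * centre i * ln (norm (lform (c i) z))) \<le> C"
      unfolding C_def
    proof (intro sum_mono mult_left_mono)
      fix i
      have "ln (norm (lform (c i) z)) \<le> norm (lform (c i) z)"
        using ln_le_minus_one[of "norm (lform (c i) z)"] nz[of i] by simp
      also have "\<dots> \<le> \<bar>R\<bar> * B i" using B(2)[of i z] mult_right_mono[OF nR, of "B i"] B(1)[of i] by linarith
      finally show "ln (norm (lform (c i) z)) \<le> \<bar>R\<bar> * B i" .
    qed (use centre_pos in \<open>auto intro: less_imp_le\<close>)
    thus ?thesis using False by (simp add: lam_def sum_negf)
  qed (simp add: lam_def)
  note [measurable] = borel_measurable_test[OF test]
  have [measurable]: "w \<in> borel_measurable borel" unfolding w_def by measurable
  have [measurable]: "lam \<in> borel_measurable borel" unfolding lam_def by measurable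
  have intw: "integrable lborel w"
  proof (rule Bochner_Integration.integrable_bound[OF integrable_compact_support[OF test_function_continuous[OF test] R]])
    show "AE z in lborel. norm (w z) \<le> norm (\<phi> z)"
      using abs_Re_le_cmod by (auto simp: w_def)
  qed auto
  have exp_lam: "exp (\<tau> * of_real (lam z)) = exp (\<tau> * of_real C) * wt (anti \<tau>) z" if "w z \<noteq> 0" for z \<tau>
  proof -
    have nz: "lform (c i) z \<noteq> 0" for i using that by (auto simp: w_def wt_eq_0_iff split: if_splits)
    have "wt (anti \<tau>) z = exp (\<Sum>i\<in>UNIV. - (2 * \<tau> * of_real (centre i) * of_real (ln (norm (lform (c i) z)))))"
      unfolding wt_def by (simp add: abs_powr_exp nz exp_sum mult_ac)
    also have "(\<Sum>i\<in>UNIV. - (2 * \<tau> * of_real (centre i) * of_real (ln (norm (lform (c i) z))))) =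
        \<tau> * of_real (\<Sum>i\<in>UNIV. - 2 * centre i * ln (norm (lform (c i) z)))"
      by (simp add: sum_distrib_left mult_ac)
    finally show ?thesis using that by (simp add: lam_def distrib_left flip: exp_add)
  qed
  have "(\<integral>\<^sup>+ z. ennreal (w z * exp (lam z)) \<partial>lborel) < \<infinity>"
  proof (rule landau_convergence[where m = m and \<beta> = \<beta> and g = "\<lambda>\<tau>. exp (\<tau> * of_real C) * (- G \<tau> / dimn)"])
    show "(\<lambda>\<tau>. exp (\<tau> * of_real C) * (- G \<tau> / dimn)) holomorphic_on {\<tau>. Re \<tau> < \<beta>}"
      using dimn0 by (intro holomorphic_intros G) auto
    fix \<tau> :: complex assume \<tau>: "Re \<tau> < - m"
    have "exp (\<tau> * of_real C) * (- G \<tau> / dimn) = (LINT z|lborel. exp (\<tau> * of_real C) * (wt (anti \<tau>) z * \<phi> z))"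
      unfolding G_zint(1)[OF \<tau>, symmetric] by (simp add: zint_def)
    also have "\<dots> = (LINT z|lborel. of_real (w z) * exp (\<tau> * of_real (lam z)))"
    proof (rule Bochner_Integration.integral_cong[OF refl])
      fix z
      show "exp (\<tau> * of_real C) * (wt (anti \<tau>) z * \<phi> z) = of_real (w z) * exp (\<tau> * of_real (lam z))"
      proof (cases "w z = 0")
        case True
        hence "wt (anti \<tau>) z = 0 \<or> \<phi> z = 0"
          using \<phi>_real(1)[of z] by (auto simp: w_def wt_eq_0_iff split: if_splits)
        thus ?thesis using True by auto
      next
        case False
        hence "of_real (w z) = \<phi> z" using \<phi>_real(1)[of z] by (auto simp: w_def split: if_splits)
        thus ?thesis by (simp add: exp_lam[OF False])
      qed
    qed
    finally show "exp (\<tau> * of_real C) * (- G \<tau> / dimn) = (LINT z|lborel. of_real (w z) * exp (\<tau> * of_real (lam z)))" .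
  qed (use w0 lam0 intw m \<beta> in auto)
  note finite = this
  \<comment> \<open>By continuity \<open>Re (\<phi> z) > c0\<close> on a ball around 0, where the
    finite integral therefore dominates a multiple of that of \<open>centre_density\<close>.\<close>
  define c0 where "c0 = Re (\<phi> 0) / 2"
  have c0: "c0 > 0" using \<phi>0 by (simp add: c0_def less_complex_def)
  have "continuous_on UNIV (\<lambda>z. Re (\<phi> z))" by (intro continuous_intros test_function_continuous test)
  hence "open ((\<lambda>z. Re (\<phi> z)) -` {c0<..})" by (intro open_vimage) auto
  moreover have "0 \<in> (\<lambda>z. Re (\<phi> z)) -` {c0<..}" using c0 by (simp add: c0_def)
  ultimately obtain r where r: "r > 0" "ball 0 r \<subseteq> (\<lambda>z. Re (\<phi> z)) -` {c0<..}"
    using open_contains_ball by blast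
  have le: "ennreal (centre_density z) * indicator (ball 0 r) z \<le>
      ennreal (1 / (c0 * exp C)) * ennreal (w z * exp (lam z))" for z
  proof (cases "z \<in> ball 0 r \<and> wt 0 z \<noteq> 0")
    case True
    hence wz: "w z = Re (\<phi> z)" "w z > c0" using r(2) by (auto simp: w_def)
    have nz: "lform (c i) z \<noteq> 0" for i using True by (auto simp: wt_eq_0_iff)
    have "exp (lam z) = exp C * centre_density z"
      using wz c0 nz by (simp add: lam_def centre_density_def powr_def exp_add exp_sum mult_ac)
    hence "centre_density z = 1 / (c0 * exp C) * (c0 * exp (lam z))" using c0 by simp
    also have "\<dots> \<le> 1 / (c0 * exp C) * (w z * exp (lam z))"
      using wz c0 by (intro mult_left_mono mult_right_mono) auto
    finally have "ennreal (centre_density z) \<le> ennreal (1 / (c0 * exp C) * (w z * exp (lam z)))" by (rule ennreal_leI)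
    also have "\<dots> = ennreal (1 / (c0 * exp C)) * ennreal (w z * exp (lam z))"
      using c0 w0[of z] by (intro ennreal_mult) auto
    finally show ?thesis using True by simp
  next
    case False
    hence "centre_density z = 0 \<or> z \<notin> ball 0 r" by (auto simp: wt_eq_0_iff centre_density_def)
    thus ?thesis by auto
  qed
  have "(\<infinity>::ennreal) \<le> (\<integral>\<^sup>+ z. ennreal (1 / (c0 * exp C)) * ennreal (w z * exp (lam z)) \<partial>lborel)"
    unfolding centre_density_not_integrable[OF r(1), symmetric] by (intro nn_integral_mono le)
  also have "\<dots> = ennreal (1 / (c0 * exp C)) * (\<integral>\<^sup>+ z. ennreal (w z * exp (lam z)) \<partial>lborel)"
    by (rule nn_integral_cmult) measurable
  also have "\<dots> < \<infinity>" using finite by (simp add: ennreal_mult_less_top)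
  finally show False by simp
qed

theorem generic_nonempty:
  assumes irr: "\<And>T. T \<noteq> {} \<Longrightarrow> T \<noteq> UNIV \<Longrightarrow> rk T + rk (-T) \<noteq> CARD('n)"
    and pos: "\<And>z. \<phi> z \<ge> 0" and \<phi>0: "\<phi> 0 > 0"
  shows "generic \<noteq> {}"
proof -
  \<comment> \<open>Scaled so that multiplication by \<open>- dimn\<close> gives
    \<open>anti 1\<close>.\<close>
  let ?a = "(1 / dimn) *s centre_vec"
  have dimn0: "dimn \<noteq> 0" by (simp add: dimn_eq)
  have eq: "(- dimn) *s ?a = anti 1" using dimn0 by (simp add: vec_eq_iff centre_vec_def)
  have "(\<Sum>i\<in>UNIV. ?a $ i) = (1 / dimn) * of_real (sum centre UNIV)"
    by (simp add: centre_vec_def sum_distrib_left sum_divide_distrib)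
  also have "\<dots> = 1" using dimn0 by (simp add: sum_centre_UNIV dimn_eq)
  finally have "?a \<in> hyper" by (simp only: hyper_def mem_Collect_eq)
  moreover have "regular (anti 1)"
    unfolding regular_def
  proof (intro allI impI)
    fix T :: "'r set" and d :: nat assume T: "T \<noteq> {}" "T = UNIV \<longrightarrow> 1 \<le> d"
    show "fac T d (anti 1) \<noteq> 0"
      by (rule fac_anti_nonzero[OF T(1)])
        (use sum_centre_less_factor[OF irr T(1), of d] T(2) sum_centre_pos[OF T(1)] in simp)
  qed
  ultimately have "?a \<in> generic"
    unfolding generic_def eq mem_Collect_eq using RR_centre_nonzero[OF irr pos \<phi>0] eq by simp
  thus ?thesis by blast
qed

end

section \<open>Evaluation of polynomials\<close>

lemma eval_in_superset:
  assumes "finite S" "Poly_Mapping.keys p \<subseteq> S" "h 0 = 0"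
  shows "eval_in h x p = (\<Sum>m\<in>S. h (Poly_Mapping.lookup p m) * (\<Prod>i\<in>UNIV. x i ^ Poly_Mapping.lookup m i))"
  unfolding eval_in_def
  by (rule sum.mono_neutral_left) (use assms in \<open>auto simp: in_keys_iff\<close>)

text \<open>Treats \<open>peval\<close> and \<open>lin_subst\<close> together: they are
  \<open>eval_in\<close> for the structure maps identity and \<open>Const\<close>.\<close>

locale algebra_eval =
  fixes h :: "complex \<Rightarrow> 'b::comm_ring_1" and x :: "'n::finite \<Rightarrow> 'b"
  assumes h_0: "h 0 = 0" and h_1: "h 1 = 1" and h_add: "h (a + b) = h a + h b" and h_mult: "h (a * b) = h a * h b"
begin

lemma add: "eval_in h x (p + q) = eval_in h x p + eval_in h x q"
proof -
  let ?S = "Poly_Mapping.keys p \<union> Poly_Mapping.keys q"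
  show ?thesis
    using keys_add[of p q]
    by (simp add: eval_in_superset[of ?S] h_0 h_add lookup_add distrib_right sum.distrib)
qed

lemma zero: "eval_in h x 0 = 0"
  by (simp add: eval_in_def)

lemma sum: "eval_in h x (sum g A) = (\<Sum>y\<in>A. eval_in h x (g y))"
  by (induction A rule: infinite_finite_induct) (simp_all add: add zero)

lemma single: "eval_in h x (Poly_Mapping.single m a) = h a * (\<Prod>i\<in>UNIV. x i ^ Poly_Mapping.lookup m i)"
  by (subst eval_in_superset[of "{m}"]) (auto simp: h_0)

lemma const: "eval_in h x (Const a) = h a"
  by (simp add: Const_def single)

lemma var: "eval_in h x (Var i) = x i"
proof -
  have "(\<Prod>j\<in>UNIV. x j ^ Poly_Mapping.lookup (Poly_Mapping.single i (1::nat)) j) = (\<Prod>j\<in>UNIV. if j = i then x j else 1)"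
    by (rule prod.cong) (auto simp: lookup_single when_def)
  thus ?thesis by (simp add: Var_def single h_1)
qed

lemma mult: "eval_in h x (p * q) = eval_in h x p * eval_in h x q"
proof -
  have s: "eval_in h x (Poly_Mapping.single m a * Poly_Mapping.single l b) =
      eval_in h x (Poly_Mapping.single m a) * eval_in h x (Poly_Mapping.single l b)" for m l a b
    by (simp add: mult_single single h_mult lookup_add power_add prod.distrib mult_ac)
  let ?a = "\<lambda>m. Poly_Mapping.single m (Poly_Mapping.lookup p m)"
  let ?b = "\<lambda>m. Poly_Mapping.single m (Poly_Mapping.lookup q m)"
  have p: "p = sum ?a (Poly_Mapping.keys p)" and q: "q = sum ?b (Poly_Mapping.keys q)"
    by (rule cpoly_sum_monomials)+
  have "eval_in h x (sum ?a (Poly_Mapping.keys p) * sum ?b (Poly_Mapping.keys q)) =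
      eval_in h x (sum ?a (Poly_Mapping.keys p)) * eval_in h x (sum ?b (Poly_Mapping.keys q))"
    by (simp add: sum_product sum s)
  thus ?thesis by (simp flip: p q)
qed

lemma one: "eval_in h x 1 = 1"
  using const[of 1] by (simp add: h_1 Const_def flip: single_one)

lemma prod: "eval_in h x (prod g A) = (\<Prod>y\<in>A. eval_in h x (g y))"
  by (induction A rule: infinite_finite_induct) (simp_all add: mult one)

lemma power: "eval_in h x (p ^ k) = eval_in h x p ^ k"
  by (induction k) (simp_all add: mult one)

end

lemma Const_simps [simp]: "Const 0 = 0" "Const 1 = 1" "Const (a + b) = Const a + Const b" "Const (a * b) = Const a * Const b"
  by (simp_all add: Const_def single_add mult_single flip: single_one)

lemma Const_sum: "Const (sum g A) = (\<Sum>x\<in>A. Const (g x))"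
  by (induction A rule: infinite_finite_induct) simp_all

interpretation peval_eval: algebra_eval "\<lambda>c. c" "\<lambda>i. z $ i" for z
  by unfold_locales auto

interpretation lin_subst_eval: algebra_eval Const "\<lambda>i. \<Sum>j\<in>UNIV. Const (L $ i $ j) * Var j" for L
  by unfold_locales auto

lemmas peval_simps [simp] =
  peval_eval.add[folded peval_def] peval_eval.zero[folded peval_def] peval_eval.one[folded peval_def]
  peval_eval.mult[folded peval_def] peval_eval.const[folded peval_def] peval_eval.var[folded peval_def]
  peval_eval.prod[folded peval_def] peval_eval.power[folded peval_def] peval_eval.sum[folded peval_def]

lemma cpoly_induct [case_names Const Var add mult]:
  assumes "\<And>a. P (Const a)" "\<And>i. P (Var i)" "\<And>p q. P p \<Longrightarrow> P q \<Longrightarrow> P (p + q)" "\<And>p q. P p \<Longrightarrow> P q \<Longrightarrow> P (p * q)"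
  shows "P (p :: ('n::finite) cpoly)"
proof -
  have sum: "P (sum g A)" if "\<And>x. x \<in> A \<Longrightarrow> P (g x)" for g and A :: "'c set"
    using that by (induction A rule: infinite_finite_induct) (use assms(1)[of 0] assms(3) in auto)
  have power: "P (q ^ k)" if "P q" for q k
    using that by (induction k) (use assms(1)[of 1] assms(4) in auto)
  have prod: "P (prod g A)" if "\<And>x. x \<in> A \<Longrightarrow> P (g x)" for g and A :: "'c set"
    using that by (induction A rule: infinite_finite_induct) (use assms(1)[of 1] assms(4) in auto)
  have Var_power: "Var i ^ k = Poly_Mapping.single (Poly_Mapping.single i k) 1" for i :: 'n and k
    by (induction k) (simp_all add: Var_def mult_single flip: single_add)
  have prod_single: "(\<Prod>i\<in>A. Poly_Mapping.single (g i) (1::complex)) = Poly_Mapping.single (sum g A) 1"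
    for A :: "'n set" and g :: "'n \<Rightarrow> 'n \<Rightarrow>\<^sub>0 nat"
    by (induction A rule: infinite_finite_induct) (simp_all add: mult_single)
  have "P (Poly_Mapping.single m a)" for m a
  proof -
    have "(\<Sum>i\<in>UNIV. Poly_Mapping.single i (Poly_Mapping.lookup m i)) = m"
      by (rule poly_mapping_eqI) (simp add: lookup_sum lookup_single when_def)
    hence eq: "Poly_Mapping.single m a = Const a * (\<Prod>i\<in>UNIV. Var i ^ Poly_Mapping.lookup m i)"
      by (simp add: Var_power prod_single Const_def mult_single)
    show ?thesis unfolding eq by (rule assms(4)[OF assms(1) prod[OF power[OF assms(2)]]])
  qed
  thus ?thesis by (subst cpoly_sum_monomials) (rule sum)
qed

section \<open>Linear forms as polynomials; decomposability\<close>

definition linpoly :: "complex ^ 'n \<Rightarrow> ('n::finite) cpoly" where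
  "linpoly c = (\<Sum>j\<in>UNIV. Const (c $ j) * Var j)"

lemma peval_linpoly [simp]: "peval (linpoly c) z = lform c z"
  by (simp add: linpoly_def lform_def)

lemma linpoly_0 [simp]: "linpoly 0 = 0"
  by (simp add: linpoly_def)

lemma linpoly_eq_0_iff: "linpoly c = 0 \<longleftrightarrow> c = 0"
proof
  assume "linpoly c = 0"
  hence "lform c (axis j 1) = 0" for j by (metis peval_linpoly peval_simps(2))
  moreover have "lform c (axis j 1) = c $ j" for j
    by (simp add: lform_def axis_def if_distrib cong: if_cong)
  ultimately show "c = 0" by (simp add: vec_eq_iff)
qed simp

lemma homogeneous_1_linpoly:
  assumes "homogeneous 1 (p :: ('n::finite) cpoly)"
  shows "p = linpoly (\<chi> j. Poly_Mapping.lookup p (Poly_Mapping.single j 1))"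
proof -
  let ?s = "\<lambda>j::'n. Poly_Mapping.single j (1::nat)"
  have inj: "inj ?s" by (rule injI) (metis lookup_single_eq lookup_single_not_eq one_neq_zero)
  have sub: "Poly_Mapping.keys p \<subseteq> range ?s"
  proof
    fix m assume "m \<in> Poly_Mapping.keys p"
    hence 1: "(\<Sum>i\<in>UNIV. Poly_Mapping.lookup m i) = 1" using assms by (auto simp: homogeneous_def)
    then obtain j where j: "Poly_Mapping.lookup m j = 1" "\<And>i. i \<noteq> j \<Longrightarrow> Poly_Mapping.lookup m i = 0"
      using sum_eq_1_iff[of UNIV "Poly_Mapping.lookup m"] by auto
    have "m = ?s j" by (rule poly_mapping_eqI) (use j in \<open>auto simp: lookup_single when_def\<close>)
    thus "m \<in> range ?s" by blast
  qed
  have "p = (\<Sum>m\<in>range ?s. Poly_Mapping.single m (Poly_Mapping.lookup p m))"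
    by (subst cpoly_sum_monomials, rule sum.mono_neutral_left) (use sub in \<open>auto simp: in_keys_iff\<close>)
  also have "\<dots> = (\<Sum>j\<in>UNIV. Poly_Mapping.single (?s j) (Poly_Mapping.lookup p (?s j)))"
    using inj by (subst sum.reindex) auto
  finally show ?thesis by (simp add: linpoly_def Const_def Var_def mult_single)
qed

lemma lin_subst_linpoly: "lin_subst L (linpoly c) = linpoly (c v* L)"
proof -
  have "lin_subst L (linpoly c) = (\<Sum>i\<in>UNIV. Const (c $ i) * (\<Sum>j\<in>UNIV. Const (L $ i $ j) * Var j))"
    by (simp add: lin_subst_def linpoly_def lin_subst_eval.sum lin_subst_eval.mult lin_subst_eval.const lin_subst_eval.var)
  also have "\<dots> = (\<Sum>i\<in>UNIV. \<Sum>j\<in>UNIV. Const (L $ i $ j * c $ i) * Var j)"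
    by (simp add: sum_distrib_left mult_ac)
  also have "\<dots> = (\<Sum>j\<in>UNIV. \<Sum>i\<in>UNIV. Const (L $ i $ j * c $ i) * Var j)" by (rule sum.swap)
  also have "\<dots> = linpoly (c v* L)"
    by (simp add: linpoly_def vector_matrix_mult_def Const_sum sum_distrib_left mult_ac)
  finally show ?thesis .
qed

lemma vars_mult: "vars (p * q) \<subseteq> vars p \<union> vars (q :: ('n::finite) cpoly)"
proof
  fix k assume "k \<in> vars (p * q)"
  then obtain m where m: "m \<in> Poly_Mapping.keys (p * q)" "k \<in> Poly_Mapping.keys m" by (auto simp: vars_def)
  then obtain l l' where "m = l + l'" "l \<in> Poly_Mapping.keys p" "l' \<in> Poly_Mapping.keys q"
    using keys_mult[of p q] by blast
  thus "k \<in> vars p \<union> vars q" using m(2) keys_add[of l l'] by (auto simp: vars_def)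
qed

lemma vars_prod: "(\<And>x. x \<in> A \<Longrightarrow> vars (g x) \<subseteq> S) \<Longrightarrow> vars (prod g A :: ('n::finite) cpoly) \<subseteq> S"
proof (induction A rule: infinite_finite_induct)
  case (insert x A)
  thus ?case using vars_mult[of "g x" "prod g A"] by auto
qed (auto simp: vars_def)

lemma vars_linpoly: "vars (linpoly c) \<subseteq> {k. c $ k \<noteq> 0}"
proof
  fix k assume "k \<in> vars (linpoly c)"
  then obtain m where m: "m \<in> Poly_Mapping.keys (linpoly c)" "k \<in> Poly_Mapping.keys m" by (auto simp: vars_def)
  have "linpoly c = (\<Sum>j\<in>UNIV. Poly_Mapping.single (Poly_Mapping.single j 1) (c $ j))"
    by (simp add: linpoly_def Const_def Var_def mult_single)
  hence "Poly_Mapping.lookup (linpoly c) m = (\<Sum>j\<in>UNIV. c $ j when Poly_Mapping.single j 1 = m)"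
    by (simp add: lookup_sum lookup_single)
  moreover have "Poly_Mapping.lookup (linpoly c) m \<noteq> 0" using m(1) by (simp add: in_keys_iff)
  ultimately obtain j where "(c $ j when Poly_Mapping.single j 1 = m) \<noteq> 0"
    by (metis (no_types, lifting) sum.neutral)
  hence "c $ j \<noteq> 0" "Poly_Mapping.single j 1 = m" by (auto simp: when_def split: if_splits)
  thus "k \<in> {k. c $ k \<noteq> 0}" using m(2) by (auto split: if_splits)
qed

lemma prod_linpoly_not_constant:
  fixes d :: "'i \<Rightarrow> complex ^ 'n::{finite,linorder}"
  assumes "finite A" "A \<noteq> {}" "\<And>t. t \<in> A \<Longrightarrow> d t \<noteq> 0"
  shows "\<not> constant_poly (\<Prod>t\<in>A. linpoly (d t))"
proof
  assume "constant_poly (\<Prod>t\<in>A. linpoly (d t))"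
  then obtain a where a: "(\<Prod>t\<in>A. linpoly (d t)) = Const a" by (auto simp: constant_poly_def)
  have "peval (\<Prod>t\<in>A. linpoly (d t)) 0 = 0" using assms by (simp add: card_gt_0_iff)
  hence "a = 0" by (simp add: a)
  hence "(\<Prod>t\<in>A. linpoly (d t)) = 0" using a by simp
  thus False using assms by (simp add: linpoly_eq_0_iff)
qed

text \<open>If the ranks add up, the bases of \<open>T\<close> and of its complement together form a
  basis of the whole space. In the coordinates given by this basis the forms of \<open>T\<close>
  involve only variables in \<open>I\<close>, the others only variables outside.\<close>

lemma (in arrangement) coordinates_exist:
  assumes rank: "rk T + rk (-T) = CARD('n)"
  obtains L :: "complex ^ 'n ^ 'n" and I where "invertible L"
    "\<And>t k. t \<in> T \<Longrightarrow> k \<notin> I \<Longrightarrow> (c t v* L) $ k = 0" "\<And>t k. t \<notin> T \<Longrightarrow> k \<in> I \<Longrightarrow> (c t v* L) $ k = 0"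
proof -
  define B where "B = bas T \<union> bas (-T)"
  have disj: "bas T \<inter> bas (-T) = {}" using bas_subset[of T] bas_subset[of "-T"] by auto
  have "card B = CARD('n)" unfolding B_def using card_Un_disjoint[OF _ _ disj] rank by (simp add: rk_def)
  then obtain \<gamma> :: "'n \<Rightarrow> 'r" where \<gamma>: "bij_betw \<gamma> UNIV B"
    using finite_same_card_bij[of "UNIV :: 'n set" B] by auto
  \<comment> \<open>The rows are the adapted basis. They span, so \<open>X\<close> has an inverse
    \<open>L\<close>, and substituting \<open>L\<close> turns the basis forms into
    coordinates.\<close>
  define X where "X = (\<chi> j. c (\<gamma> j))"
  have rowX: "row j X = c (\<gamma> j)" for j by (simp add: row_def X_def vec_eq_iff)
  have BX: "c ` B \<subseteq> rows X" unfolding rows_def rowX using \<gamma> by (auto simp: bij_betw_def)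
  have "c t \<in> vec.span (rows X)" for t
  proof (cases "t \<in> T")
    case True
    hence "c t \<in> vec.span (c ` bas T)" using spans_by_bas[of T] by (auto simp: spans_by_def)
    thus ?thesis by (rule subsetD[OF vec.span_mono, rotated]) (use BX in \<open>auto simp: B_def\<close>)
  next
    case False
    hence "c t \<in> vec.span (c ` bas (-T))" using spans_by_bas[of "-T"] by (auto simp: spans_by_def)
    thus ?thesis by (rule subsetD[OF vec.span_mono, rotated]) (use BX in \<open>auto simp: B_def\<close>)
  qed
  hence "vec.span (range c) \<subseteq> vec.span (rows X)"
    by (intro vec.span_minimal vec.subspace_span) auto
  hence "vec.span (rows X) = UNIV" unfolding span_range by auto
  then obtain L where LX: "L ** X = mat 1" using matrix_left_invertible_span_rows_gen[of X] by blast
  hence XL: "X ** L = mat 1" using matrix_left_right_inverse by blast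
  have inv: "invertible L" using LX XL by (auto simp: invertible_def)
  have rowXL: "(c (\<gamma> j) v* L) $ k = (if j = k then 1 else 0)" for j k
  proof -
    have "(c (\<gamma> j) v* L) $ k = (X ** L) $ j $ k"
      by (simp add: X_def vector_matrix_mult_def matrix_matrix_mult_def mult.commute)
    thus ?thesis by (simp add: XL mat_def)
  qed
  have vanish: "(x v* L) $ k = 0" if x: "x \<in> vec.span (c ` S)" and S: "S \<subseteq> B" and k: "\<gamma> k \<notin> S" for x k S
    using x
  proof (induction rule: vec.span_induct_alt)
    case base
    show ?case by (simp add: vector_matrix_mult_def)
  next
    case (step a x y)
    then obtain i where i: "i \<in> S" "x = c i" by blast
    then obtain j where j: "i = \<gamma> j" using \<gamma> S by (auto simp: bij_betw_def)
    have "j \<noteq> k" using i j k by auto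
    hence "(x v* L) $ k = 0" by (simp add: i j rowXL)
    moreover have "((a *s x + y) v* L) $ k = a * ((x v* L) $ k) + (y v* L) $ k"
      by (simp add: vector_matrix_mult_def sum.distrib sum_distrib_left algebra_simps)
    ultimately show ?case using step by simp
  qed
  show ?thesis
  proof (rule that[OF inv, of "{k. \<gamma> k \<in> bas T}"])
    show "(c t v* L) $ k = 0" if "t \<in> T" "k \<notin> {k. \<gamma> k \<in> bas T}" for t k
      by (rule vanish[of _ "bas T"]) (use that spans_by_bas[of T] in \<open>auto simp: spans_by_def B_def\<close>)
    show "(c t v* L) $ k = 0" if "t \<notin> T" "k \<in> {k. \<gamma> k \<in> bas T}" for t k
      by (rule vanish[of _ "bas (-T)"]) (use that disj spans_by_bas[of "-T"] in \<open>auto simp: spans_by_def B_def\<close>)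
  qed
qed

text \<open>In adapted coordinates the product splits into the forms of \<open>T\<close> and the
  rest. Neither part is constant, as both index sets are nonempty and \<open>L\<close> keeps the
  forms nonzero.\<close>

lemma rank_sum_decomposable:
  fixes c :: "'r::finite \<Rightarrow> complex ^ 'n::{finite,linorder}"
  assumes "arrangement c" and T: "T \<noteq> {}" "T \<noteq> UNIV"
    and rank: "arrangement.rk c T + arrangement.rk c (-T) = CARD('n)"
  shows "decomposable (\<Prod>i\<in>UNIV. linpoly (c i))"
proof -
  interpret arrangement c by fact
  obtain L :: "complex ^ ('n::{finite,linorder}) ^ ('n::{finite,linorder})" and I where L: "invertible L"
    "\<And>t k. t \<in> T \<Longrightarrow> k \<notin> I \<Longrightarrow> (c t v* L) $ k = 0" "\<And>t k. t \<notin> T \<Longrightarrow> k \<in> I \<Longrightarrow> (c t v* L) $ k = 0"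
    using coordinates_exist[OF rank] by blast
  have nz: "c t v* L \<noteq> 0" for t
  proof
    assume 0: "c t v* L = 0"
    obtain L' where L': "L ** L' = mat 1" using L(1) by (auto simp: invertible_def)
    have "c t = c t v* (L ** L')" by (simp add: L')
    also have "\<dots> = (c t v* L) v* L'" by (rule vector_matrix_mul_assoc[symmetric])
    also have "\<dots> = 0" unfolding 0 by (simp add: vector_matrix_mult_def vec_eq_iff)
    finally show False using c_nonzero by blast
  qed
  let ?g = "\<Prod>t\<in>T. linpoly (c t v* L)" and ?h = "\<Prod>t\<in>-T. linpoly (c t v* L)"
  have "lin_subst L (\<Prod>i\<in>UNIV. linpoly (c i)) = (\<Prod>i\<in>UNIV. linpoly (c i v* L))"
    by (simp add: lin_subst_def lin_subst_eval.prod flip: lin_subst_linpoly)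
  also have "\<dots> = ?g * ?h"
    using prod.union_disjoint[of T "-T" "\<lambda>t. linpoly (c t v* L)"] by simp
  finally have "lin_subst L (\<Prod>i\<in>UNIV. linpoly (c i)) = ?g * ?h" .
  moreover have "\<not> constant_poly ?g" "\<not> constant_poly ?h"
    by (rule prod_linpoly_not_constant; use T nz in auto)+
  moreover have "vars ?g \<subseteq> I"
    by (rule vars_prod, rule order_trans[OF vars_linpoly]) (use L(2) in blast)
  moreover have "vars ?h \<subseteq> -I"
    by (rule vars_prod, rule order_trans[OF vars_linpoly]) (use L(3) in blast)
  ultimately show ?thesis
    unfolding decomposable_def
    by (intro exI[of _ L] exI[of _ ?g] exI[of _ ?h] conjI L(1)) auto
qed

section \<open>Existence of Bernstein-Sato polynomials\<close>

lemma map_poly_Const_mult: "map_poly Const (b * d) = map_poly Const b * map_poly Const (d :: complex poly)"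
  by (rule poly_eqI) (simp add: coeff_map_poly coeff_mult Const_sum)

text \<open>One nonzero relation yields a monic relation of least degree;
  \<open>bernstein_sato_unique\<close> then resolves the definite description.\<close>

lemma bernstein_sato_poly_relation:
  assumes "bernstein_sato_relation f b" "b \<noteq> 0"
  shows "bernstein_sato_relation f (bernstein_sato_poly f)"
proof -
  let ?R = "\<lambda>d. lead_coeff d = 1 \<and> bernstein_sato_relation f d"
  \<comment> \<open>Serves as the second argument of \<open>bernstein_sato_relation_lincomb\<close>,
    which then just divides \<open>b\<close> by its leading coefficient.\<close>
  have "bernstein_sato_relation f 0"
    unfolding bernstein_sato_relation_def
    by (rule bexI[OF _ weyl_operators.mult[of 0]]) simp
  from bernstein_sato_relation_lincomb[OF assms(1) this, of "inverse (lead_coeff b)"]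
  have "?R (smult (inverse (lead_coeff b)) b)" using assms(2) by (simp add: lead_coeff_smult)
  then obtain d where d: "?R d" "\<And>e. ?R e \<Longrightarrow> degree d \<le> degree e"
    using ex_has_least_nat[of ?R _ degree] by blast
  have "bernstein_sato_poly f = d"
    unfolding bernstein_sato_poly_def
  proof (rule the_equality)
    fix e assume "lead_coeff e = 1 \<and> bernstein_sato_relation f e \<and>
        (\<forall>c. lead_coeff c = 1 \<and> bernstein_sato_relation f c \<longrightarrow> degree e \<le> degree c)"
    thus "e = d" using d by (intro bernstein_sato_unique[of e f d]) auto
  qed (use d in auto)
  thus ?thesis using d by simp
qed

lemma pderiv_var_Const [simp]: "pderiv_var i (Const a) = 0"
  by (simp add: Const_def pderiv_var_single)

lemma pderiv_var_1: "pderiv_var i 1 = 0"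
  using pderiv_var_Const[of i 1] by simp

lemma pderiv_var_Var: "pderiv_var i (Var j) = (if i = j then 1 else 0)"
  by (simp add: Var_def pderiv_var_single lookup_single when_def flip: single_one)

lemma pderiv_var_linpoly [simp]: "pderiv_var i (linpoly c) = Const (c $ i)"
  by (simp add: linpoly_def pderiv_var_sum pderiv_var_mult pderiv_var_Var if_distrib cong: if_cong)

lemma pderiv_s_pCons [simp]: "pderiv_s i [:p:] = [:pderiv_var i p:]"
  by (rule poly_eqI) (auto simp: pderiv_s_def coeff_map_poly coeff_pCons split: nat.splits)

lemma pderiv_s_map_Const [simp]: "pderiv_s i (map_poly Const b) = 0"
  by (rule poly_eqI) (simp add: pderiv_s_def coeff_map_poly)

lemma fderiv_to_fract: "fderiv i (to_fract g) = to_fract (pderiv_s i g)"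
proof -
  have "pderiv_s i 1 = 0" using pderiv_s_map_Const[of i 1] by (simp add: map_poly_1' flip: one_pCons)
  thus ?thesis using fderiv_Fract[of 1 i g] by (simp add: to_fract_def)
qed

lemma to_fract_of_nat: "to_fract (of_nat m) = of_nat m"
  by (induction m) simp_all

definition emb :: "('n::linorder) cpoly \<Rightarrow> 'n cpoly_s fract" where
  "emb p = to_fract [:p:]"

lemma emb_simps [simp]: "emb 0 = 0" "emb 1 = 1" "emb (p + q) = emb p + emb q" "emb (p * q) = emb p * emb q"
  "emb p = 0 \<longleftrightarrow> p = 0"
  by (simp_all add: emb_def flip: one_pCons to_fract_add to_fract_mult)

lemma emb_sum: "emb (sum g A) = (\<Sum>x\<in>A. emb (g x))"
  by (induction A rule: infinite_finite_induct) auto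

definition ddir :: "complex ^ 'n::{finite,linorder} \<Rightarrow> ('n::{finite,linorder}) cpoly \<Rightarrow> 'n cpoly" where
  "ddir v p = (\<Sum>j\<in>UNIV. Const (v $ j) * pderiv_var j p)"

lemma ddir_mult: "ddir v (p * q) = ddir v p * q + p * ddir v q"
  by (simp add: ddir_def pderiv_var_mult distrib_left sum.distrib sum_distrib_left sum_distrib_right mult_ac)

lemma ddir_1: "ddir v 1 = 0"
  by (simp add: ddir_def pderiv_var_1)

lemma ddir_linpoly: "ddir v (linpoly c) = Const (lform c v)"
  by (simp add: ddir_def lform_def Const_sum mult.commute)

lemma log_ddir_power:
  assumes "p \<noteq> 0"
  shows "emb (ddir v (p ^ k)) = of_nat k * (emb (ddir v p) / emb p) * emb (p ^ k)"
proof (induction k)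
  case (Suc k)
  have "emb (ddir v (p ^ Suc k)) = emb (ddir v p) * emb (p ^ k) + emb p * emb (ddir v (p ^ k))"
    by (simp add: ddir_mult)
  also have "\<dots> = of_nat (Suc k) * (emb (ddir v p) / emb p) * emb (p ^ Suc k)"
    unfolding Suc.IH using assms by (simp add: field_simps)
  finally show ?case .
qed (simp add: ddir_1)

lemma log_ddir_prod:
  assumes "finite A" "\<And>t. t \<in> A \<Longrightarrow> emb (ddir v (g t)) = d t * emb (g t)"
  shows "emb (ddir v (prod g A)) = (\<Sum>t\<in>A. d t) * emb (prod g A)"
  using assms
  by (induction A rule: finite_induct) (auto simp: ddir_1 ddir_mult algebra_simps)

section \<open>The Weyl module generated by \<open>f \<cdot> f\<^sup>s\<close>\<close>

locale power_arrangement = arrangement c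
  for c :: "'r::finite \<Rightarrow> complex ^ 'n::{finite,linorder}" +
  fixes a :: "'r \<Rightarrow> nat"
  assumes a_pos: "a i > 0"
begin

definition fpow :: "('r \<Rightarrow> nat) \<Rightarrow> 'n cpoly" where
  "fpow \<alpha> = (\<Prod>i\<in>UNIV. linpoly (c i) ^ \<alpha> i)"

abbreviation ff :: "'n cpoly" where "ff \<equiv> fpow a"

lemma linpoly_nonzero [simp]: "linpoly (c i) \<noteq> 0"
  using c_nonzero by (simp add: linpoly_eq_0_iff)

lemma fpow_nonzero [simp]: "fpow \<alpha> \<noteq> 0"
  by (simp add: fpow_def)

lemma fpow_Suc: "fpow (\<alpha>(i := Suc (\<alpha> i))) = linpoly (c i) * fpow \<alpha>"
proof -
  have "fpow (\<alpha>(i := Suc (\<alpha> i))) = linpoly (c i) ^ Suc (\<alpha> i) * (\<Prod>j\<in>UNIV - {i}. linpoly (c j) ^ \<alpha> j)"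
    unfolding fpow_def by (subst prod.remove[of _ i]) (auto intro!: prod.cong)
  also have "\<dots> = linpoly (c i) * (\<Prod>j\<in>UNIV. linpoly (c j) ^ \<alpha> j)"
    by (subst prod.remove[of UNIV i]) (auto simp: mult_ac)
  finally show ?thesis by (simp add: fpow_def)
qed

lemma fpow_le: "(\<And>i. \<alpha> i \<le> \<beta> i) \<Longrightarrow> fpow \<beta> = fpow \<alpha> * fpow (\<lambda>i. \<beta> i - \<alpha> i)"
  by (simp add: fpow_def flip: prod.distrib power_add)

lemma log_ddir_fpow:
  "emb (ddir v (fpow \<alpha>)) = (\<Sum>t\<in>UNIV. of_nat (\<alpha> t) * (emb (Const (lform (c t) v)) / emb (linpoly (c t)))) * emb (fpow \<alpha>)"
  unfolding fpow_def
  by (rule log_ddir_prod) (auto simp: log_ddir_power ddir_linpoly)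

text \<open>The \<open>A\<^sub>n[s]\<close>-submodule generated by
  \<open>f \<cdot> f\<^sup>s\<close>, in terms of coefficients of \<open>f\<^sup>s\<close>. A
  Bernstein-Sato relation for \<open>b\<close> says that \<open>b\<close> belongs to it.\<close>

definition NN :: "'n cpoly_s fract set" where
  "NN = {P (emb ff) | P. P \<in> weyl_operators ff}"

lemma NN_add:
  assumes "u \<in> NN" "w \<in> NN"
  shows "u + w \<in> NN"
proof -
  obtain P Q where PQ: "P \<in> weyl_operators ff" "u = P (emb ff)" "Q \<in> weyl_operators ff" "w = Q (emb ff)"
    using assms unfolding NN_def mem_Collect_eq by fast
  show ?thesis
    unfolding NN_def mem_Collect_eq PQ(2,4)
    by (rule exI[of _ "\<lambda>u. P u + Q u"], rule conjI, rule refl, rule weyl_operators.add[OF PQ(1,3)])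
qed

lemma NN_comp: "Q \<in> weyl_operators ff \<Longrightarrow> u \<in> NN \<Longrightarrow> Q u \<in> NN"
proof -
  assume Q: "Q \<in> weyl_operators ff" and "u \<in> NN"
  then obtain P where P: "P \<in> weyl_operators ff" "u = P (emb ff)" by (auto simp: NN_def)
  show ?thesis
    unfolding NN_def mem_Collect_eq
    by (rule exI[of _ "Q \<circ> P"], rule conjI, simp add: P(2), rule weyl_operators.comp[OF Q P(1)])
qed

lemma NN_mult: "u \<in> NN \<Longrightarrow> to_fract g * u \<in> NN"
  using NN_comp[OF weyl_operators.mult] by simp

lemma emb_ff_NN: "emb ff \<in> NN"
  unfolding NN_def mem_Collect_eq
  by (rule exI[of _ "\<lambda>u. to_fract 1 * u"], rule conjI, simp, rule weyl_operators.mult)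

lemma NN_0: "0 \<in> NN"
  using NN_mult[OF emb_ff_NN, of 0] by simp

lemma NN_sum: "(\<And>x. x \<in> A \<Longrightarrow> g x \<in> NN) \<Longrightarrow> sum g A \<in> NN"
  by (induction A rule: infinite_finite_induct) (auto intro: NN_add NN_0)

lemma NN_diff:
  assumes "u \<in> NN" "w \<in> NN"
  shows "u - w \<in> NN"
proof -
  have "u - w = u + to_fract (-1) * w" by simp
  thus ?thesis using NN_add[OF assms(1) NN_mult[OF assms(2), of "-1"]] by (simp only:)
qed

definition svar :: "'n cpoly_s fract" where "svar = to_fract [:0, 1:]"

definition tdir :: "complex ^ 'n::{finite,linorder} \<Rightarrow> 'n cpoly_s fract \<Rightarrow> 'n cpoly_s fract" where
  "tdir v u = (\<Sum>j\<in>UNIV. emb (Const (v $ j)) * twisted_deriv ff j u)"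

lemma NN_tdir: "u \<in> NN \<Longrightarrow> tdir v u \<in> NN"
  unfolding tdir_def emb_def by (intro NN_sum NN_mult NN_comp[OF weyl_operators.deriv])

text \<open>The algebraic counterpart of \<open>wirt_lpow_wt\<close>: in the product of the monomial
  with \<open>f\<^sup>s\<close> the form \<open>t\<close> has exponent
  \<open>\<alpha> t + s * a t\<close>.\<close>

lemma tdir_fpow:
  "tdir v (to_fract (map_poly Const b) * emb (fpow \<alpha>)) =
    to_fract (map_poly Const b) * emb (fpow \<alpha>) *
    (\<Sum>t\<in>UNIV. (of_nat (\<alpha> t) + svar * of_nat (a t)) * (emb (Const (lform (c t) v)) / emb (linpoly (c t))))"
proof -
  let ?B = "map_poly Const b" and ?m = "fpow \<alpha>"
  let ?k = "\<lambda>t. emb (Const (lform (c t) v)) / emb (linpoly (c t))"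
  have 1: "twisted_deriv ff j (to_fract ?B * emb ?m) =
      to_fract ?B * (emb (pderiv_var j ?m) + svar * emb ?m * emb (pderiv_var j ff) / emb ff)" for j
  proof -
    have tw: "twisted_deriv ff j u = fderiv j u + svar * u * emb (pderiv_var j ff) / emb ff" for u
      by (simp only: twisted_deriv_def svar_def emb_def)
    have Bm: "to_fract ?B * emb ?m = to_fract (?B * [:?m:])" by (simp only: emb_def to_fract_mult)
    have fd: "fderiv j (to_fract ?B * emb ?m) = to_fract ?B * emb (pderiv_var j ?m)"
      unfolding Bm fderiv_to_fract pderiv_s_mult pderiv_s_map_Const pderiv_s_pCons
      by (simp only: emb_def to_fract_mult mult_zero_left add_0_left)
    show ?thesis unfolding tw fd by (simp add: distrib_left mult_ac)
  qed
  have "tdir v (to_fract ?B * emb ?m) =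
      to_fract ?B * ((\<Sum>j\<in>UNIV. emb (Const (v $ j)) * emb (pderiv_var j ?m)) +
        svar * emb ?m * (\<Sum>j\<in>UNIV. emb (Const (v $ j)) * emb (pderiv_var j ff)) / emb ff)"
    unfolding tdir_def 1
    by (simp add: distrib_left sum.distrib sum_distrib_left sum_divide_distrib mult_ac)
  also have "\<dots> = to_fract ?B * (emb (ddir v ?m) + svar * emb ?m * emb (ddir v ff) / emb ff)"
    by (simp add: ddir_def emb_sum)
  also have "\<dots> = to_fract ?B * emb ?m * ((\<Sum>t\<in>UNIV. of_nat (\<alpha> t) * ?k t) + svar * (\<Sum>t\<in>UNIV. of_nat (a t) * ?k t))"
    unfolding log_ddir_fpow by (simp add: distrib_left mult_ac)
  also have "(\<Sum>t\<in>UNIV. of_nat (\<alpha> t) * ?k t) + svar * (\<Sum>t\<in>UNIV. of_nat (a t) * ?k t) =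
      (\<Sum>t\<in>UNIV. (of_nat (\<alpha> t) + svar * of_nat (a t)) * ?k t)"
    by (simp only: distrib_right sum.distrib sum_distrib_left mult.assoc)
  finally show ?thesis .
qed

text \<open>The product \<open>ev L\<close> at the exponents \<open>s * a t\<close>, as a polynomial
  in \<open>s\<close>.\<close>

definition evp :: "('r set \<times> nat) multiset \<Rightarrow> complex poly" where
  "evp L = (\<Prod>(T, d)\<in>#L. [:of_nat (rk T + d), of_nat (sum a T):])"

lemma evp_simps [simp]: "evp {#} = 1"
  "evp (add_mset (T, d) L) = [:of_nat (rk T + d), of_nat (sum a T):] * evp L"
  "evp (L + L') = evp L * evp L'"
  by (simp_all add: evp_def)

lemma evp_nonzero: "(\<And>T d. (T, d) \<in># L \<Longrightarrow> T \<noteq> {}) \<Longrightarrow> evp L \<noteq> 0"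
proof (induction L)
  case (add x L)
  obtain T d where x: "x = (T, d)" by (cases x)
  obtain t where "t \<in> T" using add.prems[of T d] by (auto simp: x)
  hence "sum a T \<noteq> 0" using a_pos[of t] by auto
  hence "(of_nat (sum a T) :: complex) \<noteq> 0" by (simp only: of_nat_eq_0_iff not_False_eq_True)
  hence "[:of_nat (rk T + d), of_nat (sum a T) :: complex:] \<noteq> 0"
    by (simp only: pCons_eq_0_iff) simp
  moreover have "evp L \<noteq> 0"
  proof (rule add.IH)
    fix T d assume "(T, d) \<in># L"
    thus "T \<noteq> {}" using add.prems[of T d] by simp
  qed
  ultimately show ?case unfolding x evp_simps by (simp only: mult_eq_0_iff) simp
qed auto

definition reaches :: "('r set \<times> nat) multiset \<Rightarrow> ('r \<Rightarrow> nat) \<Rightarrow> bool" where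
  "reaches L \<alpha> \<longleftrightarrow> to_fract (map_poly Const (evp L)) * emb (fpow \<alpha>) \<in> NN"

lemma reaches_mono:
  assumes "reaches L \<alpha>" "L \<subseteq># L'" "\<And>i. \<alpha> i \<le> \<beta> i"
  shows "reaches L' \<beta>"
proof -
  have "evp L' = evp (L' - L) * evp L" using assms(2) by (metis evp_simps(3) subset_mset.diff_add)
  hence "to_fract (map_poly Const (evp L')) * emb (fpow \<beta>) =
      to_fract (map_poly Const (evp (L' - L)) * [:fpow (\<lambda>i. \<beta> i - \<alpha> i):]) * (to_fract (map_poly Const (evp L)) * emb (fpow \<alpha>))"
    by (simp only: fpow_le[OF assms(3)] map_poly_Const_mult emb_simps to_fract_mult emb_def[symmetric] mult_ac)
  thus ?thesis using NN_mult[OF assms(1)[unfolded reaches_def]] by (simp add: reaches_def)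
qed

text \<open>A monomial with all exponents \<open>sum a UNIV\<close> is a multiple of
  \<open>f\<close>, as each \<open>a i\<close> is at most that sum.\<close>

lemma reaches_start: "reaches {#} (\<lambda>_. sum a UNIV)"
proof -
  have "reaches {#} a" using emb_ff_NN by (simp add: reaches_def map_poly_1')
  thus ?thesis by (rule reaches_mono) (auto intro: member_le_sum)
qed

lemma linpoly_expand:
  assumes "t \<in> T"
  shows "(\<Sum>i\<in>bas T. Const (lform (c t) (dual T i)) * linpoly (c i)) = linpoly (c t)"
proof -
  have "(\<Sum>i\<in>bas T. lform (c t) (dual T i) * c i $ j) = c t $ j" for j
    using lform_expand[OF assms, of "axis j 1"] by (simp add: lform_def axis_def if_distrib cong: if_cong)
  hence "linpoly (c t) = (\<Sum>j\<in>UNIV. Const (\<Sum>i\<in>bas T. lform (c t) (dual T i) * c i $ j) * Var j)"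
    by (simp add: linpoly_def)
  also have "\<dots> = (\<Sum>j\<in>UNIV. \<Sum>i\<in>bas T. Const (lform (c t) (dual T i)) * (Const (c i $ j) * Var j))"
    by (simp add: Const_sum sum_distrib_right mult.assoc)
  also have "\<dots> = (\<Sum>i\<in>bas T. \<Sum>j\<in>UNIV. Const (lform (c t) (dual T i)) * (Const (c i $ j) * Var j))"
    by (rule sum.swap)
  also have "\<dots> = (\<Sum>i\<in>bas T. Const (lform (c t) (dual T i)) * linpoly (c i))"
    by (simp add: linpoly_def sum_distrib_left)
  finally show ?thesis ..
qed

text \<open>The same divergence identity as in \<open>integration_by_parts\<close>, at the exponents
  \<open>\<alpha> t + s * a t\<close>. No test function occurs: the divergence is not 0 but lies in
  \<open>NN\<close>, which is closed under derivations.\<close>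

lemma reaches_step:
  assumes \<alpha>: "\<And>t. t \<notin> T \<Longrightarrow> \<alpha> t \<ge> 1"
    and 1: "\<And>i. i \<in> bas T \<Longrightarrow> reaches L (\<alpha>(i := Suc (\<alpha> i)))"
    and 2: "\<And>i t. i \<in> bas T \<Longrightarrow> t \<notin> T \<Longrightarrow> reaches L (\<alpha>(i := Suc (\<alpha> i), t := \<alpha> t - 1))"
  shows "reaches (add_mset (T, sum \<alpha> T) L) \<alpha>"
proof -
  define W where "W = to_fract (map_poly Const (evp L) :: 'n cpoly_s)"
  define y where "y t = emb (linpoly (c t))" for t
  define P where "P = emb (fpow \<alpha>)"
  define x where "x t = of_nat (\<alpha> t) + svar * of_nat (a t)" for t
  define k where "k t i = (emb (Const (lform (c t) (dual T i))) :: 'n cpoly_s fract)" for t i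
  let ?E = "\<lambda>i t. W * emb (fpow (\<alpha>(i := Suc (\<alpha> i), t := \<alpha> t - 1)))"
  have y0: "y t \<noteq> 0" for t by (simp add: y_def)
  have yk: "(\<Sum>i\<in>bas T. k t i * y i) = y t" if "t \<in> T" for t
    using arg_cong[OF linpoly_expand[OF that], of emb] by (simp add: emb_sum k_def y_def)
  have kii: "k i i = 1" if "i \<in> bas T" for i using lform_dual[OF that that] by (simp add: k_def)
  have lhs: "tdir (dual T i) (W * emb (fpow (\<alpha>(i := Suc (\<alpha> i))))) =
      W * P * (\<Sum>t\<in>UNIV. x t * (k t i * y i / y t)) + W * P" if i: "i \<in> bas T" for i
  proof -
    have "tdir (dual T i) (W * emb (fpow (\<alpha>(i := Suc (\<alpha> i))))) = W * (y i * P) *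
        (\<Sum>t\<in>UNIV. (of_nat ((\<alpha>(i := Suc (\<alpha> i))) t) + svar * of_nat (a t)) * (k t i / y t))"
      unfolding W_def tdir_fpow unfolding fpow_Suc by (simp add: y_def P_def k_def)
    also have "(\<Sum>t\<in>UNIV. (of_nat ((\<alpha>(i := Suc (\<alpha> i))) t) + svar * of_nat (a t)) * (k t i / y t)) =
        (\<Sum>t\<in>UNIV. x t * (k t i / y t) + (if t = i then k i i / y i else 0))"
      by (rule sum.cong) (auto simp: x_def algebra_simps add_divide_distrib)
    also have "\<dots> = (\<Sum>t\<in>UNIV. x t * (k t i / y t)) + 1 / y i" by (simp add: sum.distrib kii[OF i])
    finally have "tdir (dual T i) (W * emb (fpow (\<alpha>(i := Suc (\<alpha> i))))) =
        W * (y i * P) * (\<Sum>t\<in>UNIV. x t * (k t i / y t)) + W * (y i * P) * (1 / y i)" by (simp only: distrib_left)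
    also have "W * (y i * P) * (\<Sum>t\<in>UNIV. x t * (k t i / y t)) = W * P * (\<Sum>t\<in>UNIV. x t * (k t i * y i / y t))"
      by (simp add: sum_distrib_left mult_ac)
    also have "W * (y i * P) * (1 / y i) = W * P" using y0[of i] by simp
    finally show ?thesis .
  qed
  have off: "W * P * (k t i * y i / y t) = k t i * ?E i t" if "i \<in> bas T" "t \<notin> T" for i t
  proof -
    have "t \<noteq> i" using that bas_subset by auto
    hence "fpow (\<alpha>(i := Suc (\<alpha> i))) = linpoly (c t) * fpow (\<alpha>(i := Suc (\<alpha> i), t := \<alpha> t - 1))"
      using fpow_Suc[of "\<alpha>(i := Suc (\<alpha> i), t := \<alpha> t - 1)" t] \<alpha>[OF that(2)] by (simp add: fun_upd_twist)
    hence "linpoly (c i) * fpow \<alpha> = linpoly (c t) * fpow (\<alpha>(i := Suc (\<alpha> i), t := \<alpha> t - 1))"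
      by (simp add: fpow_Suc)
    from arg_cong[OF this, of emb] have "y i * P = y t * emb (fpow (\<alpha>(i := Suc (\<alpha> i), t := \<alpha> t - 1)))"
      by (simp add: y_def P_def)
    hence "emb (fpow (\<alpha>(i := Suc (\<alpha> i), t := \<alpha> t - 1))) = y i * P / y t" using y0[of t] by (simp add: field_simps)
    thus ?thesis by (simp add: mult_ac)
  qed
  have split: "(\<Sum>t\<in>UNIV. g t) = (\<Sum>t\<in>T. g t) + (\<Sum>t\<in>-T. g t)" for g :: "'r \<Rightarrow> 'n cpoly_s fract"
    using sum.union_disjoint[of T "-T" g] by simp
  have "(\<Sum>i\<in>bas T. tdir (dual T i) (W * emb (fpow (\<alpha>(i := Suc (\<alpha> i)))))) =
      (\<Sum>i\<in>bas T. W * P * (\<Sum>t\<in>T. x t * (k t i * y i / y t))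
        + W * P * (\<Sum>t\<in>-T. x t * (k t i * y i / y t)) + W * P)"
    by (rule sum.cong) (auto simp: lhs split distrib_left)
  also have "\<dots> = W * P * (\<Sum>i\<in>bas T. \<Sum>t\<in>T. x t * (k t i * y i / y t)) +
      (\<Sum>i\<in>bas T. W * P * (\<Sum>t\<in>-T. x t * (k t i * y i / y t))) + of_nat (rk T) * (W * P)"
    by (simp add: sum.distrib rk_def sum_distrib_left)
  also have "(\<Sum>i\<in>bas T. \<Sum>t\<in>T. x t * (k t i * y i / y t)) = (\<Sum>t\<in>T. \<Sum>i\<in>bas T. x t * (k t i * y i / y t))"
    by (rule sum.swap)
  also have "\<dots> = (\<Sum>t\<in>T. x t)"
  proof (rule sum.cong[OF refl])
    fix t assume t: "t \<in> T"
    have "(\<Sum>i\<in>bas T. x t * (k t i * y i / y t)) = x t / y t * (\<Sum>i\<in>bas T. k t i * y i)"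
      by (simp add: sum_distrib_left)
    thus "(\<Sum>i\<in>bas T. x t * (k t i * y i / y t)) = x t" using yk[OF t] y0[of t] by simp
  qed
  also have "(\<Sum>i\<in>bas T. W * P * (\<Sum>t\<in>-T. x t * (k t i * y i / y t))) =
      (\<Sum>i\<in>bas T. \<Sum>t\<in>-T. x t * k t i * ?E i t)"
  proof (rule sum.cong[OF refl])
    fix i assume i: "i \<in> bas T"
    have "W * P * (\<Sum>t\<in>-T. x t * (k t i * y i / y t)) = (\<Sum>t\<in>-T. x t * (W * P * (k t i * y i / y t)))"
      by (simp add: sum_distrib_left mult_ac)
    also have "\<dots> = (\<Sum>t\<in>-T. x t * k t i * ?E i t)"
    proof (rule sum.cong[OF refl])
      fix t assume "t \<in> - T"
      hence "W * P * (k t i * y i / y t) = k t i * ?E i t" by (intro off i) auto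
      thus "x t * (W * P * (k t i * y i / y t)) = x t * k t i * ?E i t" by (simp only: mult.assoc)
    qed
    finally show "W * P * (\<Sum>t\<in>-T. x t * (k t i * y i / y t)) = (\<Sum>t\<in>-T. x t * k t i * ?E i t)" .
  qed
  finally have fin: "(\<Sum>i\<in>bas T. tdir (dual T i) (W * emb (fpow (\<alpha>(i := Suc (\<alpha> i)))))) =
      W * P * (\<Sum>t\<in>T. x t) + (\<Sum>i\<in>bas T. \<Sum>t\<in>-T. x t * k t i * ?E i t) + of_nat (rk T) * (W * P)" .
  have alg: "w * p * s + y + r * (w * p) - y = (r + s) * (w * p)" for w p s y r :: "'n cpoly_s fract"
    by (simp add: algebra_simps)
  have eq: "(\<Sum>i\<in>bas T. tdir (dual T i) (W * emb (fpow (\<alpha>(i := Suc (\<alpha> i)))))) -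
      (\<Sum>i\<in>bas T. \<Sum>t\<in>-T. x t * k t i * ?E i t) = (of_nat (rk T) + (\<Sum>t\<in>T. x t)) * (W * P)"
    unfolding fin by (rule alg)
  have "(\<Sum>i\<in>bas T. tdir (dual T i) (W * emb (fpow (\<alpha>(i := Suc (\<alpha> i)))))) \<in> NN"
    using 1 by (intro NN_sum NN_tdir) (simp add: reaches_def W_def)
  moreover have "(\<Sum>i\<in>bas T. \<Sum>t\<in>-T. x t * k t i * ?E i t) \<in> NN"
  proof (intro NN_sum)
    fix i t assume "i \<in> bas T" "t \<in> - T"
    hence "?E i t \<in> NN" using 2[of i t] by (simp add: reaches_def W_def)
    moreover have "x t * k t i = to_fract ((of_nat (\<alpha> t) + [:0, 1:] * of_nat (a t)) * [:Const (lform (c t) (dual T i)):])"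
      by (simp only: x_def k_def svar_def emb_def to_fract_mult to_fract_add to_fract_of_nat)
    ultimately show "x t * k t i * ?E i t \<in> NN" using NN_mult by metis
  qed
  ultimately have "(of_nat (rk T) + (\<Sum>t\<in>T. x t)) * (W * P) \<in> NN"
    unfolding eq[symmetric] by (rule NN_diff)
  moreover have "of_nat (rk T) + (\<Sum>t\<in>T. x t) = to_fract (map_poly Const [:of_nat (rk T + sum \<alpha> T), of_nat (sum a T):])"
  proof -
    have C: "Const (of_nat m) = (of_nat m :: 'n cpoly)" for m by (induction m) auto
    have lin: "map_poly Const [:of_nat p, of_nat q:] = (of_nat p + [:0, 1:] * of_nat q :: 'n cpoly_s)" for p q
      by (rule poly_eqI) (simp add: coeff_map_poly of_nat_poly coeff_pCons C split: nat.splits)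
    have "map_poly Const [:of_nat (rk T + sum \<alpha> T), of_nat (sum a T):] =
        (of_nat (rk T + sum \<alpha> T) + [:0, 1:] * of_nat (sum a T) :: 'n cpoly_s)"
      by (rule lin)
    thus ?thesis
      by (simp add: x_def sum.distrib svar_def sum_distrib_left to_fract_of_nat del: mult_pCons_left mult_pCons_right)
  qed
  ultimately show ?thesis
    unfolding reaches_def evp_simps map_poly_Const_mult to_fract_mult by (simp add: W_def P_def mult.assoc)
qed

text \<open>Here the factor \<open>(UNIV, 0)\<close> may be spent as well: it takes the descent from
  degree 1 to \<alpha> = 0, that is, to \<open>f\<^sup>s\<close> itself.\<close>

theorem bernstein_sato_exists: "bernstein_sato_relation ff (bernstein_sato_poly ff)"
proof -
  interpret exponent_descent bas reaches "sum a UNIV"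
    by unfold_locales
      (fact bas_nonempty bas_subset reaches_start | rule reaches_mono reaches_step; assumption)+
  obtain L where L: "admissible L" "\<forall>i\<in>bas UNIV. reaches L ((\<lambda>_. 0)(i := 1))"
    using descent_full by blast
  have "reaches (add_mset (UNIV, sum (\<lambda>_::'r. 0) UNIV) L) (\<lambda>_. 0)"
    by (rule reaches_step) (use L(2) in auto)
  hence "to_fract (map_poly Const (evp (add_mset (UNIV, 0) L))) \<in> NN"
    by (simp add: reaches_def fpow_def)
  hence "bernstein_sato_relation ff (evp (add_mset (UNIV, 0) L))"
    by (auto simp: NN_def bernstein_sato_relation_def emb_def)
  moreover have "evp (add_mset (UNIV, 0) L) \<noteq> 0"
    by (rule evp_nonzero) (use L(1) in \<open>auto simp: admissible_def\<close>)
  ultimately show ?thesis by (rule bernstein_sato_poly_relation)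
qed

end

section \<open>Roots of the Bernstein-Sato polynomial\<close>

lemma wirt_add:
  assumes "F differentiable (at z)" "G differentiable (at z)"
  shows "wirt v (\<lambda>z. F z + G z) z = wirt v F z + wirt v G z"
proof -
  have *: "((\<lambda>z. F z + G z) has_derivative (\<lambda>h. frechet_derivative F (at z) h + frechet_derivative G (at z) h)) (at z)"
    by (intro has_derivative_add) (use assms in \<open>auto simp flip: frechet_derivative_works\<close>)
  show ?thesis unfolding wirt_eqI[OF *] by (simp add: wirt_def field_simps)
qed

lemma Ck_1_differentiable: "Ck 1 f \<Longrightarrow> f differentiable (at z)"
  by simp

lemma wirt_lform_power: "wirt v (\<lambda>z. lform c z ^ k) z = of_nat k * lform c v * lform c z ^ (k - 1)"
proof -
  have *: "((\<lambda>z. lform c z ^ k) has_derivative (\<lambda>h. of_nat k * lform c h * lform c z ^ (k - 1))) (at z)"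
    by (rule has_derivative_power, rule bounded_linear_imp_has_derivative, rule bounded_linear_lform)
  show ?thesis unfolding wirt_eqI[OF *] by (simp add: algebra_simps)
qed

lemma lform_axis: "lform (axis i 1) z = z $ i"
  by (simp add: lform_def axis_def if_distrib[of "\<lambda>x. x * _"] cong: if_cong)

lemma peval_Var_lform: "peval (Var i) = lform (axis i 1)"
  by (rule ext) (simp add: lform_axis)

lemma Ck_peval: "Ck k (peval p)"
proof (induction p rule: cpoly_induct)
  case (Const a)
  have "peval (Const a) = (\<lambda>z. a)" by (rule ext) simp
  thus ?case by (simp add: Ck_const)
next
  case (Var i)
  show ?case unfolding peval_Var_lform by (rule Ck_bounded_linear[OF bounded_linear_lform])
next
  case (add p q)
  have "peval (p + q) = (\<lambda>z. peval p z + peval q z)" by (rule ext) simp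
  thus ?case using Ck_add[OF add] by simp
next
  case (mult p q)
  have "peval (p * q) = (\<lambda>z. peval p z * peval q z)" by (rule ext) simp
  thus ?case using Ck_mult[OF mult] by simp
qed

lemma wirt_peval: "wirt (axis j 1) (peval p) z = peval (pderiv_var j p) z"
proof (induction p rule: cpoly_induct)
  case (Const a)
  have "peval (Const a) = (\<lambda>z. a)" by (rule ext) simp
  thus ?case by simp
next
  case (Var i)
  have "wirt (axis j 1) (peval (Var i)) z = axis j 1 $ i"
    unfolding peval_Var_lform wirt_lform by (rule lform_axis)
  also have "axis j 1 $ i = peval (pderiv_var j (Var i)) z" by (simp add: pderiv_var_Var axis_def)
  finally show ?case .
next
  case (add p q)
  have eq: "peval (p + q) = (\<lambda>z. peval p z + peval q z)" by (rule ext) simp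
  have "wirt (axis j 1) (peval (p + q)) z = wirt (axis j 1) (peval p) z + wirt (axis j 1) (peval q) z"
    unfolding eq by (intro wirt_add Ck_1_differentiable Ck_peval)
  also have "\<dots> = peval (pderiv_var j (p + q)) z" by (simp add: add pderiv_var_add)
  finally show ?case .
next
  case (mult p q)
  have eq: "peval (p * q) = (\<lambda>z. peval p z * peval q z)" by (rule ext) simp
  have "wirt (axis j 1) (peval (p * q)) z =
      wirt (axis j 1) (peval p) z * peval q z + peval p z * wirt (axis j 1) (peval q) z"
    unfolding eq by (intro wirt_mult Ck_1_differentiable Ck_peval)
  also have "\<dots> = peval (pderiv_var j (p * q)) z" by (simp add: mult pderiv_var_mult)
  finally show ?case .
qed

section \<open>Evaluation of polynomials in s and z\<close>

definition seval :: "('n::finite) cpoly_s \<Rightarrow> complex \<Rightarrow> complex ^ 'n \<Rightarrow> complex" where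
  "seval g \<sigma> z = poly (map_poly (\<lambda>p. peval p z) g) \<sigma>"

lemma seval_pCons [simp]: "seval (pCons p g) \<sigma> z = peval p z + \<sigma> * seval g \<sigma> z"
  by (simp add: seval_def map_poly_pCons)

lemma seval_0 [simp]: "seval 0 \<sigma> z = 0"
  by (simp add: seval_def)

lemma seval_add [simp]: "seval (g + h) \<sigma> z = seval g \<sigma> z + seval h \<sigma> z"
proof -
  have "map_poly (\<lambda>p. peval p z) (g + h) = map_poly (\<lambda>p. peval p z) g + map_poly (\<lambda>p. peval p z) h"
    by (rule poly_eqI) (simp add: coeff_map_poly)
  thus ?thesis by (simp add: seval_def)
qed

lemma seval_mult [simp]: "seval (g * h) \<sigma> z = seval g \<sigma> z * seval h \<sigma> z"
proof -
  have "map_poly (\<lambda>p. peval p z) (g * h) = map_poly (\<lambda>p. peval p z) g * map_poly (\<lambda>p. peval p z) h"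
    by (rule poly_eqI) (simp add: coeff_map_poly coeff_mult)
  thus ?thesis by (simp add: seval_def)
qed

lemma seval_1 [simp]: "seval 1 \<sigma> z = 1"
  by (simp add: one_pCons)

lemma seval_power [simp]: "seval (g ^ k) \<sigma> z = seval g \<sigma> z ^ k"
  by (induction k) simp_all

lemma seval_of_nat [simp]: "seval (of_nat k) \<sigma> z = of_nat k"
  by (induction k) simp_all

lemma seval_minus_of_nat [simp]: "seval (g - of_nat k) \<sigma> z = seval g \<sigma> z - of_nat k"
  using seval_add[of "g - of_nat k" "of_nat k" \<sigma> z] by simp

lemma seval_map_Const [simp]: "seval (map_poly Const b) \<sigma> z = poly b \<sigma>"
  by (induction b) (simp_all add: map_poly_pCons)

lemma Ck_seval: "Ck k (seval g \<sigma>)"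
proof (induction g)
  case 0
  have "seval (0 :: 'a cpoly_s) \<sigma> = (\<lambda>z. 0)" by (rule ext) simp
  thus ?case by (simp add: Ck_const)
next
  case (pCons p g)
  have "seval (pCons p g) \<sigma> = (\<lambda>z. peval p z + \<sigma> * seval g \<sigma> z)" by (rule ext) simp
  thus ?case using Ck_add[OF Ck_peval Ck_mult[OF Ck_const pCons.IH], of p \<sigma>] by simp
qed

lemma wirt_seval: "wirt (axis j 1) (seval g \<sigma>) z = seval (pderiv_s j g) \<sigma> z"
proof (induction g)
  case 0
  have "seval (0 :: 'a cpoly_s) \<sigma> = (\<lambda>z. 0)" by (rule ext) simp
  thus ?case by (simp add: pderiv_s_def)
next
  case (pCons p g)
  have "seval (pCons p g) \<sigma> = (\<lambda>z. peval p z + \<sigma> * seval g \<sigma> z)" by (rule ext) simp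
  moreover have "wirt (axis j 1) (\<lambda>z. peval p z + \<sigma> * seval g \<sigma> z) z =
      wirt (axis j 1) (peval p) z + wirt (axis j 1) (\<lambda>z. \<sigma> * seval g \<sigma> z) z"
    by (intro wirt_add Ck_1_differentiable Ck_peval Ck_mult[OF Ck_const Ck_seval])
  moreover have "wirt (axis j 1) (\<lambda>z. \<sigma> * seval g \<sigma> z) z = \<sigma> * wirt (axis j 1) (seval g \<sigma>) z"
    by (subst wirt_mult[OF differentiable_const Ck_1_differentiable[OF Ck_seval]]) simp
  moreover have "pderiv_s j (pCons p g) = pCons (pderiv_var j p) (pderiv_s j g)"
    by (simp add: pderiv_s_def map_poly_pCons)
  ultimately show ?case by (simp add: pCons.IH wirt_peval)
qed

text \<open>An integer shift of the exponent splits into a holomorphic and an antiholomorphic power.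
  Dividing by the former leaves a conjugate power, which the Wirtinger derivative ignores.\<close>

lemma abs_powr_add_nat:
  assumes "\<zeta> \<noteq> 0"
  shows "abs_powr (s + of_nat k) \<zeta> = abs_powr s \<zeta> * (\<zeta> * cnj \<zeta>) ^ k"
proof (induction k)
  case (Suc k)
  have "exp (2 * of_real (ln (norm \<zeta>))) = (of_real (norm \<zeta> ^ 2) :: complex)"
  proof -
    have "exp (2 * ln (norm \<zeta>)) = norm \<zeta> ^ 2"
      using assms by (simp add: exp_double)
    thus ?thesis by (metis exp_of_real of_real_mult of_real_numeral)
  qed
  hence "exp (2 * of_real (ln (norm \<zeta>))) = \<zeta> * cnj \<zeta>" by (simp only: complex_norm_square)
  moreover have "abs_powr (s + of_nat (Suc k)) \<zeta> = abs_powr (s + of_nat k) \<zeta> * exp (2 * of_real (ln (norm \<zeta>)))"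
    using assms by (simp add: abs_powr_exp algebra_simps flip: exp_add)
  ultimately show ?case using Suc.IH by simp
qed simp

lemma bounded_linear_cnj_lform: "bounded_linear (\<lambda>z. cnj (lform d z))"
  by (rule bounded_linear_compose[OF bounded_linear_cnj bounded_linear_lform])

lemma wirt_cnj_lform: "wirt v (\<lambda>z. cnj (lform d z)) z = 0"
  unfolding wirt_eqI[OF bounded_linear_imp_has_derivative[OF bounded_linear_cnj_lform]] by simp

section \<open>Pairing fractions with test functions\<close>

locale zeta_poly = zeta_arrangement c \<phi> LL RR a + power_arrangement c a
  for c :: "'r::finite \<Rightarrow> complex ^ 'n::{finite,linorder}" and \<phi> LL RR a
begin

lemma peval_fpow [simp]: "peval (fpow \<alpha>) z = lpow \<alpha> z"
  by (simp add: fpow_def lpow_def)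

definition kern :: "nat \<Rightarrow> complex \<Rightarrow> complex ^ 'n::{finite,linorder} \<Rightarrow> complex" where
  "kern m \<sigma> z = wt (ray \<sigma>) z / lpow a z ^ m"

definition conj_pow :: "nat \<Rightarrow> complex ^ 'n::{finite,linorder} \<Rightarrow> complex" where
  "conj_pow m z = (\<Prod>i\<in>UNIV. cnj (lform (c i) z) ^ (a i * m))"

lemma lpow_eq_0_iff: "lpow a z = 0 \<longleftrightarrow> wt s z = 0"
  using a_pos by (auto simp: lpow_def wt_eq_0_iff)

text \<open>This form of the kernel is smooth, as \<open>1 / f\<^sup>m\<close> has been absorbed into \<open>|f|\<^sup>2\<^sup>\<sigma>\<close>.\<close>

lemma kern_eq: "kern m \<sigma> z = conj_pow m z * wt (ray (\<sigma> - of_nat m)) z"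
proof (cases "wt (ray \<sigma>) z = 0")
  case True
  moreover from this have "wt (ray (\<sigma> - of_nat m)) z = 0" by (simp add: wt_eq_0_iff)
  ultimately show ?thesis by (simp add: kern_def)
next
  case False
  hence nz: "lform (c i) z \<noteq> 0" for i by (auto simp: wt_eq_0_iff)
  have "abs_powr (\<sigma> * of_nat (a i)) (lform (c i) z) =
      abs_powr ((\<sigma> - of_nat m) * of_nat (a i)) (lform (c i) z) * (lform (c i) z * cnj (lform (c i) z)) ^ (a i * m)" for i
    using abs_powr_add_nat[OF nz[of i], of "(\<sigma> - of_nat m) * of_nat (a i)" "a i * m"] by (simp add: algebra_simps)
  hence "wt (ray \<sigma>) z = wt (ray (\<sigma> - of_nat m)) z * (lpow a z ^ m * conj_pow m z)"
    by (simp add: wt_def lpow_def conj_pow_def power_mult_distrib power_mult prod.distrib flip: prod_power_distrib)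
  moreover have "lpow a z \<noteq> 0" using False lpow_eq_0_iff by blast
  ultimately show ?thesis by (simp add: kern_def)
qed

lemma Ck_conj_pow: "Ck k (conj_pow m)"
  unfolding conj_pow_def by (intro Ck_prod Ck_power Ck_bounded_linear[OF bounded_linear_cnj_lform])

text \<open>Antiholomorphic functions are constants for the Wirtinger derivative, so the kernel is
  differentiated like a power of \<open>f\<close> alone.\<close>

lemma wirt_conj_pow: "wirt v (conj_pow m) z = 0"
proof -
  have Ck: "Ck 1 (\<lambda>z. cnj (lform (c i) z) ^ k)" for i k
    by (rule Ck_power[OF Ck_bounded_linear[OF bounded_linear_cnj_lform]])
  have power: "wirt v (\<lambda>z. cnj (lform (c i) z) ^ k) z = 0" for i k
  proof (induction k)
    case (Suc k)
    have "wirt v (\<lambda>z. cnj (lform (c i) z) * cnj (lform (c i) z) ^ k) z = 0"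
      using Ck[of i 1] by (subst wirt_mult[OF _ Ck_1_differentiable[OF Ck]]) (simp_all add: wirt_cnj_lform Suc.IH)
    thus ?case by simp
  qed simp
  have "wirt v (\<lambda>z. \<Prod>i\<in>UNIV. cnj (lform (c i) z) ^ (a i * m)) z =
      (\<Sum>i\<in>(UNIV :: 'r set). 0) * (\<Prod>i\<in>UNIV. cnj (lform (c i) z) ^ (a i * m))"
    by (rule conjunct1[OF wirt_prod[where d = "\<lambda>_. 0"]]) (simp_all only: finite Ck_1_differentiable[OF Ck] power mult_zero_left)
  thus ?thesis by (simp add: conj_pow_def[abs_def])
qed

text \<open>In the form \<open>kern_eq\<close> the exponents are
  \<open>(\<sigma> - of_nat m) * of_nat (a i)\<close>, whose real parts exceed 1 under the
  hypothesis.\<close>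

lemma kern_derivative:
  assumes "Re \<sigma> > real m + 1"
  shows "Ck 1 (kern m \<sigma>)"
    "wirt v (kern m \<sigma>) z = (\<sigma> - of_nat m) * (\<Sum>t\<in>UNIV. of_nat (a t) * lform (c t) v / lform (c t) z) * kern m \<sigma> z"
proof -
  have o: "ray (\<sigma> - of_nat m) \<in> orthant 1" using assms by (intro ray_orthant_pos) auto
  have Ck: "Ck 1 (wt (ray (\<sigma> - of_nat m)))" using wirt_lpow_wt(2)[OF o, of "\<lambda>_. 0"] by simp
  have eq: "kern m \<sigma> = (\<lambda>z. conj_pow m z * wt (ray (\<sigma> - of_nat m)) z)" by (rule ext) (rule kern_eq)
  show "Ck 1 (kern m \<sigma>)" unfolding eq by (rule Ck_mult[OF Ck_conj_pow Ck])
  have "wirt v (wt (ray (\<sigma> - of_nat m))) z =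
      (\<Sum>t\<in>UNIV. (\<sigma> - of_nat m) * of_nat (a t) * lform (c t) v / lform (c t) z) * wt (ray (\<sigma> - of_nat m)) z"
    using wirt_lpow_wt(1)[OF o, of v "\<lambda>_. 0"] by simp
  thus "wirt v (kern m \<sigma>) z = (\<sigma> - of_nat m) * (\<Sum>t\<in>UNIV. of_nat (a t) * lform (c t) v / lform (c t) z) * kern m \<sigma> z"
    unfolding eq wirt_mult[OF Ck_1_differentiable[OF Ck_conj_pow] Ck_1_differentiable[OF Ck]] wirt_conj_pow
    by (simp add: sum_distrib_left mult_ac)
qed

lemma log_derivative_lpow:
  assumes "lpow a z \<noteq> 0"
  shows "peval (pderiv_var j ff) z = (\<Sum>t\<in>UNIV. of_nat (a t) * lform (c t) (axis j 1) / lform (c t) z) * lpow a z"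
proof -
  have nz: "lform (c t) z \<noteq> 0" for t using assms a_pos[of t] by (auto simp: lpow_def)
  have Ck: "Ck 1 (\<lambda>z. lform (c t) z ^ a t)" for t by (rule Ck_power[OF Ck_lform])
  have w: "wirt (axis j 1) (\<lambda>z. lform (c t) z ^ a t) z =
      of_nat (a t) * lform (c t) (axis j 1) / lform (c t) z * lform (c t) z ^ a t" for t
    using nz[of t] a_pos[of t] by (simp add: wirt_lform_power power_diff)
  have "peval ff = (\<lambda>z. \<Prod>t\<in>UNIV. lform (c t) z ^ a t)" by (rule ext) (simp add: lpow_def)
  hence "wirt (axis j 1) (peval ff) z =
      (\<Sum>t\<in>UNIV. of_nat (a t) * lform (c t) (axis j 1) / lform (c t) z) * (\<Prod>t\<in>UNIV. lform (c t) z ^ a t)"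
    using conjunct1[OF wirt_prod[OF finite Ck_1_differentiable[OF Ck] w]] by simp
  thus ?thesis by (simp add: wirt_peval lpow_def)
qed

text \<open>The distribution attached to the coefficient \<open>g / f^m\<close>, where
  \<open>f\<^sup>s\<close> is read as the function |f|^(2 s).\<close>

definition pair :: "'n cpoly_s \<Rightarrow> nat \<Rightarrow> (complex ^ 'n::{finite,linorder} \<Rightarrow> complex) \<Rightarrow> complex \<Rightarrow> complex" where
  "pair g m \<psi> \<sigma> = (LINT z|lborel. seval g \<sigma> z * kern m \<sigma> z * \<psi> z)"

lemma integrable_pair:
  assumes "Re \<sigma> > real m" "test_function \<psi>"
  shows "integrable lborel (\<lambda>z. seval g \<sigma> z * kern m \<sigma> z * \<psi> z)"
proof -
  have "ray (\<sigma> - of_nat m) \<in> orthant 0" using assms by (intro ray_orthant_pos) auto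
  moreover have "test_function (\<lambda>z. seval g \<sigma> z * (conj_pow m z * \<psi> z))"
    by (intro test_function_mult Ck_seval Ck_conj_pow assms)
  ultimately have "integrable lborel (\<lambda>z. wt (ray (\<sigma> - of_nat m)) z * (seval g \<sigma> z * (conj_pow m z * \<psi> z)))"
    by (rule integrable_wt)
  thus ?thesis by (simp add: kern_eq mult_ac)
qed

text \<open>The numerator over \<open>f^(m+1)\<close> of the twisted derivative of
  \<open>g / f^m\<close>, as \<open>twisted_deriv_quotient\<close> confirms.\<close>

definition dnum :: "'n \<Rightarrow> nat \<Rightarrow> 'n cpoly_s \<Rightarrow> 'n cpoly_s" where
  "dnum j m g = [:ff:] * pderiv_s j g + ([:0, 1:] - of_nat m) * g * [:pderiv_var j ff:]"

lemma pair_by_parts: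
  assumes \<sigma>: "Re \<sigma> > real m + 1" and \<psi>: "test_function \<psi>"
  shows "pair (dnum j m g) (Suc m) \<psi> \<sigma> = - pair g m (wirt (axis j 1) \<psi>) \<sigma>"
proof -
  let ?e = "axis j 1 :: complex ^ 'n::{finite,linorder}"
  let ?G = "\<lambda>z. (seval g \<sigma> z * kern m \<sigma> z) * \<psi> z"
  have Ck\<psi>: "Ck k \<psi>" for k using \<psi> by (auto simp: test_function_def)
  have Ck: "Ck 1 (\<lambda>z. seval g \<sigma> z * kern m \<sigma> z)"
    by (rule Ck_mult[OF Ck_seval kern_derivative(1)[OF \<sigma>]])
  obtain R where R: "\<And>z. \<psi> z \<noteq> 0 \<Longrightarrow> norm z \<le> R" using \<psi> by (auto simp: test_function_iff)
  have ptw: "wirt ?e ?G z = seval (dnum j m g) \<sigma> z * kern (Suc m) \<sigma> z * \<psi> z + seval g \<sigma> z * kern m \<sigma> z * wirt ?e \<psi> z" for z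
  proof -
    let ?L = "\<Sum>t\<in>UNIV. of_nat (a t) * lform (c t) ?e / lform (c t) z"
    have "wirt ?e ?G z = wirt ?e (\<lambda>z. seval g \<sigma> z * kern m \<sigma> z) z * \<psi> z + (seval g \<sigma> z * kern m \<sigma> z) * wirt ?e \<psi> z"
      by (rule wirt_mult[OF Ck_1_differentiable[OF Ck] Ck_1_differentiable[OF Ck\<psi>]])
    also have "wirt ?e (\<lambda>z. seval g \<sigma> z * kern m \<sigma> z) z =
        seval (pderiv_s j g) \<sigma> z * kern m \<sigma> z + seval g \<sigma> z * ((\<sigma> - of_nat m) * ?L * kern m \<sigma> z)"
      unfolding wirt_mult[OF Ck_1_differentiable[OF Ck_seval] Ck_1_differentiable[OF kern_derivative(1)[OF \<sigma>]]]
        wirt_seval kern_derivative(2)[OF \<sigma>] ..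
    also have "\<dots> = seval (dnum j m g) \<sigma> z * kern (Suc m) \<sigma> z"
    proof (cases "lpow a z = 0")
      case True
      hence "wt (ray \<sigma>) z = 0" using lpow_eq_0_iff by blast
      thus ?thesis by (simp add: kern_def)
    next
      case False
      hence k: "kern m \<sigma> z = kern (Suc m) \<sigma> z * lpow a z" by (simp add: kern_def)
      show ?thesis unfolding k dnum_def seval_mult seval_add seval_minus_of_nat
        by (simp add: log_derivative_lpow[OF False] algebra_simps)
    qed
    finally show ?thesis .
  qed
  have "0 = (LINT z|lborel. wirt ?e ?G z)"
    by (rule integral_wirt_0[OF Ck_mult[OF Ck Ck\<psi>], of R, symmetric]) (use R in auto)
  also have "\<dots> = pair (dnum j m g) (Suc m) \<psi> \<sigma> + pair g m (wirt ?e \<psi>) \<sigma>"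
    unfolding ptw pair_def
    by (rule Bochner_Integration.integral_add; rule integrable_pair) (use \<sigma> \<psi> in \<open>auto intro: test_function_wirt\<close>)
  finally show ?thesis by (simp add: eq_neg_iff_add_eq_0)
qed

text \<open>The pairing is defined on a representation \<open>g / f^m\<close>, not on the fraction
  itself; the existential quantifier spares a proof of independence, and \<open>pair_lift\<close>
  brings two representations to a common denominator.\<close>

definition good :: "nat \<Rightarrow> 'n cpoly_s fract \<Rightarrow> bool" where
  "good K u \<longleftrightarrow> (\<exists>g m. u = to_fract g / emb ff ^ m \<and> (\<forall>\<psi>. test_function \<psi> \<longrightarrow> tame K (pair g m \<psi>)))"

text \<open>The coefficients of \<open>h\<close>, polynomials in \<open>z\<close>, are moved into
  the test function; powers of \<open>s\<close> become multiplication by the entire function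
  \<sigma>.\<close>

lemma tame_pair_mult:
  assumes "\<And>\<psi>. test_function \<psi> \<Longrightarrow> tame K (pair g m \<psi>)" "test_function \<psi>"
  shows "tame K (pair (h * g) m \<psi>)"
  using assms(2)
proof (induction h arbitrary: \<psi>)
  case 0
  have "pair (0 * g) m \<psi> = (\<lambda>\<sigma>. 0)" by (rule ext) (simp add: pair_def)
  thus ?case by (simp add: tame_0)
next
  case (pCons p h)
  have t: "test_function (\<lambda>z. peval p z * \<psi> z)" by (intro test_function_mult Ck_peval pCons.prems)
  show ?case
  proof (rule tame_cong[where M = "real m"])
    show "tame K (\<lambda>\<sigma>. pair g m (\<lambda>z. peval p z * \<psi> z) \<sigma> + \<sigma> * pair (h * g) m \<psi> \<sigma>)"
      by (intro tame_add tame_mult[where p = "\<lambda>\<sigma>. \<sigma>"] assms(1) t pCons.IH pCons.prems holomorphic_intros)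
    fix \<sigma> assume \<sigma>: "Re \<sigma> > real m"
    have "pair (pCons p h * g) m \<psi> \<sigma> = (LINT z|lborel. seval g \<sigma> z * kern m \<sigma> z * (peval p z * \<psi> z) +
        \<sigma> * (seval (h * g) \<sigma> z * kern m \<sigma> z * \<psi> z))"
      unfolding pair_def by (rule Bochner_Integration.integral_cong[OF refl], unfold seval_mult seval_pCons) (simp add: algebra_simps)
    also have "\<dots> = pair g m (\<lambda>z. peval p z * \<psi> z) \<sigma> + \<sigma> * pair (h * g) m \<psi> \<sigma>"
      unfolding pair_def
      by (subst Bochner_Integration.integral_add[OF integrable_pair[OF \<sigma> t] integrable_mult_right[OF integrable_pair[OF \<sigma> pCons.prems]]])
        (simp only: integral_mult_right_zero)
    finally show "pair g m (\<lambda>z. peval p z * \<psi> z) \<sigma> + \<sigma> * pair (h * g) m \<psi> \<sigma> = pair (pCons p h * g) m \<psi> \<sigma>" ..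
  qed
qed

lemma pair_lift: "seval (g * [:ff:] ^ k) \<sigma> z * kern (m + k) \<sigma> z = seval g \<sigma> z * kern m \<sigma> z"
proof (cases "lpow a z = 0")
  case True
  hence "wt (ray \<sigma>) z = 0" using lpow_eq_0_iff by blast
  thus ?thesis by (simp add: kern_def)
next
  case False
  thus ?thesis unfolding seval_mult seval_power by (simp add: kern_def power_add)
qed

lemma good_add:
  assumes "good K u" "good K w"
  shows "good K (u + w)"
proof -
  have F0: "emb ff \<noteq> 0" by simp
  obtain g m where g: "u = to_fract g / emb ff ^ m" "\<And>\<psi>. test_function \<psi> \<Longrightarrow> tame K (pair g m \<psi>)"
    using assms(1) unfolding good_def by blast
  obtain h k where h: "w = to_fract h / emb ff ^ k" "\<And>\<psi>. test_function \<psi> \<Longrightarrow> tame K (pair h k \<psi>)"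
    using assms(2) unfolding good_def by blast
  let ?q = "g * [:ff:] ^ k + h * [:ff:] ^ m"
  have pow: "to_fract ([:ff:] ^ l) = emb ff ^ l" for l by (induction l) (simp_all only: power_0 power_Suc to_fract_1 to_fract_mult emb_def)
  have "to_fract ?q = to_fract g * emb ff ^ k + to_fract h * emb ff ^ m"
    by (simp only: to_fract_add to_fract_mult pow)
  hence "u + w = to_fract ?q / emb ff ^ (m + k)"
    unfolding g(1) h(1) using F0 by (simp add: power_add field_simps del: emb_simps)
  moreover have "tame K (pair ?q (m + k) \<psi>)" if \<psi>: "test_function \<psi>" for \<psi>
  proof (rule tame_cong[where M = "real (m + k)"])
    show "tame K (\<lambda>\<sigma>. pair g m \<psi> \<sigma> + pair h k \<psi> \<sigma>)" by (intro tame_add g(2) h(2) \<psi>)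
    fix \<sigma> assume \<sigma>: "Re \<sigma> > real (m + k)"
    have "pair ?q (m + k) \<psi> \<sigma> = (LINT z|lborel. seval g \<sigma> z * kern m \<sigma> z * \<psi> z + seval h \<sigma> z * kern k \<sigma> z * \<psi> z)"
      unfolding pair_def
    proof (rule Bochner_Integration.integral_cong[OF refl])
      fix z
      show "seval ?q \<sigma> z * kern (m + k) \<sigma> z * \<psi> z = seval g \<sigma> z * kern m \<sigma> z * \<psi> z + seval h \<sigma> z * kern k \<sigma> z * \<psi> z"
        using pair_lift[of g k \<sigma> z m] pair_lift[of h m \<sigma> z k]
        by (simp only: seval_add distrib_right add.commute[of k m] simp_thms)
    qed
    also have "\<dots> = pair g m \<psi> \<sigma> + pair h k \<psi> \<sigma>"
      unfolding pair_def by (rule Bochner_Integration.integral_add; rule integrable_pair) (use \<sigma> \<psi> in auto)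
    finally show "pair g m \<psi> \<sigma> + pair h k \<psi> \<sigma> = pair ?q (m + k) \<psi> \<sigma>" ..
  qed
  ultimately show ?thesis unfolding good_def by blast
qed

lemma good_mult:
  assumes "good K u"
  shows "good K (to_fract h * u)"
proof -
  obtain g m where g: "u = to_fract g / emb ff ^ m" "\<And>\<psi>. test_function \<psi> \<Longrightarrow> tame K (pair g m \<psi>)"
    using assms unfolding good_def by blast
  have "to_fract h * u = to_fract (h * g) / emb ff ^ m"
    unfolding g(1) to_fract_mult by (rule times_divide_eq_right)
  thus ?thesis unfolding good_def using tame_pair_mult[OF g(2)] by blast
qed

lemma pderiv_s_power: "to_fract (pderiv_s j (p ^ m)) * to_fract p = of_nat m * to_fract (pderiv_s j p) * to_fract p ^ m"
proof (induction m)
  case 0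
  have "pderiv_s j 1 = 0" using pderiv_s_map_Const[of j 1] by (simp add: map_poly_1' flip: one_pCons)
  thus ?case by simp
next
  case (Suc m)
  have "to_fract (pderiv_s j (p ^ Suc m)) * to_fract p =
      to_fract (pderiv_s j p) * to_fract (p ^ m) * to_fract p + to_fract p * (to_fract (pderiv_s j (p ^ m)) * to_fract p)"
    by (simp add: pderiv_s_mult algebra_simps)
  moreover have "to_fract (p ^ m) = to_fract p ^ m" by (induction m) auto
  ultimately show ?case unfolding Suc.IH by (simp add: algebra_simps)
qed

lemma twisted_deriv_quotient:
  "twisted_deriv ff j (to_fract g / emb ff ^ m) = to_fract (dnum j m g) / emb ff ^ Suc m"
proof -
  define F where "F = emb ff"
  define D where "D = emb (pderiv_var j ff)"
  define G where "G = to_fract g"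
  define G' where "G' = to_fract (pderiv_s j g)"
  define H' where "H' = to_fract (pderiv_s j ([:ff:] ^ m))"
  have F0: "F \<noteq> 0" by (simp add: F_def)
  have pow: "to_fract ([:ff:] ^ l) = F ^ l" for l
    by (induction l) (simp_all only: power_0 power_Suc to_fract_1 to_fract_mult emb_def F_def)
  have nz: "[:ff:] ^ m \<noteq> 0" by simp
  have HF: "H' * F = of_nat m * D * F ^ m"
    using pderiv_s_power[of j "[:ff:]" m] by (simp only: H'_def F_def D_def emb_def pderiv_s_pCons)
  hence H': "H' = of_nat m * D * F ^ m / F" using F0 by (simp add: field_simps)
  have Fr: "to_fract g / emb ff ^ m = Fract g ([:ff:] ^ m)"
    using pow[of m] by (simp only: Fract_conv_to_fract F_def)
  have "fderiv j (to_fract g / emb ff ^ m) = to_fract (pderiv_s j g * [:ff:] ^ m - g * pderiv_s j ([:ff:] ^ m)) /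
      to_fract ([:ff:] ^ m * [:ff:] ^ m)"
    unfolding Fr fderiv_Fract[OF nz] by (rule Fract_conv_to_fract)
  also have "\<dots> = (G' * F ^ m - G * H') / (F ^ m * F ^ m)"
    by (simp only: to_fract_diff to_fract_mult pow G_def G'_def H'_def)
  also have "\<dots> = G' / F ^ m - of_nat m * G * D / (F * F ^ m)"
    unfolding H' using F0 by (simp add: field_simps)
  finally have fd: "fderiv j (to_fract g / emb ff ^ m) = G' / F ^ m - of_nat m * G * D / (F * F ^ m)" .
  have "twisted_deriv ff j (to_fract g / emb ff ^ m) = G' / F ^ m - of_nat m * G * D / (F * F ^ m) + svar * (G / F ^ m) * D / F"
    unfolding twisted_deriv_def fd by (simp only: svar_def G_def F_def D_def emb_def)
  also have "\<dots> = (F * G' + (svar - of_nat m) * G * D) / (F * F ^ m)"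
    using F0 by (simp add: field_simps)
  also have "F * G' + (svar - of_nat m) * G * D = to_fract (dnum j m g)"
    by (simp only: dnum_def to_fract_add to_fract_mult to_fract_diff to_fract_of_nat F_def G_def G'_def D_def svar_def emb_def)
  finally show ?thesis by (simp only: F_def power_Suc)
qed

lemma good_deriv:
  assumes "good K u"
  shows "good K (twisted_deriv ff j u)"
proof -
  obtain g m where g: "u = to_fract g / emb ff ^ m" "\<And>\<psi>. test_function \<psi> \<Longrightarrow> tame K (pair g m \<psi>)"
    using assms unfolding good_def by blast
  have "tame K (pair (dnum j m g) (Suc m) \<psi>)" if \<psi>: "test_function \<psi>" for \<psi>
  proof (rule tame_cong[where M = "real m + 1"])
    show "tame K (\<lambda>\<sigma>. -1 * pair g m (wirt (axis j 1) \<psi>) \<sigma>)"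
      by (rule tame_mult[OF holomorphic_on_const g(2)[OF test_function_wirt[OF \<psi>]]])
    show "-1 * pair g m (wirt (axis j 1) \<psi>) \<sigma> = pair (dnum j m g) (Suc m) \<psi> \<sigma>" if "Re \<sigma> > real m + 1" for \<sigma>
      using pair_by_parts[OF that \<psi>, of j g] by simp
  qed
  thus ?thesis unfolding good_def g(1) twisted_deriv_quotient by blast
qed

lemma good_weyl: "P \<in> weyl_operators ff \<Longrightarrow> good K u \<Longrightarrow> good K (P u)"
proof (induction arbitrary: u rule: weyl_operators.induct)
  case (comp P Q)
  thus ?case by simp
qed (auto intro: good_mult good_deriv good_add)

text \<open>All exponents are positive, so \<open>f\<close> contains a form with index in
  \<open>bas UNIV\<close>; the remaining forms go into the test function. This is where the factor
  of the hyperplane is saved.\<close>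

lemma good_start:
  assumes "K > 0"
  shows "good K (emb ff)"
proof -
  obtain i where i: "i \<in> bas UNIV" using bas_nonempty[of UNIV] by auto
  have "tame K (pair [:ff:] 0 \<psi>)" if \<psi>: "test_function \<psi>" for \<psi>
  proof (rule tame_cong[where M = 0])
    let ?b = "a(i := a i - 1)"
    show "tame K (\<lambda>\<sigma>. zint (ray \<sigma>) (\<lambda>z. lform (c i) z * (lpow ?b z * \<psi> z)))"
      by (rule tame_lform[OF i test_function_lpow[OF \<psi>] assms])
    have "lpow a z = lform (c i) z * lpow ?b z" for z
      using lpow_Suc[of ?b i z] a_pos[of i] by simp
    thus "zint (ray \<sigma>) (\<lambda>z. lform (c i) z * (lpow ?b z * \<psi> z)) = pair [:ff:] 0 \<psi> \<sigma>" for \<sigma>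
      unfolding zint_def pair_def by (simp add: kern_def mult_ac)
  qed
  moreover have "emb ff = to_fract [:ff:] / emb ff ^ 0" by (simp add: emb_def)
  ultimately show ?thesis unfolding good_def by blast
qed

text \<open>Weyl operators preserve goodness, so the functional equation makes the product of the
  polynomial and \<open>Z0\<close> tame.\<close>

theorem bernstein_sato_root:
  assumes gen: "(\<chi> i. of_nat (a i) / of_nat A) \<in> generic"
  shows "poly (bernstein_sato_poly ff) (- dimn / of_nat A) = 0"
proof (rule root_of_tame[OF gen])
  let ?b = "bernstein_sato_poly ff"
  show "poly ?b holomorphic_on UNIV" by (intro holomorphic_intros)
  fix K :: nat assume K: "K > 0"
  obtain P where P: "P \<in> weyl_operators ff" "P (emb ff) = to_fract (map_poly Const ?b)"
    using bernstein_sato_exists unfolding bernstein_sato_relation_def emb_def by blast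
  have "good K (to_fract (map_poly Const ?b))"
    using good_weyl[OF P(1) good_start[OF K]] unfolding P(2) .
  then obtain g m where g: "to_fract (map_poly Const ?b) = to_fract g / emb ff ^ m"
    "\<And>\<psi>. test_function \<psi> \<Longrightarrow> tame K (pair g m \<psi>)"
    unfolding good_def by blast
  have pow: "to_fract ([:ff:] ^ l) = emb ff ^ l" for l
    by (induction l) (simp_all only: power_0 power_Suc to_fract_1 to_fract_mult emb_def)
  \<comment> \<open>The representation supplied by \<open>good\<close> may have a denominator.
    Clearing it identifies \<open>g\<close> as the polynomial times \<open>f^m\<close>, and
    \<open>kern m\<close> divides \<open>f^m\<close> out again.\<close>
  have "emb ff ^ m \<noteq> 0" by simp
  hence "to_fract g = to_fract (map_poly Const ?b) * emb ff ^ m"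
    unfolding g(1) by (rule nonzero_divide_eq_eq[THEN iffD1, OF _ refl])
  hence "to_fract g = to_fract (map_poly Const ?b * [:ff:] ^ m)" by (simp only: to_fract_mult pow)
  hence gb: "g = map_poly Const ?b * [:ff:] ^ m" by (simp only: to_fract_eq_iff)
  show "tame K (\<lambda>\<sigma>. poly ?b \<sigma> * Z0 \<sigma>)"
  proof (rule tame_cong[where M = 0])
    show "tame K (pair g m \<phi>)" by (rule g(2)[OF test])
    fix \<sigma>
    have "seval g \<sigma> z * kern m \<sigma> z = poly ?b \<sigma> * wt (ray \<sigma>) z" for z
      using pair_lift[of "map_poly Const ?b" m \<sigma> z 0] unfolding gb by (simp add: kern_def)
    thus "pair g m \<phi> \<sigma> = poly ?b \<sigma> * Z0 \<sigma>"
      unfolding pair_def Z0_def zint_def by (simp add: mult.assoc)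
  qed
qed

lemma zeta_integrand: "of_real (norm (peval ff z)) powr (2 * s) = wt (ray s) z"
proof (cases "lpow a z = 0")
  case True
  moreover have "wt (ray s) z = 0" using True lpow_eq_0_iff by blast
  ultimately show ?thesis by simp
next
  case False
  have nz: "lform (c t) z \<noteq> 0" for t using False a_pos[of t] by (auto simp: lpow_def)
  have "ln (norm (lpow a z)) = (\<Sum>i\<in>UNIV. real (a i) * ln (norm (lform (c i) z)))"
    using nz by (simp add: lpow_def norm_power ln_prod ln_realpow flip: prod_norm)
  hence "abs_powr s (lpow a z) = exp (\<Sum>i\<in>UNIV. 2 * (s * of_nat (a i)) * of_real (ln (norm (lform (c i) z))))"
    using False by (simp add: abs_powr_exp sum_distrib_left mult_ac)
  also have "\<dots> = wt (ray s) z" by (simp add: wt_def abs_powr_exp[OF nz] exp_sum)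
  finally show ?thesis by (simp add: abs_powr_def)
qed

text \<open>The continuation found above satisfies the defining description, and
  \<open>nicely_meromorphic_extension_unique\<close> shows that nothing else does.\<close>

theorem archimedean_zeta_pole:
  assumes "(\<chi> i. of_nat (a i) / of_nat A) \<in> generic"
  shows "is_pole (archimedean_zeta ff \<phi>) (- dimn / of_nat A)"
proof -
  obtain Z where Z: "Z nicely_meromorphic_on UNIV" "\<And>s. Re s > 0 \<Longrightarrow> Z s = Z0 s"
    "\<And>\<sigma>1. is_pole Y \<sigma>1 \<Longrightarrow> is_pole Z \<sigma>1"
    using continuation_exists by blast
  have int: "(LINT z|lborel. of_real (norm (peval ff z)) powr (2 * s) * \<phi> z) = Z0 s" for s
    by (simp only: zeta_integrand Z0_def zint_def)
  have "archimedean_zeta ff \<phi> = Z"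
    unfolding archimedean_zeta_def int
  proof (rule the_equality)
    fix W assume "W nicely_meromorphic_on UNIV \<and> (\<forall>s. 0 < Re s \<longrightarrow> W s = Z0 s)"
    thus "W = Z" using Z(1,2) by (intro nicely_meromorphic_extension_unique) auto
  qed (use Z in auto)
  thus ?thesis using Z(3)[OF pole_of_generic[OF assms]] by simp
qed

end

theorem theorem1p7:
  fixes f :: "'r::finite \<Rightarrow> ('n::{finite,linorder}) cpoly"
    and \<phi> :: "complex ^ ('n::{finite,linorder}) \<Rightarrow> complex"
  assumes "\<And>i. \<not> constant_poly (f i)"
    and "\<And>i. homogeneous 1 (f i)"
    and "central (range (\<lambda>i. zero_locus (f i)))"
    and "essential (range (\<lambda>i. zero_locus (f i)))"
    and "\<not> decomposable (\<Prod>i\<in>UNIV. f i)"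
    and "test_function \<phi>"
    and "\<phi> 0 > 0"
    and "\<And>z. \<phi> z \<ge> 0"
  shows "\<exists>U :: (complex ^ 'r) set.
    U \<noteq> {} \<and> analytically_open {a. (\<Sum>i\<in>UNIV. a $ i) = 1} U \<and>
    (\<forall>a :: 'r \<Rightarrow> nat.
       (\<forall>i. a i > 0) \<and> (\<chi> i. of_nat (a i) / of_nat (\<Sum>j\<in>UNIV. a j)) \<in> U \<longrightarrow>
         is_pole (archimedean_zeta (\<Prod>i\<in>UNIV. f i ^ a i) \<phi>)
           (- of_nat CARD('n) / of_nat (\<Sum>j\<in>UNIV. a j)) \<and>
         poly (bernstein_sato_poly (\<Prod>i\<in>UNIV. f i ^ a i))
           (- of_nat CARD('n) / of_nat (\<Sum>j\<in>UNIV. a j)) = 0)"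
  proof -
  have "\<exists>c. f i = linpoly c" for i
    using homogeneous_1_linpoly[OF assms(2)] by blast
  then obtain c where c: "\<And>i. f i = linpoly (c i)" by metis
  have arr: "arrangement c"
  proof
    fix i show "c i \<noteq> 0"
    proof
      assume "c i = 0"
      hence "f i = Const 0" by (simp add: c)
      thus False using assms(1)[of i] unfolding constant_poly_def by blast
    qed
  next
    fix z assume "\<And>i. lform (c i) z = 0"
    hence "z \<in> \<Inter> (range (\<lambda>i. zero_locus (f i)))" by (simp add: zero_locus_def c)
    moreover have "\<Inter> (range (\<lambda>i. zero_locus (f i))) = {0}" using assms(4) by (simp only: essential_def)
    ultimately show "z = 0" by blast
  qed
  interpret arrangement c by (rule arr)
  \<comment> \<open>Indecomposability enters here, as connectedness of the matroid.\<close>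
  have irr: "rk T + rk (-T) \<noteq> CARD('n)" if "T \<noteq> {}" "T \<noteq> UNIV" for T
    using rank_sum_decomposable[OF arr that] assms(5) by (auto simp: c)
  \<comment> \<open>\<open>zint_continuation\<close> gives \<open>L\<close> and \<open>R\<close> for
    each \<open>K\<close> separately; the axiom of choice collects them into the functions that
    \<open>continued_arrangement\<close> fixes.\<close>
  obtain LL RR where LR: "\<And>K. admissible (LL K)"
      "\<And>K s. s \<in> orthant (-(real K/2)) \<Longrightarrow> cdiff_at (RR K) s"
      "\<And>K s. s \<in> orthant 1 \<Longrightarrow> ev (LL K) s * (of_nat CARD('n) + (\<Sum>i\<in>UNIV. s $ i)) * zint s \<phi> = RR K s"
      "\<And>K i \<psi>. i \<in> bas UNIV \<Longrightarrow> test_function \<psi> \<Longrightarrow>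
         extends K (\<lambda>s. ev (LL K) s * zint s (\<lambda>z. lform (c i) z * \<psi> z))"
  proof -
    let ?P = "\<lambda>K L R. admissible L \<and> (\<forall>s\<in>orthant (-(real K/2)). cdiff_at R s) \<and>
      (\<forall>s\<in>orthant 1. ev L s * (of_nat CARD('n) + (\<Sum>i\<in>UNIV. s $ i)) * zint s \<phi> = R s) \<and>
      (\<forall>i\<in>bas UNIV. \<forall>\<psi>. test_function \<psi> \<longrightarrow> extends K (\<lambda>s. ev L s * zint s (\<lambda>z. lform (c i) z * \<psi> z)))"
    have "\<forall>K. \<exists>LR. ?P K (fst LR) (snd LR)"
    proof
      fix K
      obtain L R where P: "?P K L R" using zint_continuation[OF assms(6), of K] by (elim exE)
      show "\<exists>LR. ?P K (fst LR) (snd LR)" by (rule exI[of _ "(L, R)"], unfold fst_conv snd_conv) (rule P)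
    qed
    from choice[OF this] obtain LR where LR: "\<forall>K. ?P K (fst (LR K)) (snd (LR K))" by (elim exE)
    show thesis
      by (rule that[of "\<lambda>K. fst (LR K)" "\<lambda>K. snd (LR K)"]; use LR in blast)
  qed
  interpret continued_arrangement c \<phi> LL RR
    by unfold_locales (fact assms(6) LR)+
  show ?thesis
  proof (intro exI[of _ generic] conjI allI impI)
    show "generic \<noteq> {}"
      by (rule generic_nonempty[OF irr assms(8,7)])
    show "analytically_open {a. (\<Sum>i\<in>UNIV. a $ i) = 1} generic"
      using analytically_open_generic by (simp only: hyper_def)
    fix a :: "'r \<Rightarrow> nat"
    assume a: "(\<forall>i. a i > 0) \<and> (\<chi> i. of_nat (a i) / of_nat (\<Sum>j\<in>UNIV. a j)) \<in> generic"
    interpret zeta_poly c \<phi> LL RR a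
      by unfold_locales (use a in auto)
    have ff: "(\<Prod>i\<in>UNIV. f i ^ a i) = fpow a" by (simp add: c fpow_def)
    have gen: "(\<chi> i. of_nat (a i) / of_nat A) \<in> generic" using a by (simp add: A_def)
    have pt: "- of_nat CARD('n) / of_nat (\<Sum>j\<in>UNIV. a j) = - dimn / of_nat A" by (simp add: dimn_eq A_def)
    show "is_pole (archimedean_zeta (\<Prod>i\<in>UNIV. f i ^ a i) \<phi>) (- of_nat CARD('n) / of_nat (\<Sum>j\<in>UNIV. a j))"
      unfolding ff pt by (rule archimedean_zeta_pole[OF gen])
    show "poly (bernstein_sato_poly (\<Prod>i\<in>UNIV. f i ^ a i)) (- of_nat CARD('n) / of_nat (\<Sum>j\<in>UNIV. a j)) = 0"
      unfolding ff pt by (rule bernstein_sato_root[OF gen])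
  qed
qed


end
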